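(* Let $G$ be a group and assume that $\mathcal{CO}(G)$ is non-empty. Let $C_0=\bigcap_{H\in\mathcal{H}}H$, where $\mathcal{H}$ is the set of (proper) subgroups $H$ of $G$ with $\mathcal{CO}_H(G)\neq\emptyset$. Then the following conditions are equivalent: (a) All the elements of $\mathcal{CO}(G)$ are isolated (in the space $\mathcal{CO}(G)$). (b) There exists a finite rational series $G_0\trianglelefteq G_1\trianglelefteq\cdots\trianglelefteq G_n=G$ starting on $G$ of maximal length, and this series has no abelian jumps and satisfies $\mathcal{CO}(G_0)=\emptyset$. (c) There exists a unique finite rational series $G_0\trianglelefteq G_1\trianglelefteq\cdots\trianglelefteq G_n=G$ starting on $G$ of maximal length, and this series has no abelian jumps and satisfies $\mathcal{CO}(G_0)=\emptyset$. (d) There exists a finite rational series $G_0\trianglelefteq G_1\trianglelefteq\cdots\trianglelefteq G_n=G$ starting on $G$ with $G_0=C_0$, and this series has no abelian jumps. (e) There exists a unique finite rational series $G_0\trianglelefteq G_1\trianglelefteq\cdots\trianglelefteq G_n=G$ starting on $G$ with $G_0=C_0$, and this series has no abelian jumps. (f) $\mathcal{CO}_{C_0}(G)$ is finite. (g) $\mathcal{CO}(G)$ is finite. Moreover, under these equivalent conditions, $|\mathcal{CO}(G)|=2^{n+1}-2$ and $|\mathcal{CO}_{C_0}(G)|=2^n$, where $n$ is the length of any series as in (b), (c), (d) and (e).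
   Context: A left-preorder on a group $G$ is a binary relation $\preceq$ on $G$ that is total, transitive and reflexive, that is left-invariant ($\alpha_1\preceq\alpha_2$ implies $\alpha\alpha_1\preceq\alpha\alpha_2$), and that is not the trivial relation (the one with $\alpha_1\preceq\alpha_2$ for all $\alpha_1,\alpha_2$). Write $\alpha\prec\beta$ if $\alpha\preceq\beta$ and not $\beta\preceq\alpha$. The set $C=\{\alpha\in G: \alpha\preceq 1\text{ and }1\preceq\alpha\}$ is a proper subgroup of $G$, and $\preceq$ is called a left-preorder on $G$ relative to $C$. Its positive cone is $P=\{\alpha\in G:1\prec\alpha\}$, and $G=P\sqcup P^{-1}\sqcup C$. A left-preorder is Conradian if for all $\alpha,\beta\in G$ with $1\prec\alpha$ and $1\prec\beta$ there is $n\in\mathbb{N}$ ($0\in\mathbb N$) with $\alpha\prec\beta\alpha^n$. $\mathcal{CO}(G)$ is the set of all Conradian left-preorders on $G$, and for a proper subgroup $C$, $\mathcal{CO}_C(G)$ is the set of those relative to $C$. Topology: each left-preorder is identified with the map $G\to\{\pm1,0\}$ sending $P$ to $1$, $P^{-1}$ to $-1$ and $C$ to $0$. The sets $\mathcal{CO}(G)$ and $\mathcal{CO}_C(G)$ carry the subspace topology from $\{\pm1,0\}^G$ with the product topology ($\{\pm1,0\}$ discrete). A rational series starting on $G$ is a finite series of subgroups $G_0\trianglelefteq G_1\trianglelefteq\cdots\trianglelefteq G_n=G$ such that each $G_i$ is normal in $G_{i+1}$ and $G_{i+1}/G_i$ is torsion-free abelian of rank $1$ for all $0\le i<n$; its length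 is $n$. It is of maximal length if every other rational series $K_0\trianglelefteq\cdots\trianglelefteq K_k=G$ starting on $G$ has $k\le n$. An abelian jump of the series is a subseries $G_i\trianglelefteq G_{i+1}\trianglelefteq G_{i+2}$ ($0\le i\le n-2$) such that $G_i$ is normal in $G_{i+2}$ and $G_{i+2}/G_i$ is abelian. In (c), uniqueness is among all rational series starting on $G$ of maximal length; in (e), among all rational series starting on $G$ with $G_0=C_0$. *)

theory Defs
  imports "HOL-Algebra.Coset" "HOL-Algebra.FiniteProduct" "HOL-Analysis.Function_Topology"
begin

section \<open>Conradian left-preorders\<close>

text \<open>The pair \<open>(a, b) \<in> R\<close> stands for \<open>a \<preceq> b\<close>. The inclusion \<open>R \<subseteq> carrier G \<times> carrier G\<close>
  makes distinct preorders on the group distinct HOL relations, so that cardinalities are correct.\<close>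

definition left_preorder :: "('a, 'b) monoid_scheme \<Rightarrow> 'a rel \<Rightarrow> bool" where
  "left_preorder G R \<longleftrightarrow>
     R \<subseteq> carrier G \<times> carrier G \<and>
     refl_on (carrier G) R \<and> total_on (carrier G) R \<and> trans R \<and>
     (\<forall>c\<in>carrier G. \<forall>a\<in>carrier G. \<forall>b\<in>carrier G. (a, b) \<in> R \<longrightarrow> (c \<otimes>\<^bsub>G\<^esub> a, c \<otimes>\<^bsub>G\<^esub> b) \<in> R) \<and>
     R \<noteq> carrier G \<times> carrier G"

definition strictly_less :: "'a rel \<Rightarrow> 'a \<Rightarrow> 'a \<Rightarrow> bool" where
  "strictly_less R a b \<longleftrightarrow> (a, b) \<in> R \<and> (b, a) \<notin> R"

definition preorder_subgroup :: "('a, 'b) monoid_scheme \<Rightarrow> 'a rel \<Rightarrow> 'a set" where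
  "preorder_subgroup G R = {a \<in> carrier G. (a, \<one>\<^bsub>G\<^esub>) \<in> R \<and> (\<one>\<^bsub>G\<^esub>, a) \<in> R}"

definition positive_cone :: "('a, 'b) monoid_scheme \<Rightarrow> 'a rel \<Rightarrow> 'a set" where
  "positive_cone G R = {a \<in> carrier G. strictly_less R \<one>\<^bsub>G\<^esub> a}"

definition conradian :: "('a, 'b) monoid_scheme \<Rightarrow> 'a rel \<Rightarrow> bool" where
  "conradian G R \<longleftrightarrow>
     (\<forall>a\<in>carrier G. \<forall>b\<in>carrier G.
        strictly_less R \<one>\<^bsub>G\<^esub> a \<and> strictly_less R \<one>\<^bsub>G\<^esub> b \<longrightarrow>
        (\<exists>n::nat. strictly_less R a (b \<otimes>\<^bsub>G\<^esub> a [^]\<^bsub>G\<^esub> n)))"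

definition CO :: "('a, 'b) monoid_scheme \<Rightarrow> 'a rel set" where
  "CO G = {R. left_preorder G R \<and> conradian G R}"

definition CO_rel :: "('a, 'b) monoid_scheme \<Rightarrow> 'a set \<Rightarrow> 'a rel set" where
  "CO_rel G C = {R \<in> CO G. preorder_subgroup G R = C}"

text \<open>The family intersected here is non-empty as soon as \<open>CO G \<noteq> {}\<close>; otherwise the intersection
  is \<open>UNIV\<close> and has no meaning.\<close>

definition C0 :: "('a, 'b) monoid_scheme \<Rightarrow> 'a set" where
  "C0 G = \<Inter> {H. subgroup H G \<and> H \<noteq> carrier G \<and> CO_rel G H \<noteq> {}}"


section \<open>The topology\<close>

definition sign_map :: "('a, 'b) monoid_scheme \<Rightarrow> 'a rel \<Rightarrow> 'a \<Rightarrow> int" where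
  "sign_map G R =
     (\<lambda>a\<in>carrier G. if a \<in> positive_cone G R then 1
                    else if a \<in> set_inv\<^bsub>G\<^esub> (positive_cone G R) then -1 else 0)"

text \<open>Since \<^term>\<open>sign_map G\<close> is injective on \<^term>\<open>CO G\<close>, pulling the product topology back along it
  is the same as identifying \<^term>\<open>CO G\<close> with its image and taking the subspace topology.\<close>

definition CO_topology :: "('a, 'b) monoid_scheme \<Rightarrow> 'a rel topology" where
  "CO_topology G =
     pullback_topology (CO G) (sign_map G)
       (product_topology (\<lambda>_. discrete_topology {1, -1, 0}) (carrier G))"

definition isolated_point :: "'a topology \<Rightarrow> 'a \<Rightarrow> bool" where
  "isolated_point X x \<longleftrightarrow> x \<in> topspace X \<and> openin X {x}"


section \<open>Torsion-free abelian groups and their rank\<close>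

definition torsion_free :: "('a, 'b) monoid_scheme \<Rightarrow> bool" where
  "torsion_free A \<longleftrightarrow>
     (\<forall>x\<in>carrier A. \<forall>n::nat. n > 0 \<and> x [^]\<^bsub>A\<^esub> n = \<one>\<^bsub>A\<^esub> \<longrightarrow> x = \<one>\<^bsub>A\<^esub>)"

definition Z_independent :: "('a, 'b) monoid_scheme \<Rightarrow> 'a set \<Rightarrow> bool" where
  "Z_independent A S \<longleftrightarrow> S \<subseteq> carrier A \<and>
     (\<forall>T (f :: 'a \<Rightarrow> int). finite T \<and> T \<subseteq> S \<and> (\<Otimes>\<^bsub>A\<^esub>x\<in>T. x [^]\<^bsub>A\<^esub> f x) = \<one>\<^bsub>A\<^esub>
        \<longrightarrow> (\<forall>x\<in>T. f x = 0))"

text \<open>Rank of an abelian group: the cardinality of a maximal independent set.\<close>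

definition has_rank :: "('a, 'b) monoid_scheme \<Rightarrow> nat \<Rightarrow> bool" where
  "has_rank A r \<longleftrightarrow>
     (\<exists>S. Z_independent A S \<and> (\<forall>S'. Z_independent A S' \<and> S \<subseteq> S' \<longrightarrow> S' = S) \<and>
          finite S \<and> card S = r)"


section \<open>Rational series\<close>

abbreviation sub :: "('a, 'b) monoid_scheme \<Rightarrow> 'a set \<Rightarrow> ('a, 'b) monoid_scheme" where
  "sub G H \<equiv> G\<lparr>carrier := H\<rparr>"

text \<open>The series \<open>G\<^sub>0 \<unlhd> \<dots> \<unlhd> G\<^sub>n = G\<close> is the list \<open>[G\<^sub>0, \<dots>, G\<^sub>n]\<close>, which has \<open>n + 1\<close> entries.\<close>

definition rational_series :: "('a, 'b) monoid_scheme \<Rightarrow> 'a set list \<Rightarrow> bool" where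
  "rational_series G Gs \<longleftrightarrow>
     Gs \<noteq> [] \<and> (\<forall>H\<in>set Gs. subgroup H G) \<and> last Gs = carrier G \<and>
     (\<forall>i. Suc i < length Gs \<longrightarrow>
        Gs ! i \<lhd> sub G (Gs ! Suc i) \<and>
        comm_group (sub G (Gs ! Suc i) Mod Gs ! i) \<and>
        torsion_free (sub G (Gs ! Suc i) Mod Gs ! i) \<and>
        has_rank (sub G (Gs ! Suc i) Mod Gs ! i) 1)"

definition series_length :: "'a set list \<Rightarrow> nat" where
  "series_length Gs = length Gs - 1"

definition rational_series_max :: "('a, 'b) monoid_scheme \<Rightarrow> 'a set list \<Rightarrow> bool" where
  "rational_series_max G Gs \<longleftrightarrow>
     rational_series G Gs \<and>
     (\<forall>Ks. rational_series G Ks \<longrightarrow> series_length Ks \<le> series_length Gs)"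

definition abelian_jump :: "('a, 'b) monoid_scheme \<Rightarrow> 'a set list \<Rightarrow> nat \<Rightarrow> bool" where
  "abelian_jump G Gs i \<longleftrightarrow>
     i + 2 < length Gs \<and>
     Gs ! i \<lhd> sub G (Gs ! (i + 2)) \<and>
     comm_group (sub G (Gs ! (i + 2)) Mod Gs ! i)"

definition no_abelian_jumps :: "('a, 'b) monoid_scheme \<Rightarrow> 'a set list \<Rightarrow> bool" where
  "no_abelian_jumps G Gs \<longleftrightarrow> (\<nexists>i. abelian_jump G Gs i)"

end

(* A left-preorder relative to C is the same as a cone P with G = P + P^-1 + C (disjoint union), and
   the proof is carried out with Conradian cones on subgroups of G. Convex subgroups form a chain, and
   each of its jumps is an Archimedean, hence abelian, quotient. On these quotients the order can be
   changed at will without affecting the rest of the cone. An isolated cone P is determined by a finite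
   set F of its elements; so every jump meets F, there are only finitely many convex subgroups, and each
   abelian subquotient H <= K of convex subgroups has rank 1, because a torsion-free abelian group with
   an order determined by finitely many positive elements has rank 1. This yields a rational series
   without abelian jumps; it starts at C0 if P is a cone relative to C0, and such cones exist:
   take a lexicographic product of all cones on G along a well-order.
   Conversely, if a rational series without abelian jumps starts at a group without Conradian cones,
   then its next-to-last term N is convex for every Conradian cone on G: otherwise two abelian
   quotients combine to an abelian jump. Hence a cone on G is one of the two cones relative to N, possibly
   refined by a cone on N. Induction on the series gives the cardinalities and shows that every rational
   series is a final segment of the given one. *)
theory Submission
  imports Defs "HOL-Algebra.Generated_Groups"
begin

text \<open>A cone on \<open>D\<close> relative to \<open>C\<close> orders the left cosets of
  \<open>C\<close> in \<open>D\<close>. Convex subgroups need not be normal in the whole group, so a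
  quotient group is formed only once a jump is known to be abelian; until then, restricting,
  coarsening and refining change only the three sets \<open>D\<close>, \<open>C\<close> and
  \<open>P\<close>. The obstacle is that inequalities may be multiplied only from the left. The
  Conrad condition compensates for this in two ways: products of elements bounded by powers of
  \<open>h\<close> are again bounded, and \<open>x k < k k\<close> for \<open>x\<close> in
  \<open>C\<close> and positive \<open>k\<close>. The second inequality makes lexicographic products
  Conradian, with exponent 2, and leads to normality of \<open>C\<close> in the Archimedean case.
  The numbers come from rank one: a cone on such a quotient is fixed by the sign of a single
  element, so there are two of them. If \<open>D\<close> over \<open>N\<close> is the last step of a
  series without jumps, the number of cones satisfies a(D) = 2 + 2 a(N); thus a + 2 doubles with
  every step, starting from the value 2 at a group without cones.\<close>

context group
begin

lemma inv_mult_cancel [simp]: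
  "x \<in> carrier G \<Longrightarrow> y \<in> carrier G \<Longrightarrow> inv x \<otimes> (x \<otimes> y) = y"
  "x \<in> carrier G \<Longrightarrow> y \<in> carrier G \<Longrightarrow> x \<otimes> (inv x \<otimes> y) = y"
  by (simp_all flip: m_assoc)

lemmas word_simps = m_assoc inv_mult_group

lemma subgroup_nat_pow:
  "subgroup H G \<Longrightarrow> x \<in> H \<Longrightarrow> x [^] (n::nat) \<in> H"
  by (induction n) (auto simp: subgroup.one_closed subgroup.m_closed)

end

section \<open>Cones on a subgroup, their left-invariant order and convex subgroups\<close>

locale left_cone = group +
  fixes D C P
  assumes subgroup_D: "subgroup D G" and subgroup_C: "subgroup C G"
    and C_subset: "C \<subseteq> D" and P_subset: "P \<subseteq> D"
    and disjoint: "x \<in> P \<Longrightarrow> x \<notin> C"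
    and asym: "x \<in> P \<Longrightarrow> inv x \<notin> P"
    and total: "x \<in> D \<Longrightarrow> x \<in> C \<or> x \<in> P \<or> inv x \<in> P"
    and P_mult: "x \<in> P \<Longrightarrow> y \<in> P \<Longrightarrow> x \<otimes> y \<in> P"
begin

sublocale D: subgroup D G by (rule subgroup_D)
sublocale C: subgroup C G by (rule subgroup_C)

lemma in_D [simp, intro]: "x \<in> C \<Longrightarrow> x \<in> D" "x \<in> P \<Longrightarrow> x \<in> D"
  using C_subset P_subset by auto

lemma in_carrier [simp]: "x \<in> D \<Longrightarrow> x \<in> carrier G" "x \<in> C \<Longrightarrow> x \<in> carrier G" "x \<in> P \<Longrightarrow> x \<in> carrier G"
  using D.mem_carrier by auto

text \<open>Forced by totality: in the two other cases, cancelling \<open>x\<close> puts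
  \<open>x\<close> into \<open>C\<close> or \<open>inv c\<close> into \<open>P\<close>. Together
  with \<open>PC_mult\<close>, the sign of an element depends only on its double coset of
  \<open>C\<close>.\<close>

lemma CP_mult: assumes "c \<in> C" "x \<in> P" shows "c \<otimes> x \<in> P"
proof -
  have D: "c \<otimes> x \<in> D" using assms by auto
  have "c \<otimes> x \<notin> C"
  proof
    assume "c \<otimes> x \<in> C"
    then have "inv c \<otimes> (c \<otimes> x) \<in> C" using assms by blast
    then show False using assms disjoint by simp
  qed
  moreover have "inv (c \<otimes> x) \<notin> P"
  proof
    assume "inv (c \<otimes> x) \<in> P"
    then have "x \<otimes> inv (c \<otimes> x) \<in> P" using assms P_mult by blast
    then have "inv c \<in> P" using assms by (simp add: word_simps)
    then show False using assms disjoint by blast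
  qed
  ultimately show ?thesis using total[OF D] by blast
qed

lemma PC_mult: assumes "c \<in> C" "x \<in> P" shows "x \<otimes> c \<in> P"
proof -
  have D: "x \<otimes> c \<in> D" using assms by auto
  have "x \<otimes> c \<notin> C"
  proof
    assume "x \<otimes> c \<in> C"
    then have "(x \<otimes> c) \<otimes> inv c \<in> C" using assms by blast
    then show False using assms disjoint by (simp add: word_simps)
  qed
  moreover have "inv (x \<otimes> c) \<notin> P"
  proof
    assume "inv (x \<otimes> c) \<in> P"
    then have "inv (x \<otimes> c) \<otimes> x \<in> P" using assms P_mult by blast
    then have "inv c \<in> P" using assms by (simp add: word_simps)
    then show False using assms disjoint by blast
  qed
  ultimately show ?thesis using total[OF D] by blast
qed

lemma one_notin_P: "\<one> \<notin> P"
  using disjoint C.one_closed by blast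

lemma PC_PC: "x \<in> P \<union> C \<Longrightarrow> y \<in> P \<union> C \<Longrightarrow> x \<otimes> y \<in> P \<union> C"
  using P_mult PC_mult CP_mult by blast

lemma total3: assumes "x \<in> D" obtains "x \<in> C" | "x \<in> P" "x \<notin> C" | "inv x \<in> P" "x \<notin> C"
  using total[OF assms] disjoint C.m_inv_closed by blast

lemma P_pow: "x \<in> P \<Longrightarrow> x [^] Suc n \<in> P"
  by (induction n) (auto simp: P_mult)

lemma P_pow': "x \<in> P \<Longrightarrow> n > 0 \<Longrightarrow> x [^] (n::nat) \<in> P"
  using P_pow[of x "n - 1"] by simp

text \<open>Positive powers keep the sign of an element of \<open>P\<close> or of its inverse. This
  is the source of torsion-freeness for all quotients that arise from cones.\<close>

lemma isolated:
  assumes "x \<in> D" "x [^] (n::nat) \<in> C" "n > 0" shows "x \<in> C"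
  using assms(1)
proof (cases rule: total3)
  case 2
  then show ?thesis using P_pow' assms disjoint by blast
next
  case 3
  then have "inv x [^] n \<in> P" using P_pow' assms by blast
  moreover have "inv x [^] n \<in> C" using assms C.m_inv_closed by (simp add: nat_pow_inv)
  ultimately show ?thesis using disjoint by blast
qed

definition lt where "lt a b \<longleftrightarrow> inv a \<otimes> b \<in> P"
definition le where "le a b \<longleftrightarrow> inv a \<otimes> b \<in> P \<union> C"

lemma lt_le: "lt a b \<Longrightarrow> le a b" by (auto simp: lt_def le_def)

lemma lt_irrefl: "a \<in> carrier G \<Longrightarrow> \<not> lt a a"
  using one_notin_P by (auto simp: lt_def)

lemma le_refl: "a \<in> carrier G \<Longrightarrow> le a a"
  by (auto simp: le_def)

lemma mult_telescope: "\<lbrakk>a \<in> carrier G; b \<in> carrier G; c \<in> carrier G\<rbrakk>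
  \<Longrightarrow> inv a \<otimes> b \<otimes> (inv b \<otimes> c) = inv a \<otimes> c"
  by (simp add: word_simps)

lemma lt_trans: "\<lbrakk>lt a b; lt b c; a \<in> carrier G; b \<in> carrier G; c \<in> carrier G\<rbrakk> \<Longrightarrow> lt a c"
  unfolding lt_def using P_mult mult_telescope by metis

lemma le_trans: "\<lbrakk>le a b; le b c; a \<in> carrier G; b \<in> carrier G; c \<in> carrier G\<rbrakk> \<Longrightarrow> le a c"
  unfolding le_def using PC_PC mult_telescope by metis

lemma le_lt_trans: "\<lbrakk>le a b; lt b c; a \<in> carrier G; b \<in> carrier G; c \<in> carrier G\<rbrakk> \<Longrightarrow> lt a c"
  unfolding le_def lt_def using P_mult CP_mult mult_telescope by (metis Un_iff)

lemma lt_le_trans: "\<lbrakk>lt a b; le b c; a \<in> carrier G; b \<in> carrier G; c \<in> carrier G\<rbrakk> \<Longrightarrow> lt a c"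
  unfolding le_def lt_def using P_mult PC_mult mult_telescope by (metis Un_iff)

lemma not_le: assumes "a \<in> D" "b \<in> D" shows "\<not> le a b \<longleftrightarrow> lt b a"
proof -
  have D: "inv a \<otimes> b \<in> D" using assms by blast
  have i: "inv (inv a \<otimes> b) = inv b \<otimes> a" using assms by (simp add: word_simps)
  from D show ?thesis
  proof (cases rule: total3)
    case 1
    then have "inv b \<otimes> a \<in> C" using i C.m_inv_closed by metis
    then show ?thesis using 1 disjoint by (auto simp: le_def lt_def)
  next
    case 2
    then have "inv b \<otimes> a \<notin> P" using i asym by metis
    then show ?thesis using 2 by (auto simp: le_def lt_def)
  next
    case 3
    then have "inv a \<otimes> b \<notin> P" using D asym by (metis D.mem_carrier inv_inv)
    then show ?thesis using 3 i by (auto simp: le_def lt_def)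
  qed
qed

lemma lt_mult_left: "\<lbrakk>a \<in> carrier G; b \<in> carrier G; c \<in> carrier G\<rbrakk> \<Longrightarrow> lt (c \<otimes> a) (c \<otimes> b) \<longleftrightarrow> lt a b"
  by (simp add: lt_def word_simps)

lemma le_mult_left: "\<lbrakk>a \<in> carrier G; b \<in> carrier G; c \<in> carrier G\<rbrakk> \<Longrightarrow> le (c \<otimes> a) (c \<otimes> b) \<longleftrightarrow> le a b"
  by (simp add: le_def word_simps)

lemma lt_one: "a \<in> carrier G \<Longrightarrow> lt \<one> a \<longleftrightarrow> a \<in> P"
  by (simp add: lt_def)

lemma le_one: "a \<in> carrier G \<Longrightarrow> le \<one> a \<longleftrightarrow> a \<in> P \<union> C"
  by (simp add: le_def)

lemma lt_mult_P: "a \<in> carrier G \<Longrightarrow> x \<in> P \<Longrightarrow> lt a (a \<otimes> x)"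
  by (simp add: lt_def)

lemma le_mult_PC: "a \<in> carrier G \<Longrightarrow> x \<in> P \<union> C \<Longrightarrow> le a (a \<otimes> x)"
  by (auto simp: le_def)

lemma pow_PC: "x \<in> P \<Longrightarrow> x [^] (n::nat) \<in> P \<union> C"
  by (induction n) (use P_mult CP_mult in auto)

text \<open>Both cones have the same \<open>C\<close>, so an element of \<open>P' - P\<close> would
  have its inverse in \<open>P\<close> and hence in \<open>P'\<close>.\<close>

lemma cone_eqI:
  assumes "left_cone G D C P'" "P \<subseteq> P'" shows "P' = P"
proof -
  interpret P': left_cone G D C P' by fact
  have "x \<in> P" if "x \<in> P'" for x
    using total[of x] P'.disjoint P'.asym that assms P'.in_D(2) by blast
  then show ?thesis using assms by blast
qed

lemma restrict:
  assumes "subgroup E G" "E \<subseteq> D" shows "left_cone G E (C \<inter> E) (P \<inter> E)"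
proof -
  interpret E: subgroup E G by fact
  show ?thesis
  proof (intro left_cone.intro left_cone_axioms.intro group_axioms)
    show "subgroup (C \<inter> E) G" using subgroups_Inter_pair assms subgroup_C by blast
  qed (use assms disjoint asym total P_mult in auto)
qed

text \<open>Order convexity in multiplicative form: for \<open>x\<close> and \<open>y\<close> in
  \<open>P\<close>, left invariance places \<open>x\<close> between \<open>\<one>\<close> and
  \<open>x \<otimes> y\<close>.\<close>

definition convex where
  "convex H \<longleftrightarrow> subgroup H G \<and> C \<subseteq> H \<and> H \<subseteq> D \<and> (\<forall>x\<in>P. \<forall>y\<in>P. x \<otimes> y \<in> H \<longrightarrow> x \<in> H)"

lemma convexD: assumes "convex H" "x \<in> P" "y \<in> P" "x \<otimes> y \<in> H" shows "x \<in> H" "y \<in> H"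
proof -
  interpret H: subgroup H G using assms by (simp add: convex_def)
  show "x \<in> H" using assms by (auto simp: convex_def)
  then have "inv x \<otimes> (x \<otimes> y) \<in> H" using assms by blast
  then show "y \<in> H" using assms by simp
qed

lemma convex_le:
  assumes "convex H" "x \<in> P" "y \<in> H" "le x y" shows "x \<in> H"
proof -
  interpret H: subgroup H G using assms by (simp add: convex_def)
  have y: "y \<in> D" using assms by (auto simp: convex_def)
  have eq: "x \<otimes> (inv x \<otimes> y) = y" using assms y by simp
  have "inv x \<otimes> y \<in> P \<or> inv x \<otimes> y \<in> C" using assms by (auto simp: le_def)
  then show ?thesis
  proof
    assume "inv x \<otimes> y \<in> P" then show ?thesis using convexD(1)[OF assms(1,2)] eq assms by simp
  next
    assume "inv x \<otimes> y \<in> C"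
    then have "inv x \<otimes> y \<in> H" using assms by (auto simp: convex_def)
    then have "y \<otimes> inv (inv x \<otimes> y) \<in> H" using assms by blast
    then show ?thesis using assms y by (simp add: word_simps)
  qed
qed

lemma convex_D: "convex D"
  using subgroup_D by (auto simp: convex_def)

lemma convex_C: "convex C"
  using subgroup_C P_mult disjoint C_subset by (auto simp: convex_def)

text \<open>Convexity keeps products of elements of \<open>P - H\<close> outside \<open>H\<close>.
  The result orders the left cosets of \<open>H\<close>, whether or not these form a group.\<close>

lemma quotient_cone:
  assumes "convex H" shows "left_cone G D H (P - H)"
proof -
  interpret H: subgroup H G using assms by (simp add: convex_def)
  show ?thesis
  proof (intro left_cone.intro left_cone_axioms.intro group_axioms)
    show "subgroup H G" ..
    show "x \<otimes> y \<in> P - H" if "x \<in> P - H" "y \<in> P - H" for x y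
      using convexD[OF assms, of x y] P_mult that by blast
    show "x \<in> H \<or> x \<in> P - H \<or> inv x \<in> P - H" if "x \<in> D" for x
      using total[OF that] H.m_inv_closed[of "inv x"] that assms by (auto simp: convex_def)
  qed (use asym assms subgroup_D in \<open>auto simp: convex_def\<close>)
qed

lemma convex_isolated:
  assumes "convex H" "x \<in> D" "x [^] (n::nat) \<in> H" "n > 0" shows "x \<in> H"
  using left_cone.isolated[OF quotient_cone] assms by blast

lemma convex_pos:
  assumes X: "convex X" and Y: "convex Y" and XY: "\<not> X \<subseteq> Y"
  shows "\<exists>x\<in>P. x \<in> X \<and> x \<notin> Y"
proof -
  interpret X: subgroup X G using X by (simp add: convex_def)
  interpret Y: subgroup Y G using Y by (simp add: convex_def)
  obtain x where x: "x \<in> X" "x \<notin> Y" using XY by blast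
  have "inv x \<notin> Y" using Y.m_inv_closed[of "inv x"] x by auto
  moreover have "x \<in> D" "x \<notin> C" using x X Y by (auto simp: convex_def)
  ultimately show ?thesis using total[of x] x by blast
qed

text \<open>Positive witnesses of the two non-inclusions could not be compared: by convexity the
  smaller one would lie in both subgroups.\<close>

lemma convex_chain:
  assumes "convex A" "convex B" shows "A \<subseteq> B \<or> B \<subseteq> A"
proof (rule ccontr)
  assume "\<not> ?thesis"
  then obtain a b where a: "a \<in> P" "a \<in> A" "a \<notin> B" and b: "b \<in> P" "b \<in> B" "b \<notin> A"
    using convex_pos assms by meson
  then have "\<not> le a b" "\<not> le b a" using convex_le assms by blast+
  then show False using not_le lt_le a b by blast
qed

lemma convex_restrict:
  assumes "convex H" "subgroup E G" "E \<subseteq> D"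
  shows "left_cone.convex G E (C \<inter> E) (P \<inter> E) (H \<inter> E)"
proof -
  interpret E: left_cone G E "C \<inter> E" "P \<inter> E" by (rule restrict[OF assms(2,3)])
  have "subgroup (H \<inter> E) G" using assms subgroups_Inter_pair by (auto simp: convex_def)
  then show ?thesis using assms unfolding E.convex_def convex_def by blast
qed

end

section \<open>Conradian cones and their convex subgroups\<close>

lemma (in left_cone) lt_not_le: "lt a b \<Longrightarrow> a \<in> carrier G \<Longrightarrow> b \<in> carrier G \<Longrightarrow> \<not> le b a"
  using lt_le_trans lt_irrefl by blast

locale conrad_cone = left_cone +
  assumes conrad: "a \<in> P \<Longrightarrow> b \<in> P \<Longrightarrow> \<exists>n::nat. inv a \<otimes> (b \<otimes> a [^] n) \<in> P"
begin

lemma conrad_lt: "a \<in> P \<Longrightarrow> b \<in> P \<Longrightarrow> \<exists>n::nat. lt a (b \<otimes> a [^] n)"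
  using conrad by (simp add: lt_def)

text \<open>The Conrad property is applied to \<open>g\<^sup>2\<close> and \<open>g x\<^sup>-\<^sup>1\<close>, where \<open>g = x\<^sup>-\<^sup>1 k\<close>.\<close>

lemma C_mult_lt_square:
  assumes x: "x \<in> C" and k: "k \<in> P" shows "lt (x \<otimes> k) (k \<otimes> k)"
proof (rule ccontr)
  assume "\<not> ?thesis"
  then have *: "le (k \<otimes> k) (x \<otimes> k)" using not_le[of "k \<otimes> k" "x \<otimes> k"] x k by blast
  define g where "g = inv x \<otimes> k"
  have g: "g \<in> P" using CP_mult x k by (simp add: g_def)
  have gk: "le (g \<otimes> k) k"
    using * le_mult_left[of "g \<otimes> k" k x] x k by (simp add: g_def m_assoc)
  \<comment> \<open>Since \<open>g \<otimes> k \<le> k\<close>, multiplying by \<open>g\<close> from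
    the left again and again keeps all powers of \<open>g\<close> below \<open>k\<close>, whereas
    the Conrad condition is going to place some \<open>g [^] (2 * n)\<close> above
    \<open>k\<close>.\<close>
  have pow: "le (g [^] (j::nat)) k" for j
  proof (induction j)
    case (Suc j)
    have "le (g \<otimes> g [^] j) (g \<otimes> k)" using Suc le_mult_left g k by simp
    moreover have "g [^] Suc j = g \<otimes> g [^] j" by (rule nat_pow_Suc2) (use g in simp)
    ultimately show ?case using gk le_trans[of "g \<otimes> g [^] j" "g \<otimes> k" k] g k by (simp del: nat_pow_Suc)
  qed (use k in \<open>simp add: le_one\<close>)
  obtain n where n: "lt (g \<otimes> g) ((g \<otimes> inv x) \<otimes> (g \<otimes> g) [^] (n::nat))"
    using conrad_lt[of "g \<otimes> g" "g \<otimes> inv x"] P_mult PC_mult g x by auto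
  have e: "(g \<otimes> g) [^] n = g [^] (2 * n)"
    using nat_pow_pow[of g 2 n] g by (simp add: numeral_2_eq_2)
  have "lt g (inv x \<otimes> g [^] (2 * n))"
    using n lt_mult_left[of g "inv x \<otimes> g [^] (2 * n)" g] g x e by (simp add: m_assoc)
  then have "lt (x \<otimes> g) (g [^] (2 * n))"
    using lt_mult_left[of g "inv x \<otimes> g [^] (2 * n)" x] g x by simp
  then have "lt k (g [^] (2 * n))" using x k by (simp add: g_def)
  then show False using pow[of "2 * n"] lt_not_le g k by simp
qed

lemma restrict_conrad:
  assumes "subgroup E G" "E \<subseteq> D" shows "conrad_cone G E (C \<inter> E) (P \<inter> E)"
proof (intro conrad_cone.intro restrict assms conrad_cone_axioms.intro)
  interpret E: subgroup E G by fact
  fix a b assume "a \<in> P \<inter> E" "b \<in> P \<inter> E"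
  moreover from this obtain n :: nat where "inv a \<otimes> (b \<otimes> a [^] n) \<in> P" using conrad by blast
  ultimately show "\<exists>n::nat. inv a \<otimes> (b \<otimes> a [^] n) \<in> P \<inter> E"
    using subgroup_nat_pow[OF assms(1)] by blast
qed

lemma quotient_conrad:
  assumes "convex H" shows "conrad_cone G D H (P - H)"
proof (intro conrad_cone.intro quotient_cone assms conrad_cone_axioms.intro)
  fix a b assume ab: "a \<in> P - H" "b \<in> P - H"
  then obtain n :: nat where n: "inv a \<otimes> (b \<otimes> a [^] n) \<in> P" using conrad by blast
  \<comment> \<open>The element obtained for the exponent \<open>n\<close> is positive but may lie
    in \<open>H\<close>. One more factor \<open>a\<close>, which is outside \<open>H\<close>, moves
    it out of the convex subgroup; hence the exponent \<open>Suc n\<close>.\<close>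
  have e: "inv a \<otimes> (b \<otimes> a [^] Suc n) = inv a \<otimes> (b \<otimes> a [^] n) \<otimes> a"
    using ab by (simp add: m_assoc)
  have "inv a \<otimes> (b \<otimes> a [^] n) \<otimes> a \<in> P" using P_mult n ab by blast
  moreover have "inv a \<otimes> (b \<otimes> a [^] n) \<otimes> a \<notin> H" using convexD(2)[OF assms n] ab by blast
  ultimately show "\<exists>n::nat. inv a \<otimes> (b \<otimes> a [^] n) \<in> P - H" using e by (metis DiffI)
qed

end

text \<open>Signs are read off in \<open>Q\<close> and, for elements of \<open>H\<close>, in
  \<open>P\<close>. Among the mixed cases of the Conrad condition, exponent 0 settles
  \<open>a\<close> in \<open>P\<close> and \<open>b\<close> in \<open>Q\<close>. In the opposite
  case \<open>b\<close> belongs to the subgroup \<open>H\<close> relative to which \<open>a\<close>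
  is positive, and \<open>C_mult_lt_square\<close> for \<open>inv b\<close> and \<open>a\<close>
  yields exponent 2.\<close>

lemma (in group) lex_conrad:
  assumes "conrad_cone G D H Q" "conrad_cone G H C P"
  shows "conrad_cone G D C (Q \<union> P)"
proof -
  interpret Q: conrad_cone G D H Q by fact
  interpret P: conrad_cone G H C P by fact
  show ?thesis
  proof (intro conrad_cone.intro left_cone.intro left_cone_axioms.intro conrad_cone_axioms.intro group_axioms)
    show "subgroup D G" "subgroup C G" by (fact Q.subgroup_D P.subgroup_C)+
    show "C \<subseteq> D" "Q \<union> P \<subseteq> D" by auto
    show "x \<notin> C" if "x \<in> Q \<union> P" for x
      using that Q.disjoint P.disjoint by auto
    show "inv x \<notin> Q \<union> P" if "x \<in> Q \<union> P" for x
      using that Q.asym P.asym Q.disjoint P.in_D(2) Q.C.m_inv_closed Q.in_carrier(3) inv_inv by (metis Un_iff)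
    show "x \<in> C \<or> x \<in> Q \<union> P \<or> inv x \<in> Q \<union> P" if "x \<in> D" for x
      using that Q.total P.total by blast
    show "x \<otimes> y \<in> Q \<union> P" if "x \<in> Q \<union> P" "y \<in> Q \<union> P" for x y
      using that Q.P_mult Q.PC_mult Q.CP_mult P.P_mult by blast
    fix a b assume "a \<in> Q \<union> P" "b \<in> Q \<union> P"
    then consider "a \<in> Q" "b \<in> Q" | "a \<in> P" "b \<in> P" | "a \<in> P" "b \<in> Q" | "a \<in> Q" "b \<in> P" by blast
    then show "\<exists>n::nat. inv a \<otimes> (b \<otimes> a [^] n) \<in> Q \<union> P"
    proof cases
      case 3
      then have "inv a \<otimes> (b \<otimes> a [^] (0::nat)) \<in> Q" using Q.CP_mult by simp
      then show ?thesis by blast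
    next
      case 4
      then have "Q.lt (inv b \<otimes> a) (a \<otimes> a)" using Q.C_mult_lt_square by blast
      then have "inv a \<otimes> (b \<otimes> (a \<otimes> a)) \<in> Q" using 4 by (simp add: Q.lt_def m_assoc inv_mult_group)
      moreover have "a \<otimes> a = a [^] (2::nat)" using 4 by (simp add: numeral_2_eq_2)
      ultimately show ?thesis by auto
    qed (use Q.conrad P.conrad in blast)+
  qed
qed

context conrad_cone
begin

text \<open>For positive \<open>h\<close> this is the convex subgroup generated by \<open>h\<close>.
  The second bound is put on \<open>inv x\<close> because inversion need not reverse a
  left-invariant order.\<close>

definition cspan where
  "cspan h = {x \<in> D. (\<exists>n::nat. le x (h [^] n)) \<and> (\<exists>n::nat. le (inv x) (h [^] n))}"

text \<open>The Conrad condition is applied to \<open>f = h [^] Suc m\<close> and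
  \<open>g = h \<otimes> (inv x \<otimes> h [^] n)\<close>. The additional \<open>h\<close> makes
  \<open>g\<close> positive even if \<open>inv x \<otimes> h [^] n\<close> lies in \<open>C\<close>,
  and it cancels against the first factor of \<open>f\<close>.\<close>

lemma mult_pow_bounded:
  assumes h: "h \<in> P" and x: "x \<in> D" and n: "le x (h [^] (n::nat))"
  shows "\<exists>k. lt (x \<otimes> h [^] (m::nat)) (h [^] (k::nat))"
proof -
  define f where "f = h [^] Suc m"
  define g where "g = h \<otimes> (inv x \<otimes> h [^] n)"
  have "f \<in> P" using P_pow h by (simp add: f_def)
  moreover have "g \<in> P" using n h P_mult PC_mult by (auto simp: g_def le_def)
  ultimately obtain j :: nat where j: "inv f \<otimes> (g \<otimes> f [^] j) \<in> P" using conrad by blast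
  define q r s where "q = h [^] m" and "r = h [^] n" and "s = h [^] (Suc m * j)"
  have [simp]: "q \<in> carrier G" "r \<in> carrier G" "s \<in> carrier G" "x \<in> carrier G" "h \<in> carrier G"
    using h x by (auto simp: q_def r_def s_def)
  have "f [^] j = s" using nat_pow_pow[of h "Suc m" j] by (simp only: f_def s_def \<open>h \<in> carrier G\<close>)
  moreover have "f = h \<otimes> q" unfolding f_def q_def by (rule nat_pow_Suc2) simp
  ultimately have "inv f \<otimes> (g \<otimes> f [^] j) = inv (h \<otimes> q) \<otimes> ((h \<otimes> (inv x \<otimes> r)) \<otimes> s)"
    by (simp only: g_def r_def)
  also have "\<dots> = inv (x \<otimes> q) \<otimes> (r \<otimes> s)" by (simp add: word_simps)
  also have "r \<otimes> s = h [^] (n + Suc m * j)" unfolding r_def s_def by (rule nat_pow_mult) simp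
  finally have "lt (x \<otimes> q) (h [^] (n + Suc m * j))" using j by (simp only: lt_def)
  then show ?thesis unfolding q_def by blast
qed

lemma cspan_self: assumes "h \<in> P" shows "h \<in> cspan h"
proof -
  have "le h (h [^] (1::nat))" using assms le_refl by simp
  moreover have "le (inv h) (h [^] (0::nat))" using assms by (simp add: le_def)
  ultimately show ?thesis using assms unfolding cspan_def by blast
qed

lemma cspan_convex: assumes h: "h \<in> P" shows "convex (cspan h)"
proof -
  have mult: "\<exists>k. le (x \<otimes> y) (h [^] (k::nat))"
    if x: "x \<in> D" "le x (h [^] (n::nat))" and y: "y \<in> D" "le y (h [^] (m::nat))" for x y n m
  proof -
    obtain k :: nat where "lt (x \<otimes> h [^] m) (h [^] k)" using mult_pow_bounded[OF h x] by blast
    moreover have "le (x \<otimes> y) (x \<otimes> h [^] m)" using x y le_mult_left h by simp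
    ultimately have "lt (x \<otimes> y) (h [^] k)"
      using le_lt_trans[of "x \<otimes> y" "x \<otimes> h [^] m" "h [^] k"] x y h by simp
    then show ?thesis using lt_le by blast
  qed
  have C: "C \<subseteq> cspan h"
  proof
    fix c assume "c \<in> C"
    then have "le c (h [^] (0::nat))" "le (inv c) (h [^] (0::nat))" by (auto simp: le_def)
    then show "c \<in> cspan h" using \<open>c \<in> C\<close> unfolding cspan_def by blast
  qed
  have "subgroup (cspan h) G"
  proof (rule subgroupI)
    show "cspan h \<subseteq> carrier G" by (auto simp: cspan_def)
    show "cspan h \<noteq> {}" using C C.one_closed by blast
    show "inv a \<in> cspan h" if "a \<in> cspan h" for a using that by (auto simp: cspan_def)
    show "a \<otimes> b \<in> cspan h" if "a \<in> cspan h" "b \<in> cspan h" for a b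
      using that mult[of a _ b] mult[of "inv b" _ "inv a"] by (auto simp: cspan_def inv_mult_group)
  qed
  moreover have "x \<in> cspan h" if xy: "x \<in> P" "y \<in> P" "x \<otimes> y \<in> cspan h" for x y
  proof -
    obtain n where n: "le (x \<otimes> y) (h [^] (n::nat))" using xy by (auto simp: cspan_def)
    have "le x (x \<otimes> y)" using lt_le lt_mult_P xy by simp
    then have "le x (h [^] n)" using le_trans[of x "x \<otimes> y"] n xy h by simp
    moreover have "le (inv x) (h [^] (0::nat))" using xy by (simp add: le_def)
    ultimately show ?thesis using xy unfolding cspan_def by blast
  qed
  ultimately show ?thesis using C by (auto simp: convex_def cspan_def)
qed

lemma cspan_minimal:
  assumes "convex H" "h \<in> P" "h \<in> H" shows "cspan h \<subseteq> H"
proof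
  interpret H: subgroup H G using assms by (simp add: convex_def)
  fix x assume x: "x \<in> cspan h"
  then have D: "x \<in> D" by (simp add: cspan_def)
  have pow: "h [^] (n::nat) \<in> H" for n using subgroup_nat_pow assms H.subgroup_axioms by blast
  show "x \<in> H" using D
  proof (cases rule: total3)
    case 1
    then show ?thesis using assms by (auto simp: convex_def)
  next
    case 2
    then show ?thesis using x convex_le[OF assms(1) _ pow] by (auto simp: cspan_def)
  next
    case 3
    then have "inv x \<in> H" using x convex_le[OF assms(1) _ pow] by (auto simp: cspan_def)
    then show ?thesis using H.m_inv_closed[of "inv x"] D by simp
  qed
qed

text \<open>For positive \<open>h\<close>, the pair \<open>below h\<close> and
  \<open>cspan h\<close> is the convex jump at \<open>h\<close>: a convex subgroup that misses
  \<open>h\<close> is contained in the former, and one that contains \<open>h\<close> contains the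
  latter. The union is one of a chain, which is why it is a subgroup.\<close>

definition below where "below h = \<Union> {H. convex H \<and> h \<notin> H}"

lemma notin_below: "h \<notin> below h" by (auto simp: below_def)

lemma below_maximal: "convex H \<Longrightarrow> h \<notin> H \<Longrightarrow> H \<subseteq> below h" by (auto simp: below_def)

lemma below_convex: assumes "h \<in> P" shows "convex (below h)"
proof -
  let ?F = "{H. convex H \<and> h \<notin> H}"
  have C: "C \<in> ?F" using convex_C disjoint assms by blast
  have "subgroup (below h) G"
  proof (rule subgroupI)
    show "below h \<subseteq> carrier G" by (auto simp: below_def convex_def)
    show "below h \<noteq> {}" using C C.one_closed unfolding below_def by blast
    show "inv a \<in> below h" if a: "a \<in> below h" for a
    proof -
      obtain H where H: "H \<in> ?F" "a \<in> H" using a by (auto simp: below_def)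
      then have "inv a \<in> H" using subgroup.m_inv_closed[of H G a] by (simp add: convex_def)
      then show ?thesis using H unfolding below_def by blast
    qed
    show "a \<otimes> b \<in> below h" if a: "a \<in> below h" and b: "b \<in> below h" for a b
    proof -
      obtain H K where H: "H \<in> ?F" "a \<in> H" and K: "K \<in> ?F" "b \<in> K" using a b by (auto simp: below_def)
      then obtain M where "M \<in> ?F" "a \<in> M" "b \<in> M" using convex_chain[of H K] by blast
      moreover from this have "a \<otimes> b \<in> M" using subgroup.m_closed[of M G a b] by (simp add: convex_def)
      ultimately show ?thesis unfolding below_def by blast
    qed
  qed
  moreover have "C \<subseteq> below h" "below h \<subseteq> D" using C by (auto simp: below_def convex_def)
  moreover have "x \<in> below h" if "x \<in> P" "y \<in> P" "x \<otimes> y \<in> below h" for x y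
    using that convexD(1) unfolding below_def by blast
  ultimately show ?thesis by (auto simp: convex_def)
qed

lemma below_subset_cspan: assumes "h \<in> P" shows "below h \<subseteq> cspan h"
  using convex_chain[OF below_convex cspan_convex, OF assms assms] cspan_self[OF assms] notin_below by blast

end

section \<open>Archimedean cones: normality, bi-invariance and commutativity\<close>

locale arch_cone = conrad_cone +
  assumes arch: "a \<in> P \<Longrightarrow> b \<in> P \<Longrightarrow> \<exists>n::nat. le b (a [^] n)"

text \<open>If \<open>a\<close> is positive and outside \<open>below h\<close>, then
  \<open>cspan a\<close> is a convex subgroup not contained in \<open>below h\<close>, so it
  contains \<open>h\<close> and therefore all of \<open>cspan h\<close>; this bounds
  \<open>b\<close> by a power of \<open>a\<close>.\<close>

lemma (in conrad_cone) jump_arch: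
  assumes h: "h \<in> P" shows "arch_cone G (cspan h) (below h) (P \<inter> cspan h - below h)"
proof -
  have K: "convex (cspan h)" and H: "convex (below h)" using cspan_convex below_convex h by auto
  interpret K: conrad_cone G "cspan h" "C \<inter> cspan h" "P \<inter> cspan h"
    using restrict_conrad[of "cspan h"] K unfolding convex_def by blast
  have "below h \<inter> cspan h = below h" using below_subset_cspan h by blast
  then have HK: "K.convex (below h)"
    using convex_restrict[OF H] K unfolding convex_def by metis
  interpret J: conrad_cone G "cspan h" "below h" "P \<inter> cspan h - below h"
    by (rule K.quotient_conrad[OF HK])
  show ?thesis
  proof
    fix a b assume a: "a \<in> P \<inter> cspan h - below h" and b: "b \<in> P \<inter> cspan h - below h"
    have "h \<in> cspan a" using below_maximal[OF cspan_convex] cspan_self a by blast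
    then have "cspan h \<subseteq> cspan a" using cspan_minimal cspan_convex a h by blast
    then obtain n :: nat where n: "le b (a [^] n)" using b by (auto simp: cspan_def)
    have "a [^] n \<in> cspan h" using subgroup_nat_pow[OF J.subgroup_D] a by blast
    then have "inv b \<otimes> a [^] n \<in> cspan h"
      using b subgroup.m_closed[OF J.subgroup_D] subgroup.m_inv_closed[OF J.subgroup_D] by blast
    then have "J.le b (a [^] n)" using n H unfolding J.le_def le_def convex_def by blast
    then show "\<exists>n::nat. J.le b (a [^] n)" ..
  qed
qed

text \<open>A condition on commutators that can be stated before any quotient exists. For subgroups
  \<open>H \<subseteq> K\<close> it includes normality, as \<open>abelian_over_normal\<close>
  shows.\<close>

definition (in group) abelian_over where
  "abelian_over K H \<longleftrightarrow> (\<forall>a\<in>K. \<forall>b\<in>K. inv (b \<otimes> a) \<otimes> (a \<otimes> b) \<in> H)"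

context arch_cone
begin

lemma no_upper_bound: assumes "a \<in> P" "g \<in> P" shows "\<exists>n::nat. lt g (a [^] n)"
proof -
  obtain n :: nat where "le (g \<otimes> g) (a [^] n)" using arch P_mult assms by blast
  then show ?thesis using lt_mult_P[of g g] lt_le_trans[of g "g \<otimes> g" "a [^] n"] assms by auto
qed

lemma conj_pow:
  "x \<in> carrier G \<Longrightarrow> k \<in> carrier G \<Longrightarrow> (inv k \<otimes> (x \<otimes> k)) [^] (n::nat) = inv k \<otimes> (x [^] n \<otimes> k)"
  by (induction n) (simp_all add: word_simps)

text \<open>The powers of the conjugate are \<open>inv k \<otimes> (x [^] n \<otimes> k)\<close>. By
  \<open>C_mult_lt_square\<close> they all stay below \<open>k\<close>, while powers of a positive
  element are unbounded.\<close>

lemma conj_notin_P: assumes "x \<in> C" "k \<in> P" shows "inv k \<otimes> (x \<otimes> k) \<notin> P"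
proof
  assume "inv k \<otimes> (x \<otimes> k) \<in> P"
  then obtain n :: nat where "lt k ((inv k \<otimes> (x \<otimes> k)) [^] n)" using no_upper_bound assms by blast
  then have 1: "lt k (inv k \<otimes> (x [^] n \<otimes> k))" using conj_pow assms by simp
  have "lt (x [^] n \<otimes> k) (k \<otimes> k)" using C_mult_lt_square subgroup_nat_pow subgroup_C assms by blast
  then have "lt (inv k \<otimes> (x [^] n \<otimes> k)) k" using lt_mult_left[of "inv k \<otimes> (x [^] n \<otimes> k)" k k] assms by simp
  then show False using lt_not_le[OF 1] lt_le assms by simp
qed

text \<open>Here the powers \<open>k \<otimes> (x [^] n \<otimes> inv k)\<close> are bounded by
  \<open>k \<otimes> x [^] n\<close>, which lies in the same left coset of \<open>C\<close> as
  \<open>k\<close>.\<close>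

lemma conj_inv_notin_P: assumes "x \<in> C" "k \<in> P" shows "k \<otimes> (x \<otimes> inv k) \<notin> P"
proof
  assume z: "k \<otimes> (x \<otimes> inv k) \<in> P"
  obtain n :: nat where n: "lt k ((k \<otimes> (x \<otimes> inv k)) [^] n)" using no_upper_bound[OF z] assms by blast
  have "(k \<otimes> (x \<otimes> inv k)) [^] n = k \<otimes> (x [^] n \<otimes> inv k)" using conj_pow[of x "inv k" n] assms by simp
  then have 1: "lt k (k \<otimes> (x [^] n \<otimes> inv k))" using n by simp
  have "le (k \<otimes> (x [^] n \<otimes> inv k)) (k \<otimes> (x [^] n \<otimes> inv k) \<otimes> k)" using le_mult_PC assms by simp
  moreover have "k \<otimes> (x [^] n \<otimes> inv k) \<otimes> k = k \<otimes> x [^] n" using assms by (simp add: m_assoc)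
  moreover have "le (k \<otimes> x [^] n) k"
    using assms C.m_inv_closed[OF subgroup_nat_pow[OF subgroup_C]] by (simp add: le_def word_simps)
  ultimately have "le (k \<otimes> (x [^] n \<otimes> inv k)) k" using le_trans[of _ "k \<otimes> x [^] n" k] assms by simp
  then show False using 1 lt_not_le assms by simp
qed

lemma C_normal_P: assumes "x \<in> C" "k \<in> P" shows "inv k \<otimes> (x \<otimes> k) \<in> C" "k \<otimes> (x \<otimes> inv k) \<in> C"
proof -
  have D: "inv k \<otimes> (x \<otimes> k) \<in> D" "k \<otimes> (x \<otimes> inv k) \<in> D" using assms by blast+
  show "inv k \<otimes> (x \<otimes> k) \<in> C" "k \<otimes> (x \<otimes> inv k) \<in> C"
    using total[OF D(1)] total[OF D(2)] conj_notin_P[of x k] conj_notin_P[of "inv x" k]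
      conj_inv_notin_P[of x k] conj_inv_notin_P[of "inv x" k] assms by (auto simp: word_simps)
qed

lemma C_normal: assumes "x \<in> C" "k \<in> D" shows "inv k \<otimes> (x \<otimes> k) \<in> C"
  using assms(2)
proof (cases rule: total3)
  case 3
  then show ?thesis using C_normal_P(2)[OF assms(1) 3(1)] assms by simp
qed (use assms C_normal_P in \<open>auto simp: C.m_closed\<close>)

text \<open>From \<open>a \<otimes> g < g\<close> it would follow that
  \<open>a [^] n \<otimes> g \<le> g\<close> for all \<open>n\<close>; but some
  \<open>a [^] n\<close> exceeds \<open>g\<close>, and \<open>a [^] n \<otimes> g\<close> exceeds
  \<open>a [^] n\<close>.\<close>

lemma P_mult_increasing: assumes a: "a \<in> P" and g: "g \<in> P" shows "\<not> lt (a \<otimes> g) g"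
proof
  assume *: "lt (a \<otimes> g) g"
  have pow: "le (a [^] (n::nat) \<otimes> g) g" for n
  proof (induction n)
    case (Suc n)
    have "le (a \<otimes> (a [^] n \<otimes> g)) (a \<otimes> g)" using Suc le_mult_left a g by simp
    moreover have "a [^] Suc n = a \<otimes> a [^] n" by (rule nat_pow_Suc2) (use a in simp)
    ultimately show ?case using lt_le[OF *] le_trans[of "a \<otimes> (a [^] n \<otimes> g)" "a \<otimes> g" g] a g
      by (simp add: m_assoc del: nat_pow_Suc)
  qed (use g le_refl in simp)
  obtain n :: nat where "lt g (a [^] n)" using no_upper_bound a g by blast
  moreover have "lt (a [^] n) (a [^] n \<otimes> g)" using lt_mult_P a g by simp
  ultimately have "lt g (a [^] n \<otimes> g)" using lt_trans[of g "a [^] n"] a g by simp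
  then show False using pow[of n] lt_not_le a g by simp
qed

text \<open>Normality of \<open>C\<close> excludes a conjugate in \<open>C\<close>, and
  \<open>P_mult_increasing\<close> excludes a negative one. Invariance under conjugation is what
  finally permits multiplying inequalities from the right.\<close>

lemma conj_P_P: assumes "a \<in> P" "g \<in> P" shows "inv g \<otimes> (a \<otimes> g) \<in> P" "g \<otimes> (a \<otimes> inv g) \<in> P"
proof -
  have D: "inv g \<otimes> (a \<otimes> g) \<in> D" "g \<otimes> (a \<otimes> inv g) \<in> D" using assms by blast+
  have "inv g \<otimes> (a \<otimes> g) \<notin> C"
    using C_normal_P(2)[of "inv g \<otimes> (a \<otimes> g)" g] assms disjoint by (auto simp: m_assoc)
  moreover have "inv (inv g \<otimes> (a \<otimes> g)) \<notin> P"
    using P_mult_increasing[of a g] assms by (simp add: lt_def word_simps)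
  ultimately show "inv g \<otimes> (a \<otimes> g) \<in> P" using total[OF D(1)] by blast
  have "g \<otimes> (a \<otimes> inv g) \<notin> C"
    using C_normal_P(1)[of "g \<otimes> (a \<otimes> inv g)" g] assms disjoint by (auto simp: m_assoc)
  moreover have "inv (g \<otimes> (a \<otimes> inv g)) \<notin> P"
    using P_mult_increasing[of "inv (g \<otimes> (a \<otimes> inv g))" g] assms by (auto simp: lt_def word_simps)
  ultimately show "g \<otimes> (a \<otimes> inv g) \<in> P" using total[OF D(2)] by blast
qed

lemma conj_P: assumes "a \<in> P" "g \<in> D" shows "inv g \<otimes> (a \<otimes> g) \<in> P"
  using assms(2)
proof (cases rule: total3)
  case 1
  then show ?thesis using assms CP_mult PC_mult by simp
next
  case 3
  then show ?thesis using conj_P_P(2)[OF assms(1) 3(1)] assms by simp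
qed (use assms conj_P_P in auto)

lemma lt_mult_right: assumes "lt a b" "a \<in> D" "b \<in> D" "z \<in> D" shows "lt (a \<otimes> z) (b \<otimes> z)"
  using conj_P[of "inv a \<otimes> b" z] assms by (simp add: lt_def word_simps)

lemma le_mult_right: assumes "le a b" "a \<in> D" "b \<in> D" "z \<in> D" shows "le (a \<otimes> z) (b \<otimes> z)"
  using conj_P[of "inv a \<otimes> b" z] C_normal[of "inv a \<otimes> b" z] assms by (auto simp: le_def word_simps)

lemma pow_D [simp]: "x \<in> D \<Longrightarrow> x [^] (n::nat) \<in> D"
  using subgroup_nat_pow subgroup_D by blast

lemma between_powers: assumes d: "d \<in> P" and a: "a \<in> P"
  obtains i :: nat where "le (d [^] i) a" "lt a (d [^] Suc i)"
proof -
  define n where "n = (LEAST n::nat. lt a (d [^] n))"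
  have n: "lt a (d [^] n)" unfolding n_def using no_upper_bound d a by (metis LeastI_ex)
  have "n \<noteq> 0"
  proof
    assume "n = 0" then show False using n a asym by (simp add: lt_def)
  qed
  then have "\<not> lt a (d [^] (n - 1))" unfolding n_def by (metis diff_less not_less_Least zero_less_one neq0_conv)
  then have "le (d [^] (n - 1)) a" using not_le d a in_D pow_D by metis
  then show ?thesis using that[of "n - 1"] n \<open>n \<noteq> 0\<close> by simp
qed

text \<open>If \<open>P\<close> has a minimal element \<open>m\<close>, then \<open>a\<close> and
  \<open>b\<close> agree with powers of \<open>m\<close> modulo \<open>C\<close>. Otherwise some
  positive \<open>d\<close> satisfies \<open>d \<otimes> d \<le> e\<close> for the commutator
  \<open>e\<close>; placing \<open>a\<close> and \<open>b\<close> between consecutive powers of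
  \<open>d\<close> determines both products up to an error below \<open>d \<otimes> d\<close>, which
  is too small for them to differ by \<open>e\<close>.\<close>

lemma commutator_notin_P: assumes a: "a \<in> P" and b: "b \<in> P" shows "inv (b \<otimes> a) \<otimes> (a \<otimes> b) \<notin> P"
proof
  define e where "e = inv (b \<otimes> a) \<otimes> (a \<otimes> b)"
  assume "inv (b \<otimes> a) \<otimes> (a \<otimes> b) \<in> P"
  then have e: "e \<in> P" and lt: "lt (b \<otimes> a) (a \<otimes> b)" by (auto simp: e_def lt_def)
  have eq: "(b \<otimes> a) \<otimes> e = a \<otimes> b" using a b by (simp add: e_def word_simps)
  show False
  proof (cases "\<exists>m\<in>P. \<forall>x\<in>P. \<not> lt x m")
    case True
    then obtain m where m: "m \<in> P" and min: "\<And>x. x \<in> P \<Longrightarrow> \<not> lt x m" by blast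
    have near: "\<exists>i::nat. le (m [^] i) x \<and> le x (m [^] i)" if x: "x \<in> P" for x
    proof -
      obtain i :: nat where i: "le (m [^] i) x" "lt x (m [^] Suc i)" using between_powers m x by blast
      \<comment> \<open>The remainder of \<open>x\<close> after the power \<open>m [^] i\<close> is
        below the minimal positive element, so it is not positive.\<close>
      have "lt (inv (m [^] i) \<otimes> x) m"
        using i(2) lt_mult_left[of "inv (m [^] i) \<otimes> x" m "m [^] i"] m x by simp
      then have "\<not> lt (m [^] i) x" using min by (auto simp: lt_def)
      then show ?thesis using i(1) not_le[of x "m [^] i"] m x by auto
    qed
    obtain i j :: nat where i: "le (m [^] i) a" "le a (m [^] i)" and j: "le (m [^] j) b" "le b (m [^] j)"
      using near a b by blast
    have "le (a \<otimes> b) (m [^] i \<otimes> b)" using le_mult_right i a b m by simp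
    moreover have "le (m [^] i \<otimes> b) (m [^] i \<otimes> m [^] j)" using le_mult_left j a b m by simp
    moreover have "le (m [^] j \<otimes> a) (b \<otimes> a)" using le_mult_right j a b m by simp
    moreover have "le (m [^] j \<otimes> m [^] i) (m [^] j \<otimes> a)" using le_mult_left i a b m by simp
    moreover have "m [^] j \<otimes> m [^] i = m [^] i \<otimes> m [^] j" using m by (simp add: nat_pow_mult add.commute)
    ultimately have "le (a \<otimes> b) (b \<otimes> a)" using le_trans a b m
      by (smt (verit) in_carrier(3) m_closed nat_pow_closed)
    then show False using not_le[of "a \<otimes> b" "b \<otimes> a"] lt a b by blast
  next
    case False
    then obtain x where x: "x \<in> P" "lt x e" using e by blast
    \<comment> \<open>As \<open>x \<otimes> x' = e\<close>, the smaller of the two factors can serve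
      as \<open>d\<close>. If this is \<open>x'\<close>, the estimate already needs multiplication
      from the right.\<close>
    define x' where "x' = inv x \<otimes> e"
    have x': "x' \<in> P" using x by (simp add: x'_def lt_def)
    have xe: "x \<otimes> x' = e" using x e by (simp add: x'_def)
    obtain d where d: "d \<in> P" "le (d \<otimes> d) e"
    proof (cases "le x x'")
      case True
      then have "le (x \<otimes> x) e" using le_mult_left[of x x' x] x x' xe by simp
      then show thesis using that x by blast
    next
      case False
      then have "lt (x' \<otimes> x') (x \<otimes> x')" using not_le[of x x'] lt_mult_right x x' by simp
      then show thesis using that x' lt_le xe by metis
    qed
    obtain i :: nat where i: "le (d [^] i) a" "lt a (d [^] Suc i)" using between_powers d a by blast
    obtain j :: nat where j: "le (d [^] j) b" "lt b (d [^] Suc j)" using between_powers d b by blast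
    have "lt (a \<otimes> b) (d [^] Suc i \<otimes> b)" using lt_mult_right i a b d by simp
    moreover have "lt (d [^] Suc i \<otimes> b) (d [^] Suc i \<otimes> d [^] Suc j)" using lt_mult_left j a b d by simp
    ultimately have 1: "lt (a \<otimes> b) (d [^] Suc i \<otimes> d [^] Suc j)"
      using lt_trans[of "a \<otimes> b" "d [^] Suc i \<otimes> b"] a b d by simp
    have "le (d [^] j \<otimes> a) (b \<otimes> a)" using le_mult_right j a b d by simp
    moreover have "le (d [^] j \<otimes> d [^] i) (d [^] j \<otimes> a)" using le_mult_left i a b d by simp
    ultimately have "le (d [^] j \<otimes> d [^] i) (b \<otimes> a)"
      using le_trans[of "d [^] j \<otimes> d [^] i" "d [^] j \<otimes> a"] a b d by simp
    then have "le (d [^] j \<otimes> d [^] i \<otimes> (d \<otimes> d)) (b \<otimes> a \<otimes> (d \<otimes> d))"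
      using le_mult_right a b d by (meson D.m_closed in_D(2) pow_D)
    moreover have "le (b \<otimes> a \<otimes> (d \<otimes> d)) (b \<otimes> a \<otimes> e)" using le_mult_left d e a b by simp
    moreover have "d [^] j \<otimes> d [^] i \<otimes> (d \<otimes> d) = d [^] Suc i \<otimes> d [^] Suc j"
    proof -
      have d2: "d \<otimes> d = d [^] (2::nat)" using d by (simp add: numeral_2_eq_2)
      have [simp]: "d \<in> carrier G" using d by simp
      have "d [^] j \<otimes> d [^] i \<otimes> d [^] (2::nat) = d [^] (j + i + 2)"
        by (simp only: nat_pow_mult \<open>d \<in> carrier G\<close>)
      also have "j + i + 2 = Suc i + Suc j" by simp
      also have "d [^] (Suc i + Suc j) = d [^] Suc i \<otimes> d [^] Suc j"
        by (simp only: nat_pow_mult \<open>d \<in> carrier G\<close>)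
      finally show ?thesis by (simp only: d2)
    qed
    ultimately have "le (d [^] Suc i \<otimes> d [^] Suc j) (a \<otimes> b)"
      using le_trans[of _ "b \<otimes> a \<otimes> (d \<otimes> d)" "a \<otimes> b"] a b d eq by simp
    then show False using 1 lt_not_le a b d by simp
  qed
qed

text \<open>Hoelder's argument, carried out modulo \<open>C\<close>.\<close>

lemma abelian: "abelian_over D C"
proof -
  define k where "k a b = inv (b \<otimes> a) \<otimes> (a \<otimes> b)" for a b
  have sym: "k b a \<in> C" if "k a b \<in> C" "a \<in> D" "b \<in> D" for a b
    using C.m_inv_closed[OF that(1)] that by (simp add: k_def word_simps)
  \<comment> \<open>\<open>k (inv a) b\<close> is the conjugate
    \<open>a \<otimes> k b a \<otimes> inv a\<close>, so normality of \<open>C\<close> carries the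
    claim from \<open>a\<close> to \<open>inv a\<close>. This extends the result from positive
    elements to all signs.\<close>
  have inv: "k (inv a) b \<in> C" if "k a b \<in> C" "a \<in> D" "b \<in> D" for a b
    using C_normal[OF sym[OF that], of "inv a"] that by (simp add: k_def word_simps)
  have inv': "k a b \<in> C" if "k (inv a) b \<in> C" "a \<in> D" "b \<in> D" for a b
    using inv[of "inv a" b] that by simp
  have P: "k a b \<in> C" if "a \<in> P" "b \<in> P" for a b
  proof -
    have "k a b \<in> D" using that unfolding k_def by blast
    moreover have "inv (k a b) = k b a" using that by (simp add: k_def word_simps)
    ultimately show ?thesis using total[of "k a b"] commutator_notin_P that unfolding k_def by metis
  qed
  have C: "k a b \<in> C" if "a \<in> C" "b \<in> D" for a b
    using C.m_closed[OF C.m_inv_closed[OF that(1)] C_normal[OF that]] that by (simp add: k_def word_simps)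
  have PD: "k a b \<in> C" if "a \<in> P" "b \<in> D" for a b
    using total[OF that(2)] sym[of b a] P[OF that(1)] C[of b a] inv'[of b a] sym[of a "inv b"] that by auto
  have "k a b \<in> C" if "a \<in> D" "b \<in> D" for a b
    using total[OF that(1)] C PD inv' that by blast
  then show ?thesis by (simp add: abelian_over_def k_def)
qed

end

section \<open>Cones on torsion-free abelian groups\<close>

lemma (in group) int_pow_eq_one_abs:
  assumes "x \<in> carrier G" "x [^] (i::int) = \<one>" shows "x [^] (nat \<bar>i\<bar>) = \<one>"
proof (cases "i \<ge> 0")
  case True
  then show ?thesis using assms int_pow_int[of G x "nat i"] by simp
next
  case False
  then have "x [^] (- i) = \<one>" using assms int_pow_neg[of x i] by simp
  then show ?thesis using False int_pow_int[of G x "nat (- i)"] by simp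
qed

text \<open>The submonoid generated by \<open>F\<close>. In a torsion-free abelian group, having a
  positive power in \<open>mspan F\<close> means being a nonnegative rational combination of
  \<open>F\<close>.\<close>

inductive_set (in monoid) mspan :: "'a set \<Rightarrow> 'a set" for F where
  one: "\<one> \<in> mspan F"
| mult: "p \<in> F \<Longrightarrow> s \<in> mspan F \<Longrightarrow> p \<otimes> s \<in> mspan F"

context monoid
begin

lemma mspan_carrier: assumes "F \<subseteq> carrier G" shows "x \<in> mspan F \<Longrightarrow> x \<in> carrier G"
  by (induction rule: mspan.induct) (use assms in auto)

lemma mspan_incl: "F \<subseteq> carrier G \<Longrightarrow> p \<in> F \<Longrightarrow> p \<in> mspan F"
  using mspan.mult[OF _ mspan.one, of p F] by auto

lemma mspan_mult:
  assumes F: "F \<subseteq> carrier G" and y: "y \<in> mspan F" shows "x \<in> mspan F \<Longrightarrow> x \<otimes> y \<in> mspan F"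
proof (induction rule: mspan.induct)
  case one
  then show ?case using y mspan_carrier[OF F y] by simp
next
  case (mult p s)
  have "p \<otimes> s \<otimes> y = p \<otimes> (s \<otimes> y)"
    using mult.hyps F mspan_carrier[OF F y] mspan_carrier[OF F mult.hyps(2)] by (intro m_assoc) auto
  then show ?case using mult mspan.mult by metis
qed

lemma mspan_pow: "F \<subseteq> carrier G \<Longrightarrow> x \<in> mspan F \<Longrightarrow> x [^] (n::nat) \<in> mspan F"
  by (induction n) (simp_all add: mspan.one mspan_mult[of F])

end

lemma (in comm_monoid) mspan_insert:
  assumes "F \<subseteq> carrier G" "p \<in> carrier G" "x \<in> mspan (insert p F)"
  obtains k s where "s \<in> mspan F" "x = p [^] (k::nat) \<otimes> s"
proof -
  from assms(3) have "\<exists>k s. s \<in> mspan F \<and> x = p [^] (k::nat) \<otimes> s"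
  proof (induction rule: mspan.induct)
    case one
    show ?case by (rule exI[of _ 0], rule exI[of _ \<one>]) (simp add: mspan.one)
  next
    case (mult q s)
    then obtain k s' where s': "s' \<in> mspan F" "s = p [^] (k::nat) \<otimes> s'" by blast
    have c: "s' \<in> carrier G" using mspan_carrier[OF assms(1) s'(1)] .
    show ?case
    proof (cases "q = p")
      case True
      then have "q \<otimes> s = p [^] Suc k \<otimes> s'" using s' c assms by (simp add: nat_pow_Suc m_ac)
      then show ?thesis using s' by blast
    next
      case False
      then have q: "q \<in> F" using mult by blast
      then have "q \<otimes> s = p [^] k \<otimes> (q \<otimes> s')" using s' c assms m_lcomm by auto
      then show ?thesis using mspan.mult[OF q s'(1)] by blast
    qed
  qed
  then show ?thesis using that by blast
qed

context comm_group
begin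

lemma Z_independentD:
  assumes "Z_independent G S" "finite T" "T \<subseteq> S" "(\<Otimes>x\<in>T. x [^] (f x :: int)) = \<one>" "x \<in> T"
  shows "f x = 0"
  using assms(1)[unfolded Z_independent_def, THEN conjunct2, rule_format, of T f] assms(2-) by simp

text \<open>A single independent \<open>s\<close> is maximal exactly if every \<open>y\<close>
  satisfies a nontrivial relation with it. Torsion-freeness makes the exponent of \<open>y\<close>
  nonzero, and inverting the relation makes it positive. In this form the rank can be read modulo a
  subgroup without speaking of independent sets.\<close>

lemma rank_one_iff:
  assumes tf: "torsion_free G"
  shows "has_rank G 1 \<longleftrightarrow>
    (\<exists>s\<in>carrier G. s \<noteq> \<one> \<and> (\<forall>y\<in>carrier G. \<exists>n>0. \<exists>m::int. y [^] (n::nat) \<otimes> s [^] m = \<one>))"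
    (is "?L \<longleftrightarrow> ?R")
proof
  have tf_int: "i = 0" if "x \<in> carrier G" "x \<noteq> \<one>" "x [^] (i::int) = \<one>" for x i
    using int_pow_eq_one_abs[OF that(1,3)] tf that unfolding torsion_free_def by (metis zero_less_abs_iff zero_less_nat_eq)
  have two: "(\<Otimes>x\<in>{s, y}. x [^] f x) = s [^] f s \<otimes> y [^] f y"
    if "s \<in> carrier G" "y \<in> carrier G" "s \<noteq> y" for s y and f :: "'a \<Rightarrow> int"
    using that by simp
  {
    assume ?L
    then obtain S where S: "Z_independent G S" "\<And>S'. Z_independent G S' \<Longrightarrow> S \<subseteq> S' \<Longrightarrow> S' = S"
      and "card S = 1" unfolding has_rank_def by blast
    then obtain s where s: "S = {s}" by (auto simp: card_1_singleton_iff)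
    have sc: "s \<in> carrier G" using S s by (auto simp: Z_independent_def)
    have s1: "s \<noteq> \<one>"
    proof
      assume "s = \<one>"
      then have "(\<Otimes>x\<in>{s}. x [^] (1::int)) = \<one>" by simp
      then show False using Z_independentD[OF S(1), of "{s}" "\<lambda>_. 1" s] s by simp
    qed
    have "\<exists>n>0. \<exists>m::int. y [^] (n::nat) \<otimes> s [^] m = \<one>" if y: "y \<in> carrier G" for y
    proof (cases "y = s")
      case True
      have "s [^] (1::nat) \<otimes> s [^] (-1::int) = \<one>" using sc by (simp add: int_pow_neg)
      then show ?thesis using True by blast
    next
      case False
      then have "\<not> Z_independent G {s, y}" using S(2)[of "{s, y}"] s by auto
      then obtain T and f :: "'a \<Rightarrow> int" where T: "T \<subseteq> {s, y}" "(\<Otimes>x\<in>T. x [^] f x) = \<one>" "\<exists>x\<in>T. f x \<noteq> 0"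
        unfolding Z_independent_def using sc y by blast
      \<comment> \<open>Extending the exponents by 0 turns a relation on any subset \<open>T\<close>
        of \<open>{s, y}\<close> into one between \<open>s\<close> and \<open>y\<close>.\<close>
      define g where "g x = (if x \<in> T then f x else 0)" for x
      have "T = {} \<or> T = {s} \<or> T = {y} \<or> T = {s, y}" using T(1) by blast
      then have g: "s [^] g s \<otimes> y [^] g y = \<one>" using T(2) two False sc y by (auto simp: g_def)
      have "g s \<noteq> 0 \<or> g y \<noteq> 0" using T(1,3) by (auto simp: g_def)
      then have gy: "g y \<noteq> 0" using tf_int[OF sc s1, of "g s"] g sc by auto
      show ?thesis
      proof (cases "g y > 0")
        case True
        then have "y [^] nat (g y) \<otimes> s [^] g s = \<one>" using g sc y int_pow_int[of G y "nat (g y)"] by (simp add: m_comm)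
        then show ?thesis using True by (intro exI[of _ "nat (g y)"]) auto
      next
        case neg: False
        have "y [^] (- g y) \<otimes> s [^] (- g s) = inv (s [^] g s \<otimes> y [^] g y)"
          using sc y by (simp add: int_pow_neg inv_mult_group)
        then have "y [^] nat (- g y) \<otimes> s [^] (- g s) = \<one>" using g neg gy int_pow_int[of G y "nat (- g y)"] by simp
        moreover have "nat (- g y) > 0" using neg gy by simp
        ultimately show ?thesis by blast
      qed
    qed
    then show ?R using sc s1 by blast
  next
    assume ?R
    then obtain s where s: "s \<in> carrier G" "s \<noteq> \<one>"
      and rel: "\<And>y. y \<in> carrier G \<Longrightarrow> \<exists>n>0. \<exists>m::int. y [^] (n::nat) \<otimes> s [^] m = \<one>" by blast
    have "f s = 0" if "(\<Otimes>x\<in>{s}. x [^] f x) = \<one>" for f :: "'a \<Rightarrow> int"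
      using that tf_int s by simp
    then have ind: "Z_independent G {s}" using s unfolding Z_independent_def subset_singleton_iff by blast
    have "S' = {s}" if S': "Z_independent G S'" "{s} \<subseteq> S'" for S'
    proof (rule ccontr)
      assume "S' \<noteq> {s}"
      then obtain y where y: "y \<in> S'" "y \<noteq> s" using S' by blast
      have yc: "y \<in> carrier G" using y S' by (auto simp: Z_independent_def)
      then obtain n m where n: "n > 0" "y [^] (n::nat) \<otimes> s [^] (m::int) = \<one>" using rel by blast
      define f where "f x = (if x = y then int n else m)" for x
      have "(\<Otimes>x\<in>{s, y}. x [^] f x) = \<one>"
        using two[of s y f] n y s yc by (simp add: f_def int_pow_int m_comm[of "s [^] m"])
      moreover have "finite {s, y}" "{s, y} \<subseteq> S'" using y S' by auto
      ultimately have "f y = 0" using Z_independentD[OF S'(1), of "{s, y}" f y] by blast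
      then show False using n by (simp add: f_def)
    qed
    note max = this
    show ?L unfolding has_rank_def
    proof (intro exI conjI allI impI)
      show "Z_independent G {s}" by (rule ind)
      show "S' = {s}" if "Z_independent G S' \<and> {s} \<subseteq> S'" for S'
        by (rule max) (use that in blast)+
    qed simp_all
  }
qed

text \<open>Zorn's lemma gives a maximal semigroup \<open>M\<close> that avoids
  \<open>\<one>\<close>. If \<open>x \<noteq> \<one>\<close> and neither \<open>x\<close> nor
  \<open>inv x\<close> were in \<open>M\<close>, adding either of them would produce
  \<open>\<one>\<close>; the resulting two relations combine to
  \<open>\<one> \<in> M\<close>.\<close>

lemma semigroup_extends_to_cone:
  assumes tf: "torsion_free G" and S: "S \<subseteq> carrier G" "\<one> \<notin> S" "\<And>x y. x \<in> S \<Longrightarrow> y \<in> S \<Longrightarrow> x \<otimes> y \<in> S"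
  obtains Q where "left_cone G (carrier G) {\<one>} Q" "S \<subseteq> Q"
proof -
  define A where "A = {Q. Q \<subseteq> carrier G \<and> \<one> \<notin> Q \<and> S \<subseteq> Q \<and> (\<forall>x\<in>Q. \<forall>y\<in>Q. x \<otimes> y \<in> Q)}"
  have "\<exists>M\<in>A. \<forall>X\<in>A. M \<subseteq> X \<longrightarrow> X = M"
  proof (rule subset_Zorn_nonempty)
    show "A \<noteq> {}" using S by (auto simp: A_def)
    show "\<Union>\<C> \<in> A" if "\<C> \<noteq> {}" "subset.chain A \<C>" for \<C>
    proof -
      have sub: "\<C> \<subseteq> A" and chain: "\<And>X Y. X \<in> \<C> \<Longrightarrow> Y \<in> \<C> \<Longrightarrow> X \<subseteq> Y \<or> Y \<subseteq> X"
        using that(2) by (auto simp: subset_chain_def)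
      have "x \<otimes> y \<in> \<Union>\<C>" if xy: "x \<in> \<Union>\<C>" "y \<in> \<Union>\<C>" for x y
      proof -
        obtain X Y where "X \<in> \<C>" "x \<in> X" "Y \<in> \<C>" "y \<in> Y" using xy by blast
        then obtain Z where "Z \<in> \<C>" "x \<in> Z" "y \<in> Z" using chain by (metis subsetD)
        then show ?thesis using sub unfolding A_def by blast
      qed
      then show ?thesis using sub that(1) unfolding A_def by blast
    qed
  qed
  then obtain M where M: "M \<in> A" and max: "\<And>X. X \<in> A \<Longrightarrow> M \<subseteq> X \<Longrightarrow> X = M" by blast
  have Mc: "M \<subseteq> carrier G" "\<one> \<notin> M" and Mm: "\<And>x y. x \<in> M \<Longrightarrow> y \<in> M \<Longrightarrow> x \<otimes> y \<in> M"
    using M by (auto simp: A_def)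
  have Mpow: "x [^] Suc n \<in> M" if "x \<in> M" for x n
    by (induction n) (use that Mc Mm in auto)
  have Mpow': "x [^] n \<in> M" if "x \<in> M" "n > 0" for x and n :: nat
    using Mpow[OF that(1), of "n - 1"] that(2) by simp
  have ext: "\<exists>n>0. \<exists>q\<in>M. z [^] (n::nat) \<otimes> q = \<one>"
    if z: "z \<in> carrier G" "z \<noteq> \<one>" "z \<notin> M" for z
  proof -
    define T where "T = {z [^] (n::nat) \<otimes> q | n q. q \<in> insert \<one> M \<and> (n > 0 \<or> q \<in> M)}"
    have TI: "z [^] n \<otimes> q \<in> T" if "q \<in> insert \<one> M" "n > 0 \<or> q \<in> M" for n :: nat and q
      using that unfolding T_def by blast
    have "M \<subseteq> T"
    proof
      fix x assume "x \<in> M"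
      then show "x \<in> T" using TI[of x 0] Mc by auto
    qed
    moreover have "z \<in> T" using TI[of \<one> 1] z by simp
    moreover have "x \<otimes> y \<in> T" if xy: "x \<in> T" "y \<in> T" for x y
    proof -
      obtain n q where x: "x = z [^] (n::nat) \<otimes> q" "q \<in> insert \<one> M" "n > 0 \<or> q \<in> M" using xy by (auto simp: T_def)
      obtain m r where y: "y = z [^] (m::nat) \<otimes> r" "r \<in> insert \<one> M" "m > 0 \<or> r \<in> M" using xy by (auto simp: T_def)
      have c: "q \<in> carrier G" "r \<in> carrier G" using x y Mc by auto
      have "x \<otimes> y = (z [^] n \<otimes> z [^] m) \<otimes> (q \<otimes> r)" unfolding x(1) y(1) using c z by (simp add: m_ac)
      then have "x \<otimes> y = z [^] (n + m) \<otimes> (q \<otimes> r)" using z by (simp add: nat_pow_mult)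
      moreover have "q \<otimes> r \<in> insert \<one> M" "n + m > 0 \<or> q \<otimes> r \<in> M" using x y c Mm by auto
      ultimately show ?thesis using TI by simp
    qed
    moreover have "T \<subseteq> carrier G" using z Mc by (auto simp: T_def)
    moreover have "S \<subseteq> T" using M \<open>M \<subseteq> T\<close> by (auto simp: A_def)
    ultimately have "\<one> \<in> T" using max[of T] z unfolding A_def by blast
    then obtain n q where nq: "\<one> = z [^] (n::nat) \<otimes> q" "q \<in> insert \<one> M" "n > 0 \<or> q \<in> M" by (auto simp: T_def)
    have "q \<in> M"
    proof (rule ccontr)
      assume "q \<notin> M"
      then have "n > 0" "z [^] n = \<one>" using nq z by auto
      then show False using tf z by (auto simp: torsion_free_def)
    qed
    moreover have "n > 0" using nq calculation Mc by (cases n) auto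
    ultimately show ?thesis using nq by metis
  qed
  have "left_cone G (carrier G) {\<one>} M"
  proof (intro left_cone.intro left_cone_axioms.intro group_axioms)
    show "subgroup (carrier G) G" "subgroup {\<one>} G" by (rule subgroup_self) (rule triv_subgroup)
    show "x \<notin> {\<one>}" if "x \<in> M" for x using that Mc by auto
    show "inv x \<notin> M" if "x \<in> M" for x using that Mc Mm[of x "inv x"] by auto
    show "x \<in> {\<one>} \<or> x \<in> M \<or> inv x \<in> M" if x: "x \<in> carrier G" for x
    proof (rule ccontr)
      assume no: "\<not> ?thesis"
      then obtain n q where n: "n > 0" "q \<in> M" "x [^] (n::nat) \<otimes> q = \<one>" using ext x by blast
      have "inv x \<noteq> \<one>" using no x by (metis inv_inv inv_one singletonI)
      then obtain m r where m: "m > 0" "r \<in> M" "(inv x) [^] (m::nat) \<otimes> r = \<one>" using ext[of "inv x"] no x by blast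
      have c: "q \<in> carrier G" "r \<in> carrier G" using n m Mc by auto
      have q: "q = inv (x [^] n)" using n c x by (metis inv_equality m_comm nat_pow_closed)
      have "r = inv (inv (x [^] m))" using m c x by (metis inv_equality inv_closed m_comm nat_pow_closed nat_pow_inv)
      then have r: "r = x [^] m" using x by simp
      \<comment> \<open>\<open>q\<close> is the inverse of \<open>x [^] n\<close> and
        \<open>r\<close> is \<open>x [^] m\<close>, so the powers with exponents \<open>m\<close>
        and \<open>n\<close> cancel.\<close>
      have "q [^] m = inv (x [^] (n * m))" using x by (simp add: q nat_pow_pow nat_pow_inv[symmetric])
      moreover have "r [^] n = x [^] (n * m)" using x by (simp add: r nat_pow_pow mult.commute)
      ultimately have "q [^] m \<otimes> r [^] n = \<one>" using x by simp
      then show False using Mm[OF Mpow' Mpow'] n m Mc by metis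
    qed
  qed (use Mc Mm in auto)
  moreover have "S \<subseteq> M" using M by (auto simp: A_def)
  ultimately show ?thesis using that by blast
qed

text \<open>A finite set \<open>E\<close> of minimal size whose rational cone contains \<open>Q\<close> has at most one element:
  for distinct \<open>p, p'\<close> in \<open>E\<close>, one of the two quotients of \<open>p\<close> and \<open>p'\<close> is positive, hence in the
  rational cone of \<open>E\<close>, which makes one of \<open>p, p'\<close> redundant.\<close>

lemma isolated_cone_rank:
  assumes tf: "torsion_free G" and Q: "left_cone G (carrier G) {\<one>} Q" and F: "finite F" "F \<subseteq> Q"
    and uniq: "\<And>Q'. left_cone G (carrier G) {\<one>} Q' \<Longrightarrow> F \<subseteq> Q' \<Longrightarrow> Q' = Q"
  shows "\<exists>s\<in>carrier G. \<forall>y\<in>carrier G. \<exists>n>0. \<exists>m::int. y [^] (n::nat) \<otimes> s [^] m = \<one>"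
proof -
  interpret Q: left_cone G "carrier G" "{\<one>}" Q by fact
  define gen where "gen E \<longleftrightarrow> finite E \<and> E \<subseteq> Q \<and> (\<forall>q\<in>Q. \<exists>n>0. q [^] (n::nat) \<in> mspan E)" for E
  have mspan_Q: "s \<in> insert \<one> Q" if "s \<in> mspan E" "E \<subseteq> Q" for s E
    using that by (induction rule: mspan.induct) (use Q.P_mult in auto)
  have "gen F" unfolding gen_def
  proof (intro conjI ballI F, rule ccontr)
    fix q assume q: "q \<in> Q" and no: "\<not> (\<exists>n>0. q [^] (n::nat) \<in> mspan F)"
    have qc: "q \<in> carrier G" using q by simp
    have Fc: "F \<subseteq> carrier G" using F by auto
    \<comment> \<open>A \<open>q\<close> outside the rational cone of \<open>F\<close> could be made
      negative while \<open>F\<close> stays positive: \<open>inv q\<close> and \<open>F\<close>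
      generate a semigroup without \<open>\<one>\<close>, and its extension to a cone contradicts
      uniqueness.\<close>
    define T where "T = {inv q [^] (n::nat) \<otimes> s | n s. s \<in> mspan F \<and> (n > 0 \<or> s \<in> Q)}"
    have TI: "inv q [^] n \<otimes> s \<in> T" if "s \<in> mspan F" "n > 0 \<or> s \<in> Q" for n :: nat and s
      using that unfolding T_def by blast
    have "x \<otimes> y \<in> T" if xy: "x \<in> T" "y \<in> T" for x y
    proof -
      obtain n s where x: "x = inv q [^] (n::nat) \<otimes> s" "s \<in> mspan F" "n > 0 \<or> s \<in> Q" using xy by (auto simp: T_def)
      obtain m r where y: "y = inv q [^] (m::nat) \<otimes> r" "r \<in> mspan F" "m > 0 \<or> r \<in> Q" using xy by (auto simp: T_def)
      have c: "s \<in> carrier G" "r \<in> carrier G" using x y mspan_carrier Fc by auto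
      have "x \<otimes> y = (inv q [^] n \<otimes> inv q [^] m) \<otimes> (s \<otimes> r)" unfolding x(1) y(1) using c qc by (simp add: m_ac)
      then have "x \<otimes> y = inv q [^] (n + m) \<otimes> (s \<otimes> r)" using qc by (simp add: nat_pow_mult)
      moreover have "s \<otimes> r \<in> mspan F" using mspan_mult[OF Fc y(2) x(2)] .
      moreover have "n + m > 0 \<or> s \<otimes> r \<in> Q" using x y Q.P_mult by auto
      ultimately show ?thesis using TI by simp
    qed
    moreover have "T \<subseteq> carrier G" using qc mspan_carrier[OF Fc] by (auto simp: T_def)
    moreover have "\<one> \<notin> T"
    proof
      assume "\<one> \<in> T"
      then obtain n s where ns: "inv q [^] (n::nat) \<otimes> s = \<one>" "s \<in> mspan F" "n > 0 \<or> s \<in> Q" by (auto simp: T_def)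
      have sc: "s \<in> carrier G" using mspan_carrier[OF Fc ns(2)] .
      have "s = q [^] n"
        using ns(1) sc qc by (metis inv_equality inv_inv m_comm nat_pow_closed nat_pow_inv inv_closed)
      then have "n = 0" using no ns(2) by (metis gr0I)
      then show False using \<open>s = q [^] n\<close> ns(3) Q.one_notin_P by simp
    qed
    ultimately obtain Q' where Q': "left_cone G (carrier G) {\<one>} Q'" "T \<subseteq> Q'"
      using semigroup_extends_to_cone[OF tf] by blast
    have "p \<in> T" if "p \<in> F" for p
      using TI[of p 0] mspan_incl[OF Fc that] F(2) that Fc by auto
    then have "Q' = Q" using uniq[OF Q'(1)] Q'(2) by blast
    moreover have "inv q \<in> T" using TI[OF mspan.one, of 1] qc by simp
    ultimately show False using Q' Q.asym q by blast
  qed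
  then obtain E where E: "gen E" and min: "\<And>E'. gen E' \<Longrightarrow> card E \<le> card E'"
    using ex_has_least_nat[of gen F card] by blast
  have Efin: "finite E" and EQ: "E \<subseteq> Q" and Ec: "E \<subseteq> carrier G" and Egen: "\<And>q. q \<in> Q \<Longrightarrow> \<exists>n>0. q [^] (n::nat) \<in> mspan E"
    using E by (auto simp: gen_def)
  have no_pos: False if p: "p \<in> E" "p' \<in> E" "p \<noteq> p'" "p \<otimes> inv p' \<in> Q" for p p'
  proof -
    have c: "p \<in> carrier G" "p' \<in> carrier G" using p Ec by auto
    define E' where "E' = E - {p}"
    have E': "E' \<subseteq> carrier G" "E = insert p E'" "p' \<in> E'" "E' \<subseteq> Q" using Ec p EQ by (auto simp: E'_def)
    obtain n where n: "n > 0" "(p \<otimes> inv p') [^] (n::nat) \<in> mspan E" using Egen p by blast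
    then obtain k s where s: "s \<in> mspan E'" and eq: "(p \<otimes> inv p') [^] n = p [^] (k::nat) \<otimes> s"
      using mspan_insert[OF E'(1) c(1)] E'(2) by metis
    have sc: "s \<in> carrier G" using mspan_carrier[OF E'(1) s] .
    have "p [^] n = p [^] n \<otimes> inv (p' [^] n) \<otimes> p' [^] n" using c by (simp add: m_assoc)
    also have "p [^] n \<otimes> inv (p' [^] n) = p [^] k \<otimes> s"
      using eq c by (simp add: nat_pow_distrib nat_pow_inv)
    finally have pn: "p [^] n = p [^] k \<otimes> (s \<otimes> p' [^] n)" using c sc by (simp add: m_assoc)
    \<comment> \<open>The smaller power of \<open>p\<close> is cancelled in \<open>pn\<close>.
      Either a positive power of \<open>p\<close> lies in \<open>mspan E'\<close>, so
      \<open>p\<close> is redundant and \<open>E\<close> is not minimal, or \<open>\<one>\<close>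
      becomes a product of positive elements.\<close>
    show False
    proof (cases "k < n")
      case True
      have "p [^] n = p [^] k \<otimes> p [^] (n - k)" using True c by (simp add: nat_pow_mult)
      then have "p [^] (n - k) = s \<otimes> p' [^] n" using pn c sc by simp
      then have pow: "p [^] (n - k) \<in> mspan E'"
        using mspan_mult[OF E'(1) mspan_pow[OF E'(1) mspan_incl[OF E'(1) E'(3)]] s] by simp
      have "\<exists>m>0. q [^] (m::nat) \<in> mspan E'" if q: "q \<in> Q" for q
      proof -
        have qc: "q \<in> carrier G" using q by simp
        obtain m where m: "m > 0" "q [^] (m::nat) \<in> mspan E" using Egen q by blast
        then obtain l r where r: "r \<in> mspan E'" "q [^] m = p [^] (l::nat) \<otimes> r"
          using mspan_insert[OF E'(1) c(1)] E'(2) by metis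
        have rc: "r \<in> carrier G" using mspan_carrier[OF E'(1) r(1)] .
        have "q [^] (m * (n - k)) = (q [^] m) [^] (n - k)" using qc by (simp add: nat_pow_pow)
        also have "\<dots> = (p [^] l) [^] (n - k) \<otimes> r [^] (n - k)" using r rc c by (simp add: nat_pow_distrib)
        also have "(p [^] l) [^] (n - k) = (p [^] (n - k)) [^] l" using c by (simp add: nat_pow_pow mult.commute)
        finally have "q [^] (m * (n - k)) \<in> mspan E'"
          using mspan_mult[OF E'(1) mspan_pow[OF E'(1) r(1)] mspan_pow[OF E'(1) pow]] by simp
        moreover have "m * (n - k) > 0" using m True by simp
        ultimately show ?thesis by blast
      qed
      then have "gen E'" using Efin EQ by (auto simp: gen_def E'_def)
      moreover have "card E' < card E" using Efin p(1) unfolding E'_def by (rule card_Diff1_less)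
      ultimately show False using min[of E'] by simp
    next
      case False
      have pk: "p [^] k = p [^] n \<otimes> p [^] (k - n)" using False c by (simp add: nat_pow_mult)
      have "p [^] n \<otimes> \<one> = p [^] n" using c by simp
      also note pn
      also have "p [^] k \<otimes> (s \<otimes> p' [^] n) = p [^] n \<otimes> (p [^] (k - n) \<otimes> (s \<otimes> p' [^] n))"
        unfolding pk using c sc by (simp only: m_assoc nat_pow_closed m_closed)
      finally have eq: "p [^] n \<otimes> \<one> = p [^] n \<otimes> (p [^] (k - n) \<otimes> (s \<otimes> p' [^] n))" .
      have "p [^] (k - n) \<otimes> (s \<otimes> p' [^] n) \<in> carrier G" using c sc by simp
      then have one: "\<one> = p [^] (k - n) \<otimes> (s \<otimes> p' [^] n)"
        using eq Units_l_cancel[of "p [^] n" \<one> "p [^] (k - n) \<otimes> (s \<otimes> p' [^] n)"] c Units_eq by blast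
      have "p' [^] n \<in> Q" using Q.P_pow' n E' by blast
      then have "s \<otimes> p' [^] n \<in> Q" using mspan_Q[OF s E'(4)] Q.P_mult by auto
      moreover have "p [^] (k - n) \<in> Q \<union> {\<one>}" using Q.pow_PC p EQ by blast
      ultimately have "p [^] (k - n) \<otimes> (s \<otimes> p' [^] n) \<in> Q" using Q.P_mult Q.CP_mult by blast
      then show False using one Q.one_notin_P by metis
    qed
  qed
  have single: "p = p'" if p: "p \<in> E" "p' \<in> E" for p p'
  proof (rule ccontr)
    assume ne: "p \<noteq> p'"
    have c: "p \<in> carrier G" "p' \<in> carrier G" using p Ec by auto
    have "p \<otimes> inv p' \<noteq> \<one>" using ne c by (metis inv_equality inv_inv inv_closed)
    moreover have "inv (p \<otimes> inv p') = p' \<otimes> inv p" using c by (simp add: inv_mult_group)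
    ultimately have "p \<otimes> inv p' \<in> Q \<or> p' \<otimes> inv p \<in> Q" using Q.total[of "p \<otimes> inv p'"] c by auto
    then show False using no_pos p ne by blast
  qed
  show ?thesis
  proof (cases "E = {}")
    \<comment> \<open>The group is trivial in this case, and \<open>\<one>\<close> is a valid
      witness; a nontrivial one is obtained only where the quotient is known to be
      nontrivial.\<close>
    case True
    have "q [^] n \<noteq> \<one>" if "q \<in> Q" "n > 0" for q and n :: nat
      using Q.P_pow' that Q.one_notin_P by metis
    moreover have "x = \<one>" if "x \<in> mspan {}" for x using that by (cases rule: mspan.cases) auto
    ultimately have "Q = {}" using Egen True by (metis ex_in_conv)
    have "y [^] (1::nat) \<otimes> \<one> [^] (0::int) = \<one>" if "y \<in> carrier G" for y
      using Q.total[OF that] \<open>Q = {}\<close> by auto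
    then have "\<exists>n>0. \<exists>m::int. y [^] (n::nat) \<otimes> \<one> [^] m = \<one>" if "y \<in> carrier G" for y
      using that zero_less_one by metis
    then show ?thesis using one_closed by blast
  next
    case False
    then obtain p where p: "E = {p}" using single by blast
    have pc: "p \<in> carrier G" using p Ec by auto
    have pos: "\<exists>n>0. \<exists>m::int. q [^] (n::nat) \<otimes> p [^] m = \<one>" if q: "q \<in> Q" for q
    proof -
      obtain n where n: "n > 0" "q [^] (n::nat) \<in> mspan {p}" using Egen q p by blast
      then obtain k s where s: "s \<in> mspan {}" "q [^] n = p [^] (k::nat) \<otimes> s"
        using mspan_insert[of "{}" p] pc by blast
      have "s = \<one>" using s(1) by (cases rule: mspan.cases) auto
      then have "q [^] n \<otimes> p [^] (- int k) = \<one>" using s pc by (simp add: int_pow_neg int_pow_int)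
      then show ?thesis using n by blast
    qed
    have "\<exists>n>0. \<exists>m::int. y [^] (n::nat) \<otimes> p [^] m = \<one>" if y: "y \<in> carrier G" for y
      using Q.total[OF y]
    proof (elim disjE)
      assume "y \<in> {\<one>}"
      then have "y [^] (1::nat) \<otimes> p [^] (0::int) = \<one>" by simp
      then show ?thesis using zero_less_one by blast
    next
      assume "inv y \<in> Q"
      then obtain n m where n: "n > 0" "inv y [^] (n::nat) \<otimes> p [^] (m::int) = \<one>" using pos by blast
      have "y [^] n \<otimes> p [^] (- m) = inv (inv y [^] n \<otimes> p [^] m)"
        using y pc by (simp add: inv_mult int_pow_neg nat_pow_inv)
      then have "y [^] n \<otimes> p [^] (- m) = \<one>" using n by simp
      then show ?thesis using n by blast
    qed (rule pos)
    then show ?thesis using pc by blast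
  qed
qed

end

section \<open>Rational quotients\<close>

text \<open>Torsion-free abelian of rank 1, spelled out for \<open>K\<close> over \<open>H\<close>
  in terms of elements. Normality is contained in \<open>abelian_over\<close>, and the last clause
  is \<open>rank_one_iff\<close> modulo \<open>H\<close>.\<close>

definition (in group) rational_over where
  "rational_over K H \<longleftrightarrow> H \<subseteq> K \<and> abelian_over K H \<and>
     (\<forall>x\<in>K. \<forall>n>0. x [^] (n::nat) \<in> H \<longrightarrow> x \<in> H) \<and>
     (\<exists>s\<in>K - H. \<forall>y\<in>K. \<exists>n>0. \<exists>m::int. y [^] (n::nat) \<otimes> s [^] m \<in> H)"

context normal
begin

lemma coset_eq_self_iff: "a \<in> carrier G \<Longrightarrow> H #> a = H \<longleftrightarrow> a \<in> H"
  using coset_join2 rcos_self subgroup_axioms by metis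

lemma coset_eq_iff:
  assumes "a \<in> carrier G" "b \<in> carrier G"
  shows "H #> a = H #> b \<longleftrightarrow> inv b \<otimes> a \<in> H"
proof -
  have "H #> a = H #> b \<longleftrightarrow> a \<in> H #> b"
    using repr_independence[of a H b] rcos_self[of a H] assms subgroup_axioms by blast
  also have "\<dots> \<longleftrightarrow> a \<otimes> inv b \<in> H" using rcos_module[OF is_group] assms by simp
  also have "\<dots> \<longleftrightarrow> inv b \<otimes> a \<in> H"
    using inv_op_closed1[of b "a \<otimes> inv b"] inv_op_closed2[of b "inv b \<otimes> a"] assms by (auto simp: m_assoc)
  finally show ?thesis .
qed

lemma Mod_carrier: "carrier (G Mod H) = (\<lambda>a. H #> a) ` carrier G"
  by (simp add: carrier_FactGroup)

lemma Mod_inv: "a \<in> carrier G \<Longrightarrow> inv\<^bsub>G Mod H\<^esub> (H #> a) = H #> inv a"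
  using inv_FactGroup[of "H #> a"] rcos_inv[of a] Mod_carrier by simp

lemma comm_group_Mod_iff: "comm_group (G Mod H) \<longleftrightarrow> abelian_over (carrier G) H"
proof -
  have "comm_group (G Mod H) \<longleftrightarrow>
      (\<forall>x\<in>carrier (G Mod H). \<forall>y\<in>carrier (G Mod H). x \<otimes>\<^bsub>G Mod H\<^esub> y = y \<otimes>\<^bsub>G Mod H\<^esub> x)"
    using group.group_comm_groupI[OF factorgroup_is_group] comm_groupE(4) by metis
  also have "\<dots> \<longleftrightarrow> (\<forall>a\<in>carrier G. \<forall>b\<in>carrier G. H #> (a \<otimes> b) = H #> (b \<otimes> a))"
    unfolding Mod_carrier ball_simps by (simp add: rcos_sum)
  also have "\<dots> \<longleftrightarrow> abelian_over (carrier G) H"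
    by (simp add: abelian_over_def coset_eq_iff)
  finally show ?thesis .
qed

lemma torsion_free_Mod_iff:
  "torsion_free (G Mod H) \<longleftrightarrow> (\<forall>x\<in>carrier G. \<forall>n>0. x [^] (n::nat) \<in> H \<longrightarrow> x \<in> H)"
proof -
  have "torsion_free (G Mod H) \<longleftrightarrow>
      (\<forall>x\<in>carrier G. \<forall>n::nat. n > 0 \<and> H #> (x [^] n) = H \<longrightarrow> H #> x = H)"
    unfolding torsion_free_def Mod_carrier ball_simps by (simp add: FactGroup_pow)
  then show ?thesis by (auto simp: coset_eq_self_iff)
qed

lemma rank_Mod_iff:
  assumes "comm_group (G Mod H)" "torsion_free (G Mod H)"
  shows "has_rank (G Mod H) 1 \<longleftrightarrow>
    (\<exists>s\<in>carrier G - H. \<forall>y\<in>carrier G. \<exists>n>0. \<exists>m::int. y [^] (n::nat) \<otimes> s [^] m \<in> H)"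
proof -
  have "has_rank (G Mod H) 1 \<longleftrightarrow>
      (\<exists>s\<in>carrier G. H #> s \<noteq> H \<and>
         (\<forall>y\<in>carrier G. \<exists>n>0. \<exists>m::int. H #> (y [^] (n::nat) \<otimes> s [^] m) = H))"
    unfolding comm_group.rank_one_iff[OF assms] Mod_carrier bex_simps ball_simps
    by (simp add: FactGroup_pow FactGroup_int_pow rcos_sum)
  also have "\<dots> \<longleftrightarrow>
      (\<exists>s\<in>carrier G - H. \<forall>y\<in>carrier G. \<exists>n>0. \<exists>m::int. y [^] (n::nat) \<otimes> s [^] m \<in> H)"
    by (auto simp: coset_eq_self_iff)
  finally show ?thesis .
qed

lemma rational_Mod_iff:
  "comm_group (G Mod H) \<and> torsion_free (G Mod H) \<and> has_rank (G Mod H) 1 \<longleftrightarrow> rational_over (carrier G) H"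
  unfolding rational_over_def using comm_group_Mod_iff torsion_free_Mod_iff rank_Mod_iff subset by blast

lemma cone_pullback:
  assumes "left_cone (G Mod H) (carrier (G Mod H)) {\<one>\<^bsub>G Mod H\<^esub>} Q"
  shows "left_cone G (carrier G) H {x \<in> carrier G. H #> x \<in> Q}"
proof -
  interpret Q: left_cone "G Mod H" "carrier (G Mod H)" "{\<one>\<^bsub>G Mod H\<^esub>}" Q by fact
  show ?thesis
  proof (intro left_cone.intro left_cone_axioms.intro group_axioms)
    show "subgroup (carrier G) G" "subgroup H G" by (rule subgroup_self) (rule subgroup_axioms)
    show "x \<notin> H" if "x \<in> {x \<in> carrier G. H #> x \<in> Q}" for x
      using that Q.disjoint[of "H #> x"] by (auto simp: coset_eq_self_iff)
    show "inv x \<notin> {x \<in> carrier G. H #> x \<in> Q}" if "x \<in> {x \<in> carrier G. H #> x \<in> Q}" for x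
      using that Q.asym[of "H #> x"] by (auto simp: Mod_inv)
    show "x \<in> H \<or> x \<in> {x \<in> carrier G. H #> x \<in> Q} \<or> inv x \<in> {x \<in> carrier G. H #> x \<in> Q}"
      if "x \<in> carrier G" for x
      using that Q.total[of "H #> x"] by (auto simp: Mod_inv Mod_carrier coset_eq_self_iff)
    show "x \<otimes> y \<in> {x \<in> carrier G. H #> x \<in> Q}"
      if "x \<in> {x \<in> carrier G. H #> x \<in> Q}" "y \<in> {x \<in> carrier G. H #> x \<in> Q}" for x y
      using that Q.P_mult[of "H #> x" "H #> y"] by (auto simp: rcos_sum)
  qed (use subset in auto)
qed

lemma cone_mem_coset:
  assumes "left_cone G (carrier G) H P" "x \<in> carrier G" "y \<in> P" "H #> x = H #> y" shows "x \<in> P"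
proof -
  interpret P: left_cone G "carrier G" H P by fact
  have "inv y \<otimes> x \<in> H" using coset_eq_iff[of x y] assms by simp
  then have "y \<otimes> (inv y \<otimes> x) \<in> P" using P.PC_mult assms by blast
  then show ?thesis using assms by simp
qed

lemma cone_image:
  assumes "left_cone G (carrier G) H P"
  shows "left_cone (G Mod H) (carrier (G Mod H)) {\<one>\<^bsub>G Mod H\<^esub>} ((\<lambda>x. H #> x) ` P)"
proof -
  interpret P: left_cone G "carrier G" H P by fact
  interpret Q: group "G Mod H" by (rule factorgroup_is_group)
  have mem: "H #> x \<in> (\<lambda>x. H #> x) ` P \<longleftrightarrow> x \<in> P" if "x \<in> carrier G" for x
    using cone_mem_coset[OF assms that] by blast
  show ?thesis
  proof (intro left_cone.intro left_cone_axioms.intro factorgroup_is_group)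
    show "subgroup (carrier (G Mod H)) (G Mod H)" "subgroup {\<one>\<^bsub>G Mod H\<^esub>} (G Mod H)"
      by (rule Q.subgroup_self) (rule Q.triv_subgroup)
    show "x \<notin> {\<one>\<^bsub>G Mod H\<^esub>}" if "x \<in> (\<lambda>x. H #> x) ` P" for x
      using that P.disjoint coset_eq_self_iff by auto
    show "inv\<^bsub>G Mod H\<^esub> x \<notin> (\<lambda>x. H #> x) ` P" if "x \<in> (\<lambda>x. H #> x) ` P" for x
      using that mem P.asym by (force simp: Mod_inv)
    show "x \<in> {\<one>\<^bsub>G Mod H\<^esub>} \<or> x \<in> (\<lambda>x. H #> x) ` P \<or> inv\<^bsub>G Mod H\<^esub> x \<in> (\<lambda>x. H #> x) ` P"
      if x: "x \<in> carrier (G Mod H)" for x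
    proof -
      obtain a where a: "a \<in> carrier G" "x = H #> a" using x by (auto simp: Mod_carrier)
      show ?thesis using P.total[OF a(1)] a mem[of a] mem[of "inv a"]
        by (auto simp: Mod_inv coset_eq_self_iff)
    qed
    show "x \<otimes>\<^bsub>G Mod H\<^esub> y \<in> (\<lambda>x. H #> x) ` P"
      if "x \<in> (\<lambda>x. H #> x) ` P" "y \<in> (\<lambda>x. H #> x) ` P" for x y
      using that P.P_mult by (force simp: rcos_sum)
    show "{\<one>\<^bsub>G Mod H\<^esub>} \<subseteq> carrier (G Mod H)" using Q.one_closed by blast
  qed (auto simp: Mod_carrier)
qed

text \<open>By torsion-freeness, the positive powers of the coset of \<open>t\<close> form a
  semigroup without the identity, which extends to a cone on the quotient.\<close>

lemma rational_cone_exists: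
  assumes r: "rational_over (carrier G) H" and t: "t \<in> carrier G" "t \<notin> H"
  obtains Q where "left_cone G (carrier G) H Q" "t \<in> Q"
proof -
  have A: "comm_group (G Mod H)" "torsion_free (G Mod H)" using r rational_Mod_iff by blast+
  interpret A: comm_group "G Mod H" by (rule A(1))
  define S where "S = {H #> (t [^] n) | n::nat. n > 0}"
  have SI: "H #> (t [^] n) \<in> S" if "n > 0" for n :: nat using that unfolding S_def by blast
  have "S \<subseteq> carrier (G Mod H)" using t by (auto simp: S_def Mod_carrier)
  moreover have "t [^] n \<notin> H" if "n > 0" for n :: nat using r t that unfolding rational_over_def by blast
  then have "\<one>\<^bsub>G Mod H\<^esub> \<notin> S" using t coset_eq_self_iff by (auto simp: S_def)
  moreover have "x \<otimes>\<^bsub>G Mod H\<^esub> y \<in> S" if xy: "x \<in> S" "y \<in> S" for x y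
  proof -
    obtain n m :: nat where "n > 0" "m > 0" "x = H #> (t [^] n)" "y = H #> (t [^] m)" using xy by (auto simp: S_def)
    then show ?thesis using SI[of "n + m"] t by (simp add: rcos_sum nat_pow_mult)
  qed
  ultimately obtain Q where Q: "left_cone (G Mod H) (carrier (G Mod H)) {\<one>\<^bsub>G Mod H\<^esub>} Q" "S \<subseteq> Q"
    using A.semigroup_extends_to_cone[OF A(2)] by blast
  have "H #> t \<in> Q" using SI[of 1] Q(2) t by auto
  then show ?thesis using that[OF cone_pullback[OF Q(1)]] t by blast
qed

lemma isolated_cone_rational:
  assumes ab: "abelian_over (carrier G) H" and ne: "H \<noteq> carrier G"
    and Q: "left_cone G (carrier G) H Q" and F: "finite F" "F \<subseteq> Q"
    and uniq: "\<And>Q'. left_cone G (carrier G) H Q' \<Longrightarrow> F \<subseteq> Q' \<Longrightarrow> Q' = Q"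
  shows "rational_over (carrier G) H"
proof -
  interpret Q: left_cone G "carrier G" H Q by fact
  interpret A: comm_group "G Mod H" using ab comm_group_Mod_iff by blast
  let ?p = "\<lambda>x. H #> x"
  have tf: "torsion_free (G Mod H)" using torsion_free_Mod_iff Q.isolated by blast
  have "Q' = ?p ` Q" if Q': "left_cone (G Mod H) (carrier (G Mod H)) {\<one>\<^bsub>G Mod H\<^esub>} Q'" "?p ` F \<subseteq> Q'" for Q'
  proof -
    have "F \<subseteq> {x \<in> carrier G. ?p x \<in> Q'}" using F(2) Q'(2) Q.P_subset by blast
    then have "{x \<in> carrier G. ?p x \<in> Q'} = Q" by (rule uniq[OF cone_pullback[OF Q'(1)]])
    moreover have "Q' \<subseteq> carrier (G Mod H)" using left_cone.P_subset[OF Q'(1)] .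
    ultimately show ?thesis unfolding Mod_carrier by blast
  qed
  then have "\<exists>s\<in>carrier (G Mod H). \<forall>y\<in>carrier (G Mod H). \<exists>n>0. \<exists>m::int.
      y [^]\<^bsub>G Mod H\<^esub> (n::nat) \<otimes>\<^bsub>G Mod H\<^esub> s [^]\<^bsub>G Mod H\<^esub> m = \<one>\<^bsub>G Mod H\<^esub>"
    using A.isolated_cone_rank[OF tf cone_image[OF Q], of "?p ` F"] F by blast
  then have "\<exists>s\<in>carrier G. \<forall>y\<in>carrier G. \<exists>n>0. \<exists>m::int. H #> (y [^] (n::nat) \<otimes> s [^] m) = H"
    unfolding Mod_carrier bex_simps ball_simps by (simp add: FactGroup_pow FactGroup_int_pow rcos_sum)
  then obtain s where s: "s \<in> carrier G" "\<And>y. y \<in> carrier G \<Longrightarrow> \<exists>n>0. \<exists>m::int. y [^] (n::nat) \<otimes> s [^] m \<in> H"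
    by (auto simp: coset_eq_self_iff)
  \<comment> \<open>\<open>isolated_cone_rank\<close> also allows a trivial witness. With
    \<open>s\<close> in \<open>H\<close>, a positive power of every element would lie in
    \<open>H\<close>, against \<open>H \<noteq> carrier G\<close>.\<close>
  have "s \<notin> H"
  proof
    assume sH: "s \<in> H"
    have "y \<in> H" if y: "y \<in> carrier G" for y
    proof -
      obtain n m where n: "n > 0" "y [^] (n::nat) \<otimes> s [^] (m::int) \<in> H" using s y by blast
      have sm: "s [^] m \<in> H" using sH subgroup_int_pow_closed subgroup_axioms by blast
      then have "y [^] n \<otimes> s [^] m \<otimes> inv (s [^] m) \<in> H" using n by blast
      then have "y [^] n \<in> H" using y s by (simp add: m_assoc)
      then show ?thesis using Q.isolated y n by blast
    qed
    then show False using ne subset by blast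
  qed
  then show ?thesis unfolding rational_over_def using subset ab Q.isolated s by blast
qed

end

section \<open>Subgroups as groups of their own and as subsets of \<open>G\<close>\<close>

context group
begin

lemma sub_pow: "x [^]\<^bsub>sub G K\<^esub> (n::nat) = x [^] n"
  by (simp add: nat_pow_consistent[symmetric])

lemma subgroup_sub_iff: "subgroup K G \<Longrightarrow> subgroup H (sub G K) \<longleftrightarrow> subgroup H G \<and> H \<subseteq> K"
  using incl_subgroup[of K H] subgroup_incl[of H K] subgroup.subset[of H "sub G K"] by auto

lemma left_cone_sub_iff:
  assumes K: "subgroup K G" and D: "D \<subseteq> K"
  shows "left_cone (sub G K) D H P \<longleftrightarrow> left_cone G D H P"
proof -
  have inv: "inv\<^bsub>sub G K\<^esub> x = inv x" if "x \<in> D" for x using that K D by auto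
  have "left_cone_axioms (sub G K) D H P \<longleftrightarrow> left_cone_axioms G D H P"
  proof (cases "P \<subseteq> D \<and> H \<subseteq> D")
    case True
    then have "H \<subseteq> K" "\<And>x. x \<in> P \<Longrightarrow> inv\<^bsub>sub G K\<^esub> x = inv x" using D inv by auto
    then show ?thesis by (simp add: left_cone_axioms_def subgroup_sub_iff[OF K] inv D del: m_inv_consistent)
  qed (auto simp: left_cone_axioms_def)
  then show ?thesis unfolding left_cone_def using subgroup.subgroup_is_group[OF K] is_group by auto
qed

lemma conrad_cone_sub_iff:
  assumes K: "subgroup K G" and D: "D \<subseteq> K"
  shows "conrad_cone (sub G K) D H P \<longleftrightarrow> conrad_cone G D H P"
proof (cases "left_cone G D H P")
  case True
  then have inv: "inv\<^bsub>sub G K\<^esub> x = inv x" if "x \<in> P" for x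
    using that K D left_cone.P_subset[OF True] by auto
  show ?thesis
    unfolding conrad_cone_def left_cone_sub_iff[OF assms] conrad_cone_axioms_def sub_pow using inv by auto
qed (simp add: conrad_cone_def left_cone_sub_iff[OF assms])

text \<open>The commutator built from \<open>h\<close> and \<open>inv x\<close> becomes the
  conjugate \<open>x \<otimes> h \<otimes> inv x\<close> when multiplied by \<open>h\<close> from
  the left.\<close>

lemma abelian_over_normal:
  assumes "subgroup K G" "subgroup H G" "H \<subseteq> K" "abelian_over K H"
  shows "H \<lhd> sub G K"
proof -
  interpret K: subgroup K G by fact
  interpret H: subgroup H G by fact
  interpret S: group "sub G K" by (rule K.subgroup_is_group[OF is_group])
  have "x \<otimes> h \<otimes> inv x \<in> H" if x: "x \<in> K" and h: "h \<in> H" for x h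
  proof -
    have "inv (inv x \<otimes> h) \<otimes> (h \<otimes> inv x) \<in> H" using assms(3,4) x h unfolding abelian_over_def by blast
    then have "h \<otimes> (inv (inv x \<otimes> h) \<otimes> (h \<otimes> inv x)) \<in> H" using h by blast
    then show ?thesis using x h by (simp add: word_simps)
  qed
  then show ?thesis using S.normal_inv_iff subgroup_sub_iff[OF assms(1)] assms by auto
qed

lemma abelian_over_sub: "subgroup K G \<Longrightarrow> group.abelian_over (sub G K) K H \<longleftrightarrow> abelian_over K H"
  using subgroup.m_closed[of K G] m_inv_consistent[of K] subgroup.subgroup_is_group[of K G] is_group
  by (simp add: group.abelian_over_def abelian_over_def)

lemma rational_over_sub: "subgroup K G \<Longrightarrow> group.rational_over (sub G K) K H \<longleftrightarrow> rational_over K H"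
  using subgroup.subgroup_is_group[of K G] is_group
  by (auto simp: group.rational_over_def rational_over_def abelian_over_sub sub_pow int_pow_consistent[symmetric])

lemma abelian_quotient_iff:
  assumes "subgroup K G" "subgroup H G"
  shows "H \<lhd> sub G K \<and> comm_group (sub G K Mod H) \<longleftrightarrow> H \<subseteq> K \<and> abelian_over K H"
  using normal.comm_group_Mod_iff[of H "sub G K"] abelian_over_sub[OF assms(1)] abelian_over_normal[OF assms]
    subgroup_sub_iff[OF assms(1)] normal_imp_subgroup by auto

lemma rational_quotient_iff:
  assumes "subgroup K G" "subgroup H G"
  shows "H \<lhd> sub G K \<and> comm_group (sub G K Mod H) \<and> torsion_free (sub G K Mod H) \<and> has_rank (sub G K Mod H) 1
    \<longleftrightarrow> rational_over K H"
  using normal.rational_Mod_iff[of H "sub G K"] rational_over_sub[OF assms(1)] abelian_over_normal[OF assms]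
  by (auto simp: rational_over_def)

text \<open>Exponent 1 suffices: \<open>inv a \<otimes> (b \<otimes> a)\<close> is \<open>b\<close>
  times a commutator, hence in the same coset of \<open>H\<close> as \<open>b\<close>.\<close>

lemma abelian_conrad:
  assumes "left_cone G K H Q" "abelian_over K H" shows "conrad_cone G K H Q"
proof (intro conrad_cone.intro conrad_cone_axioms.intro assms)
  interpret Q: left_cone G K H Q by fact
  fix a b assume ab: "a \<in> Q" "b \<in> Q"
  then have "inv (a \<otimes> b) \<otimes> (b \<otimes> a) \<in> H" using assms(2) unfolding abelian_over_def by blast
  then have "b \<otimes> (inv (a \<otimes> b) \<otimes> (b \<otimes> a)) \<in> Q" using Q.PC_mult ab by blast
  then have "inv a \<otimes> (b \<otimes> a [^] (1::nat)) \<in> Q" using ab by (simp add: word_simps)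
  then show "\<exists>n::nat. inv a \<otimes> (b \<otimes> a [^] n) \<in> Q" ..
qed

lemma rational_conrad_exists:
  assumes K: "subgroup K G" "subgroup H G" and r: "rational_over K H" and t: "t \<in> K" "t \<notin> H"
  obtains Q where "conrad_cone G K H Q" "t \<in> Q"
proof -
  have HK: "H \<subseteq> K" "abelian_over K H" using r by (auto simp: rational_over_def)
  interpret N: normal H "sub G K" by (rule abelian_over_normal[OF K HK])
  obtain Q where Q: "left_cone (sub G K) K H Q" "t \<in> Q"
    using N.rational_cone_exists[of t] r rational_over_sub[OF K(1)] t by auto
  then have "left_cone G K H Q" using left_cone_sub_iff[OF K(1)] by blast
  then show ?thesis using that abelian_conrad HK Q by blast
qed

lemma isolated_rational_over:
  assumes ab: "abelian_over K H" and ne: "H \<noteq> K"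
    and Q: "left_cone G K H Q" and F: "finite F" "F \<subseteq> Q"
    and uniq: "\<And>Q'. left_cone G K H Q' \<Longrightarrow> F \<subseteq> Q' \<Longrightarrow> Q' = Q"
  shows "rational_over K H"
proof -
  interpret Q: left_cone G K H Q by fact
  interpret N: normal H "sub G K" using abelian_over_normal Q.subgroup_D Q.subgroup_C Q.C_subset ab by blast
  have "group.rational_over (sub G K) (carrier (sub G K)) H"
  proof (rule N.isolated_cone_rational)
    show "group.abelian_over (sub G K) (carrier (sub G K)) H"
      using ab abelian_over_sub[OF Q.subgroup_D] by simp
    show "left_cone (sub G K) (carrier (sub G K)) H Q" using Q left_cone_sub_iff[OF Q.subgroup_D] by simp
    show "Q' = Q" if "left_cone (sub G K) (carrier (sub G K)) H Q'" "F \<subseteq> Q'" for Q'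
      using uniq that left_cone_sub_iff[OF Q.subgroup_D] by simp
  qed (use ne F in auto)
  then show ?thesis using rational_over_sub[OF Q.subgroup_D] by simp
qed

text \<open>Rank one leaves no room for an isolated subgroup strictly between. An element of
  \<open>E - H\<close> is related to \<open>s\<close> with a nonzero exponent \<open>m\<close>, so a
  power of \<open>s\<close> and then \<open>s\<close> itself lie in \<open>E\<close>; then so does
  every \<open>y\<close>, being related to \<open>s\<close>.\<close>

lemma rational_over_intermediate:
  assumes r: "rational_over K H" and K: "subgroup K G" and E: "subgroup E G" "H \<subseteq> E" "E \<subset> K"
    and iso: "\<And>x n. x \<in> K \<Longrightarrow> x [^] (n::nat) \<in> E \<Longrightarrow> n > 0 \<Longrightarrow> x \<in> E"
  shows "E = H"
proof (rule ccontr)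
  interpret K: subgroup K G by fact
  interpret E: subgroup E G by fact
  assume "E \<noteq> H"
  then obtain e where e: "e \<in> E" "e \<notin> H" using E by blast
  obtain s where s: "s \<in> K" "\<And>y. y \<in> K \<Longrightarrow> \<exists>n>0. \<exists>m::int. y [^] (n::nat) \<otimes> s [^] m \<in> H"
    using r by (auto simp: rational_over_def)
  have tf: "\<And>x n. x \<in> K \<Longrightarrow> x [^] (n::nat) \<in> H \<Longrightarrow> n > 0 \<Longrightarrow> x \<in> H" using r by (auto simp: rational_over_def)
  have eK: "e \<in> K" using e E by blast
  obtain n m where n: "n > 0" "e [^] (n::nat) \<otimes> s [^] (m::int) \<in> H" using s eK by blast
  have "inv (e [^] n) \<otimes> (e [^] n \<otimes> s [^] m) \<in> E"
    using n e E subgroup_nat_pow[OF E(1) e(1), of n] by blast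
  then have sm: "s [^] m \<in> E" using eK s by simp
  have m0: "m \<noteq> 0"
  proof
    assume "m = 0"
    then show False using n tf[of e n] e eK by simp
  qed
  have "s [^] (nat \<bar>m\<bar>) \<in> E"
  proof (cases "m \<ge> 0")
    case True
    then show ?thesis using sm int_pow_int[of G s "nat m"] by simp
  next
    case False
    then have "inv (s [^] m) = s [^] (nat \<bar>m\<bar>)" using s int_pow_neg[of s m] int_pow_int[of G s "nat (- m)"] by simp
    then show ?thesis using sm E.m_inv_closed by metis
  qed
  then have sE: "s \<in> E" using iso s m0 by (metis zero_less_abs_iff zero_less_nat_eq)
  have "y \<in> E" if y: "y \<in> K" for y
  proof -
    obtain k l where k: "k > 0" "y [^] (k::nat) \<otimes> s [^] (l::int) \<in> H" using s y by blast
    have "s [^] l \<in> E" using sE subgroup_int_pow_closed E by blast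
    then have "y [^] k \<otimes> s [^] l \<otimes> inv (s [^] l) \<in> E" using k E by blast
    then have "y [^] k \<in> E" using y s by (simp add: m_assoc)
    then show ?thesis using iso y k by blast
  qed
  then show False using E by blast
qed

lemma rational_over_proper: "rational_over K H \<Longrightarrow> H \<subset> K"
  by (auto simp: rational_over_def)

end

section \<open>Isolated cones and rational chains\<close>

text \<open>Well-order the index set; the sign of an element is given by the first factor on which it does
  not vanish.\<close>

lemma (in group) lex_family:
  assumes I: "I \<noteq> {}" and cones: "\<And>i. i \<in> I \<Longrightarrow> conrad_cone G D (C i) (P i)"
  shows "\<exists>Q. conrad_cone G D (\<Inter>i\<in>I. C i) Q"
proof -
  obtain r where r: "well_order_on I r" using well_order_on by blast
  define less where "less i j \<longleftrightarrow> (i, j) \<in> r - Id" for i j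
  have wf: "wf (r - Id)" using r by (simp add: well_order_on_def)
  have less_trans: "less i k" if "less i j" "less j k" for i j k
  proof -
    have "trans r" "antisym r"
      using r by (auto simp: well_order_on_def linear_order_on_def partial_order_on_def preorder_on_def)
    then show ?thesis using that transD[of r i j k] antisymD[of r i j] by (auto simp: less_def)
  qed
  have less_total: "i = j \<or> less i j \<or> less j i" if "i \<in> I" "j \<in> I" for i j
    using that r unfolding less_def well_order_on_def linear_order_on_def total_on_def by auto
  define Q where "Q = {g. \<exists>i\<in>I. g \<in> P i \<and> (\<forall>j\<in>I. less j i \<longrightarrow> g \<in> C j)}"
  have QI: "g \<in> Q" if "i \<in> I" "g \<in> P i" "\<And>j. j \<in> I \<Longrightarrow> less j i \<Longrightarrow> g \<in> C j" for g i
    using that unfolding Q_def by blast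
  have sub: "subgroup (C i) G" "subgroup D G" "C i \<subseteq> D" "P i \<subseteq> D" if "i \<in> I" for i
    using conrad_cone.axioms(1)[OF cones[OF that]] by (auto simp: left_cone_def left_cone_axioms_def)
  obtain i0 where i0: "i0 \<in> I" using I by blast
  interpret D: subgroup D G using sub(2) i0 .
  have QE: "\<exists>i\<in>I. g \<in> P i \<and> (\<forall>j\<in>I. less j i \<longrightarrow> g \<in> C j)" if "g \<in> Q" for g
    using that by (simp add: Q_def)
  show ?thesis
  proof (intro exI[of _ Q] conrad_cone.intro left_cone.intro left_cone_axioms.intro conrad_cone_axioms.intro group_axioms)
    show "subgroup D G" by (rule D.subgroup_axioms)
    show "subgroup (\<Inter>i\<in>I. C i) G" using subgroups_Inter[of "C ` I"] sub I by blast
    show "(\<Inter>i\<in>I. C i) \<subseteq> D" using sub i0 by blast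
    show "Q \<subseteq> D" using QE sub(4) by blast
    show "x \<notin> (\<Inter>i\<in>I. C i)" if "x \<in> Q" for x
      using QE[OF that] left_cone.disjoint[OF conrad_cone.axioms(1)[OF cones]] by blast
    show "inv x \<notin> Q" if "x \<in> Q" for x
    proof
      assume "inv x \<in> Q"
      then obtain j where j: "j \<in> I" "inv x \<in> P j" "\<And>k. k \<in> I \<Longrightarrow> less k j \<Longrightarrow> inv x \<in> C k"
        using QE[of "inv x"] by auto
      obtain i where i: "i \<in> I" "x \<in> P i" "\<And>k. k \<in> I \<Longrightarrow> less k i \<Longrightarrow> x \<in> C k"
        using QE[OF \<open>x \<in> Q\<close>] by auto
      interpret i: conrad_cone G D "C i" "P i" by (rule cones[OF i(1)])
      interpret j: conrad_cone G D "C j" "P j" by (rule cones[OF j(1)])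
      have "x \<in> carrier G" using i by simp
      moreover have "i = j"
        using less_total[OF i(1) j(1)] i j i.disjoint j.disjoint i.C.m_inv_closed[of "inv x"]
          j.C.m_inv_closed[of x] \<open>x \<in> carrier G\<close> by auto
      ultimately show False using i.asym i j by blast
    qed
    show "x \<in> (\<Inter>i\<in>I. C i) \<or> x \<in> Q \<or> inv x \<in> Q" if x: "x \<in> D" for x
    proof (cases "x \<in> (\<Inter>i\<in>I. C i)")
      case False
      then obtain i where "i \<in> {i \<in> I. x \<notin> C i}" by blast
      then obtain m where m: "m \<in> I" "x \<notin> C m" and min: "\<And>j. less j m \<Longrightarrow> j \<in> I \<Longrightarrow> x \<in> C j"
        using wfE_min[OF wf] unfolding less_def by (metis (mono_tags, lifting) mem_Collect_eq)
      interpret m: conrad_cone G D "C m" "P m" by (rule cones[OF m(1)])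
      have "x \<in> P m \<or> inv x \<in> P m" using m.total[OF x] m by blast
      moreover have "inv x \<in> C j" if "less j m" "j \<in> I" for j
        using min[OF that] sub(1)[OF that(2)] subgroup.m_inv_closed by metis
      ultimately show ?thesis using QI[OF m(1)] min by blast
    qed blast
    show "x \<otimes> y \<in> Q" if "x \<in> Q" "y \<in> Q" for x y
    proof -
      obtain i where i: "i \<in> I" "x \<in> P i" "\<And>k. k \<in> I \<Longrightarrow> less k i \<Longrightarrow> x \<in> C k" using QE[OF \<open>x \<in> Q\<close>] by auto
      obtain j where j: "j \<in> I" "y \<in> P j" "\<And>k. k \<in> I \<Longrightarrow> less k j \<Longrightarrow> y \<in> C k" using QE[OF \<open>y \<in> Q\<close>] by auto
      interpret i: conrad_cone G D "C i" "P i" by (rule cones[OF i(1)])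
      interpret j: conrad_cone G D "C j" "P j" by (rule cones[OF j(1)])
      have C: "x \<otimes> y \<in> C k" if "k \<in> I" "less k i" "less k j" for k
        using subgroup.m_closed[OF sub(1)[OF that(1)]] i j that by blast
      consider "i = j" | "less i j" | "less j i" using less_total i j by blast
      then show ?thesis
      proof cases
        case 1
        then show ?thesis using QI[OF i(1) i.P_mult] i j C by blast
      next
        case 2
        then show ?thesis using QI[OF i(1) i.PC_mult[of y x]] i j C less_trans by blast
      next
        case 3
        then show ?thesis using QI[OF j(1) j.CP_mult[of x y]] i j C less_trans by blast
      qed
    qed
    fix a b assume "a \<in> Q" "b \<in> Q"
    obtain i where i: "i \<in> I" "a \<in> P i" "\<And>k. k \<in> I \<Longrightarrow> less k i \<Longrightarrow> a \<in> C k"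
      using QE[OF \<open>a \<in> Q\<close>] by auto
    obtain j where j: "j \<in> I" "b \<in> P j" "\<And>k. k \<in> I \<Longrightarrow> less k j \<Longrightarrow> b \<in> C k"
      using QE[OF \<open>b \<in> Q\<close>] by auto
    interpret i: conrad_cone G D "C i" "P i" by (rule cones[OF i(1)])
    interpret j: conrad_cone G D "C j" "P j" by (rule cones[OF j(1)])
    have C: "inv a \<otimes> (b \<otimes> a [^] n) \<in> C k" if "k \<in> I" "less k i" "less k j" for k and n :: nat
    proof -
      interpret k: conrad_cone G D "C k" "P k" by (rule cones[OF that(1)])
      have "a \<in> C k" "b \<in> C k" using i j that by auto
      then show ?thesis using subgroup_nat_pow[OF k.subgroup_C] by blast
    qed
    \<comment> \<open>The sign is decided at the smaller of the two indices. If they differ,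
      exponent 2 or 0 works as in a product of two cones, and at all smaller indices the word lies
      in the subgroup.\<close>
    consider "i = j" | "less i j" | "less j i" using less_total i j by blast
    then show "\<exists>n::nat. inv a \<otimes> (b \<otimes> a [^] n) \<in> Q"
    proof cases
      case 1
      then obtain n :: nat where "inv a \<otimes> (b \<otimes> a [^] n) \<in> P i" using i.conrad i j by blast
      then show ?thesis using QI[OF i(1)] C 1 by blast
    next
      case 2
      then have "i.lt (inv b \<otimes> a) (a \<otimes> a)" using i.C_mult_lt_square i j by blast
      moreover have "a \<otimes> a = a [^] (2::nat)" using i by (simp add: numeral_2_eq_2)
      ultimately have "inv a \<otimes> (b \<otimes> a [^] (2::nat)) \<in> P i"
        using i j by (simp add: i.lt_def m_assoc inv_mult_group)
      then show ?thesis using QI[OF i(1)] C 2 less_trans by blast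
    next
      case 3
      then have "inv a \<otimes> (b \<otimes> a [^] (0::nat)) \<in> P j" using j.CP_mult i j by simp
      then show ?thesis using QI[OF j(1)] C 3 less_trans by blast
    qed
  qed
qed

context conrad_cone
begin

lemma subquotient_cone:
  assumes "convex H" "convex K" "H \<subseteq> K" shows "left_cone G K H (P \<inter> K - H)"
proof -
  interpret K: left_cone G K "C \<inter> K" "P \<inter> K" using restrict assms(2) unfolding convex_def by blast
  have "H \<inter> K = H" using assms by blast
  then have "K.convex H" using convex_restrict[OF assms(1)] assms(2) unfolding convex_def by metis
  then show ?thesis by (rule K.quotient_cone)
qed

text \<open>A lexicographic product of three layers: above \<open>K\<close>, between
  \<open>H\<close> and \<open>K\<close>, and inside \<open>H\<close>. Any cone may be put in the
  middle, as it is Conradian by \<open>abelian_conrad\<close>, and the subgroup \<open>C\<close>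
  stays the same.\<close>

lemma replace_subquotient:
  assumes "convex H" "convex K" "abelian_over K H" "left_cone G K H Q"
  shows "conrad_cone G D C ((P - K) \<union> (Q \<union> (P \<inter> H)))"
proof -
  have "C \<inter> H = C" using assms by (auto simp: convex_def)
  then have "conrad_cone G H C (P \<inter> H)" using restrict_conrad[of H] assms(1) unfolding convex_def by metis
  then show ?thesis
    using lex_conrad[OF quotient_conrad[OF assms(2)] lex_conrad[OF abelian_conrad]] assms by blast
qed

end

text \<open>The last term is left open so that inductions can remove it.\<close>

definition (in group) rational_chain where
  "rational_chain Gs \<longleftrightarrow> Gs \<noteq> [] \<and> (\<forall>H\<in>set Gs. subgroup H G) \<and>
     successively (\<lambda>H K. rational_over K H) Gs"

definition (in group) no_jump where
  "no_jump Gs \<longleftrightarrow> (\<forall>i. i + 2 < length Gs \<longrightarrow> \<not> abelian_over (Gs ! (i + 2)) (Gs ! i))"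

text \<open>\<open>F\<close> is a finite certificate for \<open>P\<close> among the cones relative
  to the same \<open>C\<close>. Both isolation in the topology and finiteness of the set of
  preorders relative to \<open>C\<close> provide it.\<close>

locale isolated_cone = conrad_cone +
  fixes F
  assumes F_finite: "finite F" and F_subset: "F \<subseteq> P"
    and unique: "conrad_cone G D C P' \<Longrightarrow> F \<subseteq> P' \<Longrightarrow> P' = P"
begin

text \<open>Otherwise the order on this jump could be reversed.\<close>

lemma jump_meets_F:
  assumes h: "h \<in> P" shows "\<exists>f\<in>F. f \<in> cspan h \<and> f \<notin> below h"
proof (rule ccontr)
  assume no: "\<not> ?thesis"
  let ?K = "cspan h" and ?H = "below h"
  interpret J: arch_cone G ?K ?H "P \<inter> ?K - ?H" by (rule jump_arch[OF h])
  define Q where "Q = {x \<in> ?K. inv x \<in> P \<inter> ?K - ?H}"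
  have "left_cone G ?K ?H Q"
  proof (intro left_cone.intro left_cone_axioms.intro group_axioms)
    show "subgroup ?K G" "subgroup ?H G" "?H \<subseteq> ?K" by (fact J.subgroup_D J.subgroup_C J.C_subset)+
    show "Q \<subseteq> ?K" by (auto simp: Q_def)
    show "x \<notin> ?H" if "x \<in> Q" for x using that J.C.m_inv_closed by (auto simp: Q_def)
    show "inv x \<notin> Q" if "x \<in> Q" for x using that J.asym[of "inv x"] unfolding Q_def by blast
    show "x \<in> ?H \<or> x \<in> Q \<or> inv x \<in> Q" if "x \<in> ?K" for x
      using that J.total[OF that] by (auto simp: Q_def)
    show "x \<otimes> y \<in> Q" if "x \<in> Q" "y \<in> Q" for x y
    proof -
      have xy: "x \<in> ?K" "y \<in> ?K" using that unfolding Q_def by blast+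
      have "inv y \<otimes> inv x \<in> P \<inter> ?K - ?H" using J.P_mult that unfolding Q_def by blast
      then show ?thesis using xy J.D.m_closed[OF xy] by (simp add: Q_def inv_mult_group)
    qed
  qed
  then have *: "conrad_cone G D C ((P - ?K) \<union> (Q \<union> (P \<inter> ?H)))"
    using replace_subquotient below_convex cspan_convex J.abelian h by blast
  have "F \<subseteq> (P - ?K) \<union> (Q \<union> (P \<inter> ?H))" using no F_subset by blast
  then have "(P - ?K) \<union> (Q \<union> (P \<inter> ?H)) = P" by (rule unique[OF *])
  then have "h \<in> Q" using h cspan_self notin_below by blast
  then show False using asym h by (auto simp: Q_def)
qed

text \<open>Replacing the order between \<open>H\<close> and \<open>K\<close> by any cone that
  contains \<open>F \<inter> (K - H)\<close> keeps \<open>F\<close> positive. Hence the cone on the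
  abelian quotient is itself determined by finitely many elements, which forces rank one.\<close>

lemma abelian_rational:
  assumes H: "convex H" and K: "convex K" and HK: "H \<subset> K" and ab: "abelian_over K H"
  shows "rational_over K H"
proof (rule isolated_rational_over[OF ab])
  show "left_cone G K H (P \<inter> K - H)" using subquotient_cone H K HK by blast
  show "finite (F \<inter> (K - H))" "F \<inter> (K - H) \<subseteq> P \<inter> K - H" using F_finite F_subset by auto
  show "H \<noteq> K" using HK by blast
  fix Q assume Q: "left_cone G K H Q" "F \<inter> (K - H) \<subseteq> Q"
  interpret Q: left_cone G K H Q by (rule Q(1))
  have "F \<subseteq> (P - K) \<union> (Q \<union> (P \<inter> H))" using Q(2) F_subset by blast
  then have "(P - K) \<union> (Q \<union> (P \<inter> H)) = P" by (rule unique[OF replace_subquotient[OF H K ab Q(1)]])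
  then show "Q = P \<inter> K - H" using Q.disjoint Q.P_subset HK by blast
qed

text \<open>A convex subgroup is recovered from its trace on \<open>F\<close>: for positive
  \<open>h\<close> in \<open>K - H\<close>, the jump at \<open>h\<close> contains an element of
  \<open>F\<close> that lies in \<open>K\<close> but not in \<open>H\<close>.\<close>

lemma finite_convex: "finite {H. convex H}"
proof (rule inj_on_finite)
  show "(\<lambda>H. H \<inter> F) ` {H. convex H} \<subseteq> Pow F" "finite (Pow F)" using F_finite by auto
  have "\<not> K \<inter> F \<subseteq> H \<inter> F" if K: "convex K" and H: "convex H" and KH: "\<not> K \<subseteq> H" for H K
  proof -
    obtain h where h: "h \<in> P" "h \<in> K" "h \<notin> H" using convex_pos[OF K H KH] by blast
    then obtain f where f: "f \<in> F" "f \<in> cspan h" "f \<notin> below h" using jump_meets_F by blast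
    then show ?thesis using cspan_minimal[OF K h(1,2)] below_maximal[OF H h(3)] by blast
  qed
  then show "inj_on (\<lambda>H. H \<inter> F) {H. convex H}" unfolding inj_on_def by blast
qed

text \<open>By finiteness there is a maximal convex \<open>H\<close> properly inside
  \<open>K\<close>. The jump at any positive \<open>h\<close> in \<open>K - H\<close> must then be
  the pair \<open>H\<close>, \<open>K\<close>, so it is Archimedean and thus abelian.\<close>

lemma convex_predecessor:
  assumes K: "convex K" "K \<noteq> C"
  shows "\<exists>H. convex H \<and> rational_over K H"
proof -
  let ?A = "{H. convex H \<and> H \<subset> K}"
  have "finite ?A" using finite_convex by (rule rev_finite_subset) blast
  moreover have "C \<in> ?A" using convex_C K by (auto simp: convex_def)
  then have "?A \<noteq> {}" by blast
  ultimately have "\<exists>H\<in>?A. \<forall>X\<in>?A. H \<subseteq> X \<longrightarrow> H = X" by (rule finite_has_maximal)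
  then obtain H where H: "convex H" "H \<subset> K" and max: "\<And>X. convex X \<Longrightarrow> X \<subset> K \<Longrightarrow> H \<subseteq> X \<Longrightarrow> H = X"
    by auto
  obtain h where h: "h \<in> P" "h \<in> K" "h \<notin> H" using convex_pos[OF K(1) H(1)] H(2) by blast
  interpret J: arch_cone G "cspan h" "below h" "P \<inter> cspan h - below h" by (rule jump_arch[OF h(1)])
  have cv: "convex (cspan h)" "convex (below h)" using cspan_convex below_convex h by auto
  have "\<not> cspan h \<subseteq> H" using cspan_self h by blast
  then have "H \<subseteq> cspan h" using convex_chain[OF H(1) cv(1)] by blast
  then have "cspan h = K" using max[OF cv(1)] cspan_minimal[OF K(1) h(1,2)] cspan_self h by blast
  moreover have "below h \<subset> K" using convex_chain[OF cv(2) K(1)] h notin_below by blast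
  then have "below h = H" using max[OF cv(2)] below_maximal[OF H(1) h(3)] by blast
  ultimately have "abelian_over K H" using J.abelian by simp
  then show ?thesis using abelian_rational[OF H(1) K(1) H(2)] H by blast
qed

lemma convex_chain_exists:
  assumes "convex K"
  shows "\<exists>Gs. rational_chain Gs \<and> (\<forall>H\<in>set Gs. convex H) \<and> hd Gs = C \<and> last Gs = K"
  using assms
proof (induction "card {H. convex H \<and> H \<subset> K}" arbitrary: K rule: less_induct)
  case less
  show ?case
  proof (cases "K = C")
    case True
    then have "rational_chain [C]" using subgroup_C by (simp add: rational_chain_def)
    then show ?thesis using True convex_C by (intro exI[of _ "[C]"]) simp
  next
    case False
    then obtain H where H: "convex H" "rational_over K H" using convex_predecessor less.prems by blast
    have HK: "H \<subset> K" by (rule rational_over_proper[OF H(2)])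
    have "finite {X. convex X \<and> X \<subset> K}" using finite_convex by (rule rev_finite_subset) blast
    then have "card {X. convex X \<and> X \<subset> H} < card {X. convex X \<and> X \<subset> K}"
      by (rule psubset_card_mono) (use HK H in blast)
    then obtain Gs where Gs: "rational_chain Gs" "\<forall>H\<in>set Gs. convex H" "hd Gs = C" "last Gs = H"
      using less.hyps H(1) by blast
    have "rational_chain (Gs @ [K])"
      using Gs H(2) less.prems by (auto simp: rational_chain_def successively_append_iff convex_def)
    moreover have "hd (Gs @ [K]) = C" using Gs by (auto simp: rational_chain_def)
    ultimately show ?thesis using Gs less.prems by (intro exI[of _ "Gs @ [K]"]) auto
  qed
qed

text \<open>All terms of the chain are convex. An abelian jump would therefore have rank one by
  \<open>abelian_rational\<close>, and its middle term, being isolated, would coincide with the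
  lower one.\<close>

theorem rational_chain_exists:
  "\<exists>Gs. rational_chain Gs \<and> hd Gs = C \<and> last Gs = D \<and> no_jump Gs"
proof -
  obtain Gs where Gs: "rational_chain Gs" "\<forall>H\<in>set Gs. convex H" "hd Gs = C" "last Gs = D"
    using convex_chain_exists[OF convex_D] by blast
  have "no_jump Gs" unfolding no_jump_def
  proof (intro allI impI notI)
    fix i assume i: "i + 2 < length Gs" and ab: "abelian_over (Gs ! (i + 2)) (Gs ! i)"
    have "rational_over (Gs ! Suc i) (Gs ! i)" "rational_over (Gs ! Suc (Suc i)) (Gs ! Suc i)"
      using Gs(1) i successively_nth[of _ Gs i] successively_nth[of _ Gs "Suc i"] by (auto simp: rational_chain_def)
    then have lt: "Gs ! i \<subset> Gs ! Suc i" "Gs ! Suc i \<subset> Gs ! (i + 2)"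
      using rational_over_proper by auto
    have cv: "convex (Gs ! i)" "convex (Gs ! Suc i)" "convex (Gs ! (i + 2))" using Gs(2) i by auto
    have "rational_over (Gs ! (i + 2)) (Gs ! i)" using abelian_rational[OF cv(1,3) _ ab] lt by blast
    then have "Gs ! Suc i = Gs ! i"
      by (rule rational_over_intermediate) (use cv lt convex_isolated[OF cv(2)] in \<open>auto simp: convex_def\<close>)
    then show False using lt by blast
  qed
  then show ?thesis using Gs by blast
qed

end

section \<open>Counting sets of cones, and convexity of the next-to-last term\<close>

context group
begin

text \<open>The locale admits the empty cone, with \<open>C = D\<close>. It belongs to the trivial
  relation, which is not a left-preorder, and is excluded here.\<close>

definition cones where
  "cones D C = {P. P \<noteq> {} \<and> conrad_cone G D C P}"

text \<open>Counting the sets \<open>P\<close> alone is faithful, since \<open>D\<close> and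
  \<open>P\<close> determine \<open>C\<close> by \<open>cone_subgroup_unique\<close>.\<close>

definition all_cones where
  "all_cones D = {P. P \<noteq> {} \<and> (\<exists>C. conrad_cone G D C P)}"

lemma rational_chain_snoc:
  "Ms \<noteq> [] \<Longrightarrow> rational_chain (Ms @ [D]) \<longleftrightarrow> rational_chain Ms \<and> subgroup D G \<and> rational_over D (last Ms)"
  by (auto simp: rational_chain_def successively_append_iff)

lemma no_jump_butlast: "no_jump (Ms @ [D]) \<Longrightarrow> no_jump Ms"
  by (auto simp: no_jump_def nth_append split: if_splits)

text \<open>If \<open>N\<close> was not convex, then the jump at a positive \<open>y \<in> N - M\<close>, where \<open>M\<close> precedes \<open>N\<close>,
  would be an abelian quotient of \<open>D\<close> whose kernel meets \<open>N\<close> in a subgroup of \<open>M\<close>; as \<open>D / N\<close> is also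
  abelian, this makes \<open>D / M\<close> abelian.\<close>

lemma convex_last:
  assumes "rational_chain (Ms @ [D])" "no_jump (Ms @ [D])"
    and "all_cones (hd (Ms @ [D])) = {}"
    and "conrad_cone G D C P" "P \<noteq> {}"
  shows "Ms \<noteq> [] \<and> left_cone.convex G D C P (last Ms)"
  using assms
proof (induction Ms arbitrary: D C P rule: rev_induct)
  case Nil
  then show ?case by (auto simp: all_cones_def)
next
  case (snoc N Ms)
  interpret R: conrad_cone G D C P by fact
  have chain: "rational_chain (Ms @ [N])" "rational_over D N"
    using snoc.prems(1) rational_chain_snoc[of "Ms @ [N]" D] by auto
  have N: "subgroup N G" "N \<subset> D" using chain rational_over_proper by (auto simp: rational_chain_def)
  interpret RN: conrad_cone G N "C \<inter> N" "P \<inter> N" using R.restrict_conrad N by blast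
  have "R.convex N"
  proof (cases "P \<inter> N = {}")
    case True
    \<comment> \<open>The cone vanishes on \<open>N\<close>, and \<open>C\<close> is isolated and
      proper in \<open>D\<close>; rank one of \<open>D\<close> over \<open>N\<close> leaves only
      \<open>C = N\<close>.\<close>
    then have "N \<subseteq> C" using RN.total by blast
    moreover have "C \<subset> D" using R.C_subset R.P_subset R.disjoint snoc.prems(5) by blast
    ultimately have "C = N"
      using rational_over_intermediate[OF chain(2) R.subgroup_D R.subgroup_C] R.isolated by blast
    then show ?thesis using R.convex_C by simp
  next
    case False
    have "hd ((Ms @ [N]) @ [D]) = hd (Ms @ [N])" by (cases Ms) auto
    then have IH: "Ms \<noteq> []" "RN.convex (last Ms)"
      using snoc.IH[of N "C \<inter> N" "P \<inter> N"] chain no_jump_butlast[OF snoc.prems(2)] snoc.prems(3)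
        RN.conrad_cone_axioms False by auto
    define M where "M = last Ms"
    have M: "RN.convex M" "rational_over N M" "M \<subset> N"
      using IH chain rational_chain_snoc rational_over_proper by (auto simp: M_def)
    obtain y where y: "y \<in> P" "y \<in> N" "y \<notin> M" using RN.convex_pos[OF RN.convex_D M(1)] M(3) by blast
    define K where "K = R.cspan y"
    define H where "H = R.below y"
    interpret J: arch_cone G K H "P \<inter> K - H" unfolding K_def H_def by (rule R.jump_arch[OF y(1)])
    have K: "R.convex K" "y \<in> K" and H: "R.convex H" "y \<notin> H"
      using R.cspan_convex[OF y(1)] R.below_convex[OF y(1)] R.cspan_self[OF y(1)] R.notin_below[of y]
      by (simp_all only: K_def H_def not_False_eq_True)
    \<comment> \<open>Rank one of \<open>N\<close> over \<open>M\<close>: above \<open>M\<close>,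
      the cone restricted to \<open>N\<close> has no convex subgroups other than \<open>M\<close>
      and \<open>N\<close>. This pins down the traces of \<open>K\<close> and \<open>H\<close> on
      \<open>N\<close>.\<close>
    have eq: "X = M" if X: "RN.convex X" "M \<subseteq> X" "X \<noteq> N" for X
    proof (rule rational_over_intermediate[OF M(2) N(1)])
      show "subgroup X G" "X \<subset> N" using X(1,3) unfolding RN.convex_def by blast+
      show "x \<in> X" if "x \<in> N" "x [^] n \<in> X" "n > 0" for x and n :: nat
        using RN.convex_isolated[OF X(1)] that by blast
    qed (rule X(2))
    have KN: "RN.convex (K \<inter> N)" and HN: "RN.convex (H \<inter> N)"
      using R.convex_restrict K(1) H(1) N by blast+
    have "M \<subseteq> K \<inter> N" using RN.convex_chain[OF KN M(1)] K y by blast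
    then have NK: "N \<subseteq> K" using eq[OF KN] K y by blast
    have HM: "H \<inter> N \<subseteq> M" using RN.convex_chain[OF HN M(1)] eq[OF HN] H y by blast
    show ?thesis
    proof (cases "K = D")
      case True
      have "abelian_over D M"
        using J.abelian chain(2) True HM unfolding abelian_over_def rational_over_def by blast
      moreover obtain Ms' where "Ms = Ms' @ [M]" using IH(1) by (metis M_def append_butlast_last_id)
      then have "((Ms @ [N]) @ [D]) ! (length Ms' + 2) = D" "((Ms @ [N]) @ [D]) ! length Ms' = M"
        "length Ms' + 2 < length ((Ms @ [N]) @ [D])"
        by (auto simp: nth_append)
      ultimately have False using snoc.prems(2) unfolding no_jump_def by metis
      then show ?thesis ..
    next
      case False
      have "K = N"
      proof (rule rational_over_intermediate[OF chain(2) R.subgroup_D])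
        show "subgroup K G" "K \<subset> D" using K(1) False unfolding R.convex_def by blast+
        show "x \<in> K" if "x \<in> D" "x [^] n \<in> K" "n > 0" for x and n :: nat
          using R.convex_isolated[OF K(1)] that by blast
      qed (rule NK)
      then show ?thesis using K(1) by (simp only:)
    qed
  qed
  then show ?case by simp
qed

end

section \<open>Chains without abelian jumps\<close>

context group
begin

lemma rational_chain_hd_subset_last: "rational_chain Gs \<Longrightarrow> hd Gs \<subseteq> last Gs"
proof (induction Gs rule: rev_induct)
  case (snoc D Ms)
  then show ?case
    using rational_chain_snoc[of Ms D] rational_over_proper[of D "last Ms"] by (cases "Ms = []") auto
qed (simp add: rational_chain_def)

lemma rational_chain_append_hd:
  assumes "rational_chain (Xs @ Ks)" "Xs \<noteq> []" "Ks \<noteq> []" shows "hd Xs \<subset> hd Ks"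
proof -
  have "rational_chain Xs" "rational_over (hd Ks) (last Xs)"
    using assms by (auto simp: rational_chain_def successively_append_iff)
  then show ?thesis using rational_chain_hd_subset_last rational_over_proper by blast
qed

text \<open>Every step of the chain carries a cone, and these are combined lexicographically. In
  particular the first term of a rational series occurs as the subgroup of a cone.\<close>

lemma rational_chain_cone:
  "rational_chain Gs \<Longrightarrow> \<exists>P. conrad_cone G (last Gs) (hd Gs) P"
proof (induction Gs rule: rev_induct)
  case (snoc D Ms)
  have D: "subgroup D G" using snoc.prems by (simp add: rational_chain_def)
  show ?case
  proof (cases "Ms = []")
    case True
    \<comment> \<open>The chain with a single term needs the empty cone.\<close>
    have "conrad_cone G D D {}"
      by (intro conrad_cone.intro left_cone.intro left_cone_axioms.intro conrad_cone_axioms.intro group_axioms D) auto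
    then show ?thesis using True by auto
  next
    case False
    then have Ms: "rational_chain Ms" "rational_over D (last Ms)" using snoc.prems rational_chain_snoc by auto
    obtain P where P: "conrad_cone G (last Ms) (hd Ms) P" using snoc.IH[OF Ms(1)] by blast
    obtain t where t: "t \<in> D" "t \<notin> last Ms" using rational_over_proper[OF Ms(2)] by blast
    have "subgroup (last Ms) G" using Ms(1) by (simp add: rational_chain_def)
    then obtain Q where "conrad_cone G D (last Ms) Q" using rational_conrad_exists[OF D _ Ms(2) t] by blast
    then have "conrad_cone G D (hd Ms) (Q \<union> P)" using lex_conrad P by blast
    then show ?thesis using False by auto
  qed
qed (simp add: rational_chain_def)

lemma cone_nonempty: "conrad_cone G D C P \<Longrightarrow> C \<noteq> D \<Longrightarrow> P \<noteq> {}"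
proof
  assume "conrad_cone G D C P" "C \<noteq> D" "P = {}"
  then interpret R: conrad_cone G D C "{}" by simp
  show False using R.total R.C_subset \<open>C \<noteq> D\<close> by blast
qed

lemma nonempty_cone_proper: "conrad_cone G D C P \<Longrightarrow> P \<noteq> {} \<Longrightarrow> C \<subset> D"
proof -
  assume "conrad_cone G D C P" "P \<noteq> {}"
  then interpret R: conrad_cone G D C P by simp
  show ?thesis using R.C_subset R.P_subset R.disjoint \<open>P \<noteq> {}\<close> by blast
qed

text \<open>Going down the chain, the restriction of \<open>P\<close> becomes empty at some term, at
  the latest at the first one, which has no nonempty cones. A term on which it is empty is contained
  in \<open>C\<close>.\<close>

lemma hd_subset_C:
  assumes "rational_chain (Ms @ [D])"
    and "all_cones (hd (Ms @ [D])) = {}"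
    and "conrad_cone G D C P" "P \<noteq> {}"
  shows "hd (Ms @ [D]) \<subseteq> C"
  using assms
proof (induction Ms arbitrary: D C P rule: rev_induct)
  case Nil
  then show ?case by (auto simp: all_cones_def)
next
  case (snoc N Ms)
  interpret R: conrad_cone G D C P by fact
  have chain: "rational_chain (Ms @ [N])" "rational_over D N"
    using snoc.prems(1) rational_chain_snoc[of "Ms @ [N]" D] by auto
  have N: "subgroup N G" "N \<subset> D" using chain rational_over_proper by (auto simp: rational_chain_def)
  interpret RN: conrad_cone G N "C \<inter> N" "P \<inter> N" using R.restrict_conrad N by blast
  have hd: "hd ((Ms @ [N]) @ [D]) = hd (Ms @ [N])" by (cases Ms) auto
  show ?case
  proof (cases "P \<inter> N = {}")
    case True
    then have "N \<subseteq> C" using RN.total by blast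
    then show ?thesis using rational_chain_hd_subset_last[OF chain(1)] hd by auto
  next
    case False
    have "hd (Ms @ [N]) \<subseteq> C \<inter> N"
      by (rule snoc.IH[OF chain(1) _ RN.conrad_cone_axioms False]) (use snoc.prems(2) hd in auto)
    then show ?thesis using hd by auto
  qed
qed

text \<open>The next-to-last term \<open>N'\<close> of \<open>Ks\<close> is the subgroup of some
  cone on \<open>D\<close>. By \<open>convex_last\<close> the next-to-last term of \<open>Gs\<close>
  is convex for that cone, so it contains \<open>N'\<close>, and rank one makes the two equal. Hence
  the two chains agree downwards as far as \<open>Ks\<close> reaches.\<close>

lemma rational_chain_suffix:
  assumes "rational_chain Gs" "no_jump Gs" "all_cones (hd Gs) = {}"
    and "rational_chain Ks" "last Ks = last Gs"
  shows "\<exists>Xs. Gs = Xs @ Ks"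
  using assms
proof (induction Gs arbitrary: Ks rule: rev_induct)
  case (snoc D Ms)
  have D: "subgroup D G" using snoc.prems(1) by (simp add: rational_chain_def)
  obtain Ks' where Ks: "Ks = Ks' @ [D]"
    using snoc.prems(4,5) by (metis append_butlast_last_id last_snoc rational_chain_def)
  show ?case
  proof (cases "Ks' = []")
    case False
    define N' where "N' = last Ks'"
    have Ks': "rational_chain Ks'" "rational_over D N'"
      using snoc.prems(4) rational_chain_snoc False unfolding Ks N'_def by auto
    have N': "subgroup N' G" using Ks'(1) False by (simp add: rational_chain_def N'_def)
    obtain t where t: "t \<in> D" "t \<notin> N'" using rational_over_proper[OF Ks'(2)] by blast
    obtain Q where Q: "conrad_cone G D N' Q" "t \<in> Q" using rational_conrad_exists[OF D N' Ks'(2) t] by blast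
    interpret Q: conrad_cone G D N' Q by (rule Q(1))
    have Ms: "Ms \<noteq> []" "Q.convex (last Ms)"
      using convex_last[OF snoc.prems(1,2,3) Q(1)] Q(2) by auto
    have rMs: "rational_chain Ms" "rational_over D (last Ms)" using snoc.prems(1) rational_chain_snoc Ms(1) by auto
    have "last Ms = N'"
    proof (rule rational_over_intermediate[OF Ks'(2) D])
      show "subgroup (last Ms) G" "N' \<subseteq> last Ms" using Ms(2) by (simp_all add: Q.convex_def)
      show "last Ms \<subset> D" by (rule rational_over_proper[OF rMs(2)])
      show "x \<in> last Ms" if "x \<in> D" "x [^] n \<in> last Ms" "n > 0" for x and n :: nat
        using Q.convex_isolated[OF Ms(2)] that by blast
    qed
    then obtain Xs where "Ms = Xs @ Ks'"
      using snoc.IH[of Ks'] rMs no_jump_butlast[OF snoc.prems(2)] snoc.prems(3) Ms(1) Ks' N'_def by auto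
    then show ?thesis using Ks by simp
  qed (use Ks in simp)
qed (simp add: rational_chain_def)

text \<open>A relation \<open>x [^] n \<otimes> s [^] m \<in> N\<close> with \<open>n > 0\<close>
  ties the sign of \<open>x\<close> to that of \<open>s\<close>. Thus a cone is determined by the
  sign of \<open>s\<close>, and this sign in turn by the sign of \<open>t\<close>.\<close>

lemma rational_cone_eqI:
  assumes r: "rational_over D N" and Q: "conrad_cone G D N Q" "conrad_cone G D N Q'"
    and s: "t \<in> Q" "t \<in> Q'"
  shows "Q' = Q"
proof -
  interpret Q: conrad_cone G D N Q by (rule Q(1))
  interpret Q': conrad_cone G D N Q' by (rule Q(2))
  obtain s where s0: "s \<in> D" "s \<notin> N" and rel: "\<And>y. y \<in> D \<Longrightarrow> \<exists>n>0. \<exists>m::int. y [^] (n::nat) \<otimes> s [^] m \<in> N"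
    using r by (auto simp: rational_over_def)
  have main: "X = Y"
    if X: "conrad_cone G D N X" "u \<in> X" and Y: "conrad_cone G D N Y" "u \<in> Y" and u: "u = s \<or> u = inv s"
    for X Y u
  proof -
    interpret X: conrad_cone G D N X by (rule X(1))
    interpret Y: conrad_cone G D N Y by (rule Y(1))
    have uD: "u \<in> D" using X by simp
    have rel_u: "\<exists>n>0. \<exists>m::int. y [^] (n::nat) \<otimes> u [^] m \<in> N" if y: "y \<in> D" for y
    proof -
      obtain n m where n: "n > 0" "y [^] (n::nat) \<otimes> s [^] (m::int) \<in> N" using rel[OF y] by blast
      have "s [^] m = u [^] m \<or> s [^] m = u [^] (- m)" using u s0 by (auto simp: int_pow_inv int_pow_neg)
      then show ?thesis using n by metis
    qed
    have "Y \<subseteq> X"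
    proof
      fix x assume x: "x \<in> Y"
      then have xD: "x \<in> D" by simp
      obtain n m where n: "n > 0" "x [^] (n::nat) \<otimes> u [^] (m::int) \<in> N" using rel_u[OF xD] by blast
      \<comment> \<open>With \<open>x\<close> and \<open>u\<close> both positive in
        \<open>Y\<close>, a nonnegative exponent would make the related product positive, although
        it lies in \<open>N\<close>.\<close>
      have "m < 0"
      proof (rule ccontr)
        assume "\<not> m < 0"
        then have "u [^] m = u [^] nat m" using int_pow_int[of G u "nat m"] by simp
        then have "u [^] m \<in> Y \<union> N" using Y.pow_PC[OF Y(2), of "nat m"] by simp
        moreover have "x [^] n \<in> Y" using Y.P_pow' x n by blast
        ultimately have "x [^] n \<otimes> u [^] m \<in> Y" using Y.P_mult Y.PC_mult by blast
        then show False using n Y.disjoint by blast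
      qed
      then have um: "u [^] m = inv (u [^] nat (- m))" "nat (- m) > 0"
        using uD int_pow_neg[of u "- m"] int_pow_int[of G u "nat (- m)"] by simp_all
      have uX: "u [^] nat (- m) \<in> X" using X.P_pow'[OF X(2)] um(2) by blast
      show "x \<in> X"
      proof (rule ccontr)
        assume "x \<notin> X"
        then have "inv x \<in> X" using X.total[OF xD] Y.disjoint x by blast
        then have "inv x [^] n \<in> X" using X.P_pow' n by blast
        then have "u [^] nat (- m) \<otimes> inv x [^] n \<in> X" using X.P_mult uX by blast
        moreover have "u [^] nat (- m) \<otimes> inv x [^] n = inv (x [^] n \<otimes> u [^] m)"
          using xD uD by (simp add: um inv_mult_group nat_pow_inv)
        ultimately show False using n Q.C.m_inv_closed X.disjoint by metis
      qed
    qed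
    then show ?thesis by (rule Y.cone_eqI[OF X.left_cone_axioms])
  qed
  have sgn: "s \<in> Q \<and> s \<in> Q' \<or> inv s \<in> Q \<and> inv s \<in> Q' \<or> s \<in> Q \<and> inv s \<in> Q' \<or> inv s \<in> Q \<and> s \<in> Q'"
    using Q.total[OF s0(1)] Q'.total[OF s0(1)] s0(2) by blast
  \<comment> \<open>If \<open>s\<close> had opposite signs in the two cones, the relation between
    \<open>t\<close> and \<open>s\<close> would fail in one of them, depending on the sign of its
    exponent \<open>m\<close>.\<close>
  have opp: False if A: "conrad_cone G D N A" "t \<in> A" and B: "conrad_cone G D N B" "t \<in> B"
      and sA: "s \<in> A" and sB: "inv s \<in> B" for A B
  proof -
    interpret A: conrad_cone G D N A by (rule A(1))
    interpret B: conrad_cone G D N B by (rule B(1))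
    have tD: "t \<in> D" using A by simp
    obtain n m where n: "n > 0" "t [^] (n::nat) \<otimes> s [^] (m::int) \<in> N" using rel[OF tD] by blast
    have tA: "t [^] n \<in> A" and tB: "t [^] n \<in> B" using A.P_pow' A(2) B.P_pow' B(2) n by blast+
    show False
    proof (cases "m \<ge> 0")
      case True
      then have "s [^] m = s [^] nat m" using int_pow_int[of G s "nat m"] by simp
      then have "s [^] m \<in> A \<union> N" using A.pow_PC[OF sA, of "nat m"] by simp
      then have "t [^] n \<otimes> s [^] m \<in> A" using A.P_mult A.PC_mult tA by blast
      then show False using n A.disjoint by blast
    next
      case False
      then have "s [^] m = inv (s [^] nat (- m))"
        using s0 int_pow_neg[of s "- m"] int_pow_int[of G s "nat (- m)"] by simp
      also have "\<dots> = inv s [^] nat (- m)" using s0 by (simp only: nat_pow_inv Q.in_carrier)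
      finally have "s [^] m = inv s [^] nat (- m)" .
      then have "s [^] m \<in> B \<union> N" using B.pow_PC[OF sB, of "nat (- m)"] by simp
      then have "t [^] n \<otimes> s [^] m \<in> B" using B.P_mult B.PC_mult tB by blast
      then show False using n B.disjoint by blast
    qed
  qed
  show ?thesis using sgn main[OF Q(2) _ Q(1)] opp[OF Q(1) s(1) Q(2) s(2)] opp[OF Q(2) s(2) Q(1) s(1)] by blast
qed

lemma card_cones_rational:
  assumes D: "subgroup D G" "subgroup N G" and r: "rational_over D N"
  shows "card (cones D N) = 2"
proof -
  obtain t where t: "t \<in> D" "t \<notin> N" using rational_over_proper[OF r] by blast
  obtain Q where Q: "conrad_cone G D N Q" "t \<in> Q" using rational_conrad_exists[OF D r t] by blast
  interpret D: subgroup D G by (rule D(1))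
  interpret N: subgroup N G by (rule D(2))
  have it: "inv t \<in> D" "inv t \<notin> N" using t N.m_inv_closed[of "inv t"] by auto
  obtain Q' where Q': "conrad_cone G D N Q'" "inv t \<in> Q'" using rational_conrad_exists[OF D r it] by blast
  interpret Q: conrad_cone G D N Q by (rule Q(1))
  have "X = Q \<or> X = Q'" if "conrad_cone G D N X" for X
  proof -
    interpret X: conrad_cone G D N X by (rule that)
    show ?thesis
      using X.total[OF t(1)] t rational_cone_eqI[OF r Q(1) that Q(2)] rational_cone_eqI[OF r Q'(1) that Q'(2)] by blast
  qed
  then have "cones D N = {Q, Q'}" using Q Q' by (auto simp: cones_def)
  moreover have "Q \<noteq> Q'" using Q.asym Q(2) Q'(2) by blast
  ultimately show ?thesis by simp
qed

text \<open>Adding 2 turns the recursion into doubling and avoids subtraction; a chain with one term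
  gives \<open>0 + 2 = 2 ^ 1\<close>. The second count requires two terms, because relative to
  \<open>D\<close> itself there are 0 nonempty cones on \<open>D\<close>, not
  \<open>2 ^ 0\<close>.\<close>

lemma card_all_cones:
  assumes "rational_chain Gs" "no_jump Gs" "all_cones (hd Gs) = {}"
  shows "finite (all_cones (last Gs)) \<and> card (all_cones (last Gs)) + 2 = 2 ^ length Gs \<and>
    (length Gs \<ge> 2 \<longrightarrow> card (cones (last Gs) (hd Gs)) = 2 ^ (length Gs - 1))"
  using assms
proof (induction Gs rule: rev_induct)
  case (snoc D Ms)
  show ?case
  proof (cases "Ms = []")
    case True
    then have "all_cones D = {}" using snoc.prems(3) by simp
    then show ?thesis using True by simp
  next
    case False
    define N where "N = last Ms"
    have Ms: "rational_chain Ms" and r: "rational_over D N" and D: "subgroup D G"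
      using snoc.prems(1) rational_chain_snoc[OF False] by (auto simp: N_def)
    have N: "subgroup N G" using Ms by (simp add: rational_chain_def N_def)
    have hd: "hd (Ms @ [D]) = hd Ms" using False by simp
    have ND: "N \<subset> D" by (rule rational_over_proper[OF r])
    have IH: "finite (all_cones N)" "card (all_cones N) + 2 = 2 ^ length Ms"
      "length Ms \<ge> 2 \<Longrightarrow> card (cones N (hd Ms)) = 2 ^ (length Ms - 1)"
      using snoc.IH[OF Ms no_jump_butlast[OF snoc.prems(2)]] snoc.prems(3) hd by (auto simp: N_def)
    let ?f = "\<lambda>(Q, P). Q \<union> P"
    have cv: "left_cone.convex G D C P N" if "conrad_cone G D C P" "P \<noteq> {}" for C P
      using convex_last[OF snoc.prems that] by (simp add: N_def)
    have upper: "P - N \<in> cones D N" if P: "conrad_cone G D C P" "P \<noteq> {}" for C P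
    proof -
      interpret P: conrad_cone G D C P by (rule P(1))
      have "conrad_cone G D N (P - N)" by (rule P.quotient_conrad[OF cv[OF P]])
      then show ?thesis using cone_nonempty[of D N "P - N"] ND unfolding cones_def by blast
    qed
    have lower: "C \<subseteq> N \<and> conrad_cone G N C (P \<inter> N)" if P: "conrad_cone G D C P" "P \<noteq> {}" for C P
    proof -
      interpret P: conrad_cone G D C P by (rule P(1))
      have "C \<subseteq> N" using cv[OF P] by (simp add: P.convex_def)
      then show ?thesis using P.restrict_conrad[OF N] ND by (metis inf.absorb1 psubset_imp_subset)
    qed
    have inj: "inj_on ?f (cones D N \<times> all_cones N)"
    proof (rule inj_on_inverseI)
      fix QP assume "QP \<in> cones D N \<times> all_cones N"
      then obtain Q P C where QP: "QP = (Q, P)" "conrad_cone G D N Q" "conrad_cone G N C P"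
        by (auto simp: cones_def all_cones_def)
      interpret Q: conrad_cone G D N Q by (rule QP(2))
      interpret P: conrad_cone G N C P by (rule QP(3))
      show "(\<lambda>X. (X - N, X \<inter> N)) (?f QP) = QP"
        using Q.disjoint P.P_subset QP(1) by auto
    qed
    have split: "all_cones D = cones D N \<union> ?f ` (cones D N \<times> all_cones N)"
    proof (intro equalityI subsetI)
      fix P assume "P \<in> all_cones D"
      then obtain C where P: "conrad_cone G D C P" "P \<noteq> {}" by (auto simp: all_cones_def)
      have eq: "P = ?f (P - N, P \<inter> N)" by auto
      show "P \<in> cones D N \<union> ?f ` (cones D N \<times> all_cones N)"
      proof (cases "P \<inter> N = {}")
        case True
        then have "P - N = P" by blast
        then show ?thesis using upper[OF P] by simp
      next
        case False
        then have "P \<inter> N \<in> all_cones N" using lower[OF P] by (auto simp: all_cones_def)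
        then show ?thesis using upper[OF P] eq by blast
      qed
    next
      fix X assume "X \<in> cones D N \<union> ?f ` (cones D N \<times> all_cones N)"
      then show "X \<in> all_cones D"
      proof
        assume "X \<in> ?f ` (cones D N \<times> all_cones N)"
        then obtain Q P C where X: "X = Q \<union> P" "Q \<noteq> {}" "conrad_cone G D N Q" "conrad_cone G N C P"
          by (auto simp: cones_def all_cones_def)
        then show ?thesis using lex_conrad[OF X(3,4)] by (auto simp: all_cones_def)
      qed (auto simp: cones_def all_cones_def)
    qed
    have disj: "cones D N \<inter> ?f ` (cones D N \<times> all_cones N) = {}"
    proof -
      have False if X: "Q \<union> P \<in> cones D N" "P \<in> all_cones N" for Q P
      proof -
        obtain C where "conrad_cone G N C P" "P \<noteq> {}" using X(2) by (auto simp: all_cones_def)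
        moreover have "conrad_cone G D N (Q \<union> P)" using X(1) by (simp add: cones_def)
        ultimately have "P \<subseteq> N" "\<And>x. x \<in> P \<Longrightarrow> x \<notin> N"
          using left_cone.P_subset left_cone.disjoint conrad_cone.axioms(1) by (metis, metis UnI2)
        then show False using \<open>P \<noteq> {}\<close> by blast
      qed
      then show ?thesis by auto
    qed
    have card2: "card (cones D N) = 2" by (rule card_cones_rational[OF D N r])
    then have fin: "finite (cones D N)" using card.infinite by fastforce
    have "card (all_cones D) = 2 + 2 * card (all_cones N)"
      unfolding split using disj fin IH(1) card2
      by (subst card_Un_disjoint) (auto simp: card_image[OF inj] card_cartesian_product)
    then have 1: "card (all_cones D) + 2 = 2 ^ length (Ms @ [D])" using IH(2) by simp
    have 2: "finite (all_cones D)" unfolding split using fin IH(1) by simp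
    have 3: "card (cones D (hd Ms)) = 2 ^ length Ms"
    proof (cases "length Ms \<ge> 2")
      case True
      then obtain Xs where Xs: "Ms = Xs @ [N]" "Xs \<noteq> []"
        using False by (metis N_def append_butlast_last_id append_self_conv2 length_Cons list.size(3) not_less_eq_eq numeral_2_eq_2 order_refl)
      have hdN: "hd Ms \<subset> N" using rational_chain_append_hd[of Xs "[N]"] Ms Xs by simp
      have sub: "cones N (hd Ms) \<subseteq> all_cones N" by (auto simp: cones_def all_cones_def)
      have "cones D (hd Ms) = ?f ` (cones D N \<times> cones N (hd Ms))"
      proof (intro equalityI subsetI)
        fix P assume "P \<in> cones D (hd Ms)"
        then have P: "conrad_cone G D (hd Ms) P" "P \<noteq> {}" by (auto simp: cones_def)
        have "P \<inter> N \<in> cones N (hd Ms)" using lower[OF P] cone_nonempty hdN by (auto simp: cones_def)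
        moreover have "P = ?f (P - N, P \<inter> N)" by auto
        ultimately show "P \<in> ?f ` (cones D N \<times> cones N (hd Ms))" using upper[OF P] by blast
      qed (use lex_conrad in \<open>auto simp: cones_def\<close>)
      moreover have "inj_on ?f (cones D N \<times> cones N (hd Ms))"
        by (rule inj_on_subset[OF inj]) (use sub in auto)
      ultimately have "card (cones D (hd Ms)) = 2 * card (cones N (hd Ms))"
        by (simp add: card_image card_cartesian_product card2)
      then show ?thesis using IH(3)[OF True] True by (simp flip: power_Suc)
    next
      case short: False
      then have "Ms = [N]" using False by (cases Ms rule: remdups_adj.cases) (auto simp: N_def)
      then show ?thesis using card2 by simp
    qed
    show ?thesis using 1 2 3 False by simp
  qed
qed (simp add: rational_chain_def)

end

section \<open>Conradian left-preorders as cones\<close>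

context group
begin

definition order_of where
  "order_of C P = {(a, b) \<in> carrier G \<times> carrier G. inv a \<otimes> b \<in> P \<union> C}"

lemma CO_cone:
  assumes "R \<in> CO G"
  shows "conrad_cone G (carrier G) (preorder_subgroup G R) (positive_cone G R)"
    and "positive_cone G R \<noteq> {}"
    and "R = order_of (preorder_subgroup G R) (positive_cone G R)"
proof -
  let ?P = "positive_cone G R" and ?C = "preorder_subgroup G R"
  have lp: "left_preorder G R" and con: "conradian G R" using assms by (auto simp: CO_def)
  have sub: "R \<subseteq> carrier G \<times> carrier G" and nontrivial: "R \<noteq> carrier G \<times> carrier G"
    and ro: "refl_on (carrier G) R" "total_on (carrier G) R" "trans R"
    and linv: "\<And>a b c. \<lbrakk>c \<in> carrier G; a \<in> carrier G; b \<in> carrier G; (a, b) \<in> R\<rbrakk> \<Longrightarrow> (c \<otimes> a, c \<otimes> b) \<in> R"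
    using lp by (simp_all add: left_preorder_def)
  have refl: "(a, a) \<in> R" if "a \<in> carrier G" for a using ro(1) that by (simp add: refl_on_def)
  have tot: "(a, b) \<in> R \<or> (b, a) \<in> R" if "a \<in> carrier G" "b \<in> carrier G" for a b
    using ro(2)[unfolded total_on_def, rule_format, OF that] refl[OF that(1)] by (cases "a = b") simp_all
  have tr: "(a, c) \<in> R" if "(a, b) \<in> R" "(b, c) \<in> R" for a b c
    by (rule transD[OF ro(3) that])
  have shift: "(a, b) \<in> R \<longleftrightarrow> (\<one>, inv a \<otimes> b) \<in> R" "(b, a) \<in> R \<longleftrightarrow> (inv a \<otimes> b, \<one>) \<in> R"
    if "a \<in> carrier G" "b \<in> carrier G" for a b
    using linv[of "inv a" a b] linv[of "inv a" b a] linv[of a \<one> "inv a \<otimes> b"] linv[of a "inv a \<otimes> b" \<one>] that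
    by auto
  have P: "x \<in> ?P \<longleftrightarrow> x \<in> carrier G \<and> (\<one>, x) \<in> R \<and> (x, \<one>) \<notin> R" for x
    by (auto simp: positive_cone_def strictly_less_def)
  have C: "x \<in> ?C \<longleftrightarrow> x \<in> carrier G \<and> (\<one>, x) \<in> R \<and> (x, \<one>) \<in> R" for x
    by (auto simp: preorder_subgroup_def)
  have inv: "(\<one>, inv x) \<in> R \<longleftrightarrow> (x, \<one>) \<in> R" "(inv x, \<one>) \<in> R \<longleftrightarrow> (\<one>, x) \<in> R" if "x \<in> carrier G" for x
    using shift[of x \<one>] that by auto
  have mult: "(\<one>, x \<otimes> y) \<in> R" if "(\<one>, x) \<in> R" "(\<one>, y) \<in> R" "x \<in> carrier G" "y \<in> carrier G" for x y
    using linv[of x \<one> y] tr[of \<one> x "x \<otimes> y"] that by auto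
  have mult': "(x \<otimes> y, \<one>) \<in> R" if "(x, \<one>) \<in> R" "(y, \<one>) \<in> R" "x \<in> carrier G" "y \<in> carrier G" for x y
    using linv[of x y \<one>] tr[of "x \<otimes> y" x \<one>] that by auto
  have subC: "subgroup ?C G"
  proof (rule subgroupI)
    show "?C \<noteq> {}" using C[of \<one>] refl by blast
  qed (use C inv mult mult' in auto)
  have P_mult: "x \<otimes> y \<in> ?P" if "x \<in> ?P" "y \<in> ?P" for x y
  proof -
    have xy: "x \<in> carrier G" "y \<in> carrier G" "(\<one>, x) \<in> R" "(\<one>, y) \<in> R" "(y, \<one>) \<notin> R" using that P by auto
    have "(x \<otimes> y, \<one>) \<notin> R"
    proof
      assume "(x \<otimes> y, \<one>) \<in> R"
      then have "(x \<otimes> y, x) \<in> R" using tr xy by blast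
      then show False using shift(2)[of x "x \<otimes> y"] xy by simp
    qed
    then show ?thesis using P mult xy by auto
  qed
  have lt: "strictly_less R a b \<longleftrightarrow> inv a \<otimes> b \<in> ?P" if "a \<in> carrier G" "b \<in> carrier G" for a b
    using shift[OF that] that P by (auto simp: strictly_less_def)
  show "conrad_cone G (carrier G) ?C ?P"
  proof (intro conrad_cone.intro left_cone.intro left_cone_axioms.intro conrad_cone_axioms.intro group_axioms subC)
    show "subgroup (carrier G) G" by (rule subgroup_self)
    show "inv x \<notin> ?P" if "x \<in> ?P" for x using that P inv by auto
    show "x \<in> ?C \<or> x \<in> ?P \<or> inv x \<in> ?P" if "x \<in> carrier G" for x
      using that tot[of \<one> x] P C inv by auto
    fix a b assume ab: "a \<in> ?P" "b \<in> ?P"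
    then have c: "a \<in> carrier G" "b \<in> carrier G" and "strictly_less R \<one> a" "strictly_less R \<one> b"
      by (auto simp: positive_cone_def)
    then obtain n :: nat where "strictly_less R a (b \<otimes> a [^] n)" using con unfolding conradian_def by blast
    then have "inv a \<otimes> (b \<otimes> a [^] n) \<in> ?P" using lt c by simp
    then show "\<exists>n::nat. inv a \<otimes> (b \<otimes> a [^] n) \<in> ?P" ..
  qed (use P C P_mult in auto)
  have PC: "(a, b) \<in> R \<longleftrightarrow> inv a \<otimes> b \<in> ?P \<union> ?C" if "a \<in> carrier G" "b \<in> carrier G" for a b
    using shift[OF that] that P C by auto
  then show "R = order_of ?C ?P" using sub by (auto simp: order_of_def)
  show "?P \<noteq> {}"
  proof
    assume "?P = {}"
    then have "x \<in> ?C" if "x \<in> carrier G" for x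
      using that tot[of \<one> x] P[of x] P[of "inv x"] C inv by auto
    then show False using PC sub nontrivial by auto
  qed
qed

lemma cone_CO:
  assumes "conrad_cone G (carrier G) C P" "P \<noteq> {}"
  shows "order_of C P \<in> CO G"
    and "positive_cone G (order_of C P) = P"
    and "preorder_subgroup G (order_of C P) = C"
proof -
  interpret R: conrad_cone G "carrier G" C P by fact
  have mem: "(a, b) \<in> order_of C P \<longleftrightarrow> a \<in> carrier G \<and> b \<in> carrier G \<and> R.le a b" for a b
    by (auto simp: order_of_def R.le_def)
  have less: "strictly_less (order_of C P) a b \<longleftrightarrow> R.lt a b" if "a \<in> carrier G" "b \<in> carrier G" for a b
    using that R.not_le[of b a] R.lt_le by (auto simp: strictly_less_def mem)
  show pos: "positive_cone G (order_of C P) = P"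
    using less R.lt_one by (auto simp: positive_cone_def)
  have inv: "inv x \<in> P \<union> C \<and> x \<in> P \<union> C \<longleftrightarrow> x \<in> C" if "x \<in> carrier G" for x
    using that R.asym R.C.m_inv_closed[of x] R.C.m_inv_closed[of "inv x"] R.disjoint by auto
  show "preorder_subgroup G (order_of C P) = C"
  proof (rule Set.set_eqI)
    fix x
    show "x \<in> preorder_subgroup G (order_of C P) \<longleftrightarrow> x \<in> C"
    proof (cases "x \<in> carrier G")
      case True
      then show ?thesis using inv[OF True] unfolding preorder_subgroup_def by (simp add: mem R.le_def)
    qed (use R.in_carrier in \<open>auto simp: preorder_subgroup_def\<close>)
  qed
  have "left_preorder G (order_of C P)"
    unfolding left_preorder_def
  proof (intro conjI ballI impI)
    show "order_of C P \<subseteq> carrier G \<times> carrier G" by (auto simp: order_of_def)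
    show "refl_on (carrier G) (order_of C P)" using R.le_refl by (auto simp: refl_on_def mem)
    show "total_on (carrier G) (order_of C P)"
      using R.not_le R.lt_le by (auto simp: total_on_def mem)
    show "trans (order_of C P)" using R.le_trans by (auto simp: trans_def mem)
    show "(c \<otimes> a, c \<otimes> b) \<in> order_of C P"
      if "c \<in> carrier G" "a \<in> carrier G" "b \<in> carrier G" "(a, b) \<in> order_of C P" for a b c
      using that R.le_mult_left by (simp add: mem)
    obtain p where p: "p \<in> P" using assms(2) by blast
    then have "R.lt \<one> p" using R.lt_one by simp
    then have "(p, \<one>) \<notin> order_of C P" using R.lt_not_le p by (simp add: mem)
    then show "order_of C P \<noteq> carrier G \<times> carrier G" using p by auto
  qed
  moreover have "conradian G (order_of C P)"
    unfolding conradian_def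
  proof (intro ballI impI)
    fix a b assume c: "a \<in> carrier G" "b \<in> carrier G"
      and "strictly_less (order_of C P) \<one> a \<and> strictly_less (order_of C P) \<one> b"
    then have "a \<in> P" "b \<in> P" using less R.lt_one by auto
    then obtain n :: nat where "R.lt a (b \<otimes> a [^] n)" using R.conrad_lt by blast
    then show "\<exists>n::nat. strictly_less (order_of C P) a (b \<otimes> a [^] n)" using less c by auto
  qed
  ultimately show "order_of C P \<in> CO G" by (simp add: CO_def)
qed

text \<open>\<open>C\<close> consists of the elements of \<open>D\<close> for which neither they nor
  their inverses are in \<open>P\<close>.\<close>

lemma cone_subgroup_unique:
  assumes "conrad_cone G D C P" "conrad_cone G D C' P" shows "C = C'"
proof -
  interpret R: conrad_cone G D C P by fact
  interpret R': conrad_cone G D C' P by fact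
  show ?thesis
    using R.total R'.total R.disjoint R'.disjoint R.C_subset R'.C_subset
      R.C.m_inv_closed R'.C.m_inv_closed by blast
qed

lemma CO_eqI: "R \<in> CO G \<Longrightarrow> R' \<in> CO G \<Longrightarrow> positive_cone G R = positive_cone G R' \<Longrightarrow> R = R'"
  using CO_cone(1,3) cone_subgroup_unique by metis

lemma bij_CO: "bij_betw (positive_cone G) (CO G) (all_cones (carrier G))"
proof (rule bij_betw_imageI)
  show "inj_on (positive_cone G) (CO G)" using CO_eqI by (auto simp: inj_on_def)
  show "positive_cone G ` CO G = all_cones (carrier G)"
  proof (intro equalityI subsetI)
    fix P assume "P \<in> all_cones (carrier G)"
    then obtain C where "conrad_cone G (carrier G) C P" "P \<noteq> {}" by (auto simp: all_cones_def)
    then show "P \<in> positive_cone G ` CO G" using cone_CO[of C P] by (metis imageI)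
  qed (use CO_cone in \<open>auto simp: all_cones_def\<close>)
qed

lemma bij_CO_rel: "bij_betw (positive_cone G) (CO_rel G C) (cones (carrier G) C)"
proof (rule bij_betw_imageI)
  show "inj_on (positive_cone G) (CO_rel G C)" using CO_eqI by (auto simp: inj_on_def CO_rel_def)
  show "positive_cone G ` CO_rel G C = cones (carrier G) C"
  proof (intro equalityI subsetI)
    fix P assume "P \<in> cones (carrier G) C"
    then have "conrad_cone G (carrier G) C P" "P \<noteq> {}" by (auto simp: cones_def)
    then have "positive_cone G (order_of C P) = P" "order_of C P \<in> CO_rel G C"
      using cone_CO[of C P] by (auto simp: CO_rel_def)
    then show "P \<in> positive_cone G ` CO_rel G C" by (metis imageI)
  qed (use CO_cone in \<open>auto simp: cones_def CO_rel_def\<close>)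
qed

lemma CO_sub_empty_iff: assumes "subgroup H G" shows "CO (sub G H) = {} \<longleftrightarrow> all_cones H = {}"
proof -
  interpret S: group "sub G H" by (rule subgroup.subgroup_is_group[OF assms is_group])
  have "S.all_cones H = all_cones H"
    using conrad_cone_sub_iff[OF assms order_refl] by (simp add: S.all_cones_def all_cones_def)
  then show ?thesis using bij_betw_imp_surj_on[OF S.bij_CO] by auto
qed

section \<open>The smallest subgroup of a Conradian left-preorder, and rational series as
  chains\<close>

lemma C0_eq: "C0 G = \<Inter> {C. cones (carrier G) C \<noteq> {}}"
proof -
  have "CO_rel G C \<noteq> {} \<longleftrightarrow> cones (carrier G) C \<noteq> {}" for C
    using bij_betw_imp_surj_on[OF bij_CO_rel] by blast
  moreover have "subgroup C G \<and> C \<noteq> carrier G" if "cones (carrier G) C \<noteq> {}" for C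
  proof -
    obtain P where P: "conrad_cone G (carrier G) C P" "P \<noteq> {}" using \<open>cones (carrier G) C \<noteq> {}\<close> by (auto simp: cones_def)
    interpret R: conrad_cone G "carrier G" C P by (rule P(1))
    show ?thesis using R.subgroup_C nonempty_cone_proper[OF P] by blast
  qed
  ultimately have "{H. subgroup H G \<and> H \<noteq> carrier G \<and> CO_rel G H \<noteq> {}} = {C. cones (carrier G) C \<noteq> {}}"
    by blast
  then show ?thesis by (simp add: C0_def)
qed

lemma cone_C0:
  assumes "CO G \<noteq> {}"
  obtains P where "conrad_cone G (carrier G) (C0 G) P" "P \<noteq> {}"
proof -
  define I where "I = {C. cones (carrier G) C \<noteq> {}}"
  obtain R where R: "R \<in> CO G" using assms by blast
  have "positive_cone G R \<in> cones (carrier G) (preorder_subgroup G R)"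
    using CO_cone(1,2)[OF R] by (simp add: cones_def)
  then have ne: "I \<noteq> {}" unfolding I_def by blast
  \<comment> \<open>One cone is chosen for each subgroup that occurs, so the subgroups themselves
    index the family and their intersection is \<open>C0 G\<close>.\<close>
  have "conrad_cone G (carrier G) C (SOME P. P \<in> cones (carrier G) C)" if "C \<in> I" for C
    using some_in_eq[of "cones (carrier G) C"] that by (auto simp: I_def cones_def)
  from lex_family[of I "carrier G" "\<lambda>C. C", OF ne this] obtain P where P: "conrad_cone G (carrier G) (C0 G) P"
    by (auto simp: C0_eq I_def)
  obtain C Q where "conrad_cone G (carrier G) C Q" "Q \<noteq> {}" "C \<in> I" using ne by (auto simp: I_def cones_def)
  then have "C0 G \<noteq> carrier G" using nonempty_cone_proper unfolding C0_eq I_def by blast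
  then show ?thesis using that P cone_nonempty by blast
qed

text \<open>A nonempty cone on \<open>C0 G\<close> would refine a cone relative to
  \<open>C0 G\<close> to one relative to a strictly smaller subgroup.\<close>

lemma all_cones_C0_empty: assumes "CO G \<noteq> {}" shows "all_cones (C0 G) = {}"
proof (rule ccontr)
  assume "all_cones (C0 G) \<noteq> {}"
  then obtain C Q where Q: "conrad_cone G (C0 G) C Q" "Q \<noteq> {}" by (auto simp: all_cones_def)
  obtain P where P: "conrad_cone G (carrier G) (C0 G) P" using cone_C0[OF assms] by blast
  have "P \<union> Q \<in> cones (carrier G) C" using lex_conrad[OF P Q(1)] Q(2) by (simp add: cones_def)
  then have "C0 G \<subseteq> C" unfolding C0_eq by blast
  then show False using nonempty_cone_proper[OF Q] by blast
qed

lemma rational_series_iff: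
  "rational_series G Gs \<longleftrightarrow> rational_chain Gs \<and> last Gs = carrier G"
proof -
  have "(\<forall>i. Suc i < length Gs \<longrightarrow>
        Gs ! i \<lhd> sub G (Gs ! Suc i) \<and> comm_group (sub G (Gs ! Suc i) Mod Gs ! i) \<and>
        torsion_free (sub G (Gs ! Suc i) Mod Gs ! i) \<and> has_rank (sub G (Gs ! Suc i) Mod Gs ! i) 1) \<longleftrightarrow>
      successively (\<lambda>H K. rational_over K H) Gs" if "\<forall>H\<in>set Gs. subgroup H G"
    unfolding successively_conv_nth using that rational_quotient_iff by (metis Suc_lessD nth_mem)
  then show ?thesis unfolding rational_series_def rational_chain_def by blast
qed

lemma rational_chain_nth_subset:
  assumes "rational_chain Gs" "i \<le> j" "j < length Gs" shows "Gs ! i \<subseteq> Gs ! j"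
  using assms(2,3)
proof (induction j rule: dec_induct)
  case (step j)
  then have "rational_over (Gs ! Suc j) (Gs ! j)"
    using assms(1) unfolding rational_chain_def successively_conv_nth by blast
  then show ?case using step rational_over_proper by fastforce
qed simp

lemma no_abelian_jumps_iff:
  assumes "rational_chain Gs" shows "no_abelian_jumps G Gs \<longleftrightarrow> no_jump Gs"
proof -
  have "abelian_jump G Gs i \<longleftrightarrow> i + 2 < length Gs \<and> abelian_over (Gs ! (i + 2)) (Gs ! i)" for i
  proof (cases "i + 2 < length Gs")
    case True
    then have "subgroup (Gs ! i) G" "subgroup (Gs ! (i + 2)) G" using assms by (auto simp: rational_chain_def)
    then show ?thesis
      using abelian_quotient_iff[of "Gs ! (i + 2)" "Gs ! i"] rational_chain_nth_subset[OF assms, of i "i + 2"] True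
      by (auto simp: abelian_jump_def)
  qed (simp add: abelian_jump_def)
  then show ?thesis by (auto simp: no_abelian_jumps_def no_jump_def)
qed

section \<open>Isolated points and finite certificates\<close>

lemma sign_map_eq_iff:
  assumes "R \<in> CO G" "R' \<in> CO G" "x \<in> carrier G"
  shows "sign_map G R x = sign_map G R' x \<longleftrightarrow>
    (x \<in> positive_cone G R \<longleftrightarrow> x \<in> positive_cone G R') \<and>
    (inv x \<in> positive_cone G R \<longleftrightarrow> inv x \<in> positive_cone G R')"
proof -
  interpret R: conrad_cone G "carrier G" "preorder_subgroup G R" "positive_cone G R" by (rule CO_cone(1)[OF assms(1)])
  interpret R': conrad_cone G "carrier G" "preorder_subgroup G R'" "positive_cone G R'" by (rule CO_cone(1)[OF assms(2)])
  have inv: "x \<in> set_inv X \<longleftrightarrow> inv x \<in> X" if "X \<subseteq> carrier G" for X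
    using that assms(3) by (force simp: SET_INV_def)
  show ?thesis
    using R.asym[of x] R'.asym[of x] R.P_subset R'.P_subset assms(3) inv
    by (auto simp: sign_map_def)
qed

lemma sign_map_PiE: "sign_map G R \<in> (\<Pi>\<^sub>E i\<in>carrier G. {1, -1, 0})"
  by (auto simp: sign_map_def)

text \<open>A basic open set restricts only finitely many coordinates \<open>E\<close>. Each of them
  is controlled by whichever of \<open>x\<close> and \<open>inv x\<close> is positive, and this
  element goes into \<open>F\<close>. Coordinates in \<open>C\<close> have sign 0 for every cone
  relative to \<open>C\<close>.\<close>

lemma isolated_point_cone:
  assumes iso: "isolated_point (CO_topology G) (order_of C P)"
    and P: "conrad_cone G (carrier G) C P" "P \<noteq> {}"
  obtains F where "isolated_cone G (carrier G) C P F"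
proof -
  interpret R: conrad_cone G "carrier G" C P by (rule P(1))
  let ?R = "order_of C P"
  let ?T = "\<lambda>_::'a. discrete_topology {1, -1, 0 :: int}"
  have R: "?R \<in> CO G" "positive_cone G ?R = P" using cone_CO P by auto
  obtain U where U: "openin (product_topology ?T (carrier G)) U" "{?R} = sign_map G -` U \<inter> CO G"
    using iso unfolding isolated_point_def CO_topology_def openin_pullback_topology by blast
  have "sign_map G ?R \<in> U" using U(2) by blast
  from product_topology_open_contains_basis[OF U(1) this]
  obtain X where X: "sign_map G ?R \<in> (\<Pi>\<^sub>E i\<in>carrier G. X i)" "finite {i. X i \<noteq> {1, -1, 0}}"
    "(\<Pi>\<^sub>E i\<in>carrier G. X i) \<subseteq> U" by auto
  define E where "E = {i. X i \<noteq> {1, -1, 0}}"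
  define F where "F = {x \<in> P. x \<in> E \<or> inv x \<in> E}"
  have "F \<subseteq> E \<union> (\<lambda>x. inv x) ` E"
  proof
    fix x assume x: "x \<in> F"
    then have "x = inv (inv x)" by (simp add: F_def)
    then have "inv x \<in> E \<Longrightarrow> x \<in> (\<lambda>x. inv x) ` E" by (rule image_eqI)
    then show "x \<in> E \<union> (\<lambda>x. inv x) ` E" using x by (auto simp: F_def)
  qed
  then have "finite F" using X(2) unfolding E_def by (meson finite_UnI finite_imageI finite_subset)
  moreover have "P' = P" if P': "conrad_cone G (carrier G) C P'" "F \<subseteq> P'" for P'
  proof -
    interpret R': conrad_cone G "carrier G" C P' by (rule P'(1))
    have "P' \<noteq> {}" using cone_nonempty[OF P'(1)] nonempty_cone_proper[OF P] by blast
    then have R': "order_of C P' \<in> CO G" "positive_cone G (order_of C P') = P'" using cone_CO P' by auto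
    have "sign_map G (order_of C P') \<in> (\<Pi>\<^sub>E i\<in>carrier G. X i)"
    proof (rule PiE_I)
      fix x assume x: "x \<in> carrier G"
      show "sign_map G (order_of C P') x \<in> X x"
      proof (cases "x \<in> E")
        case True
        have "x \<in> F \<longleftrightarrow> x \<in> P" "inv x \<in> F \<longleftrightarrow> inv x \<in> P" using True x by (auto simp: F_def)
        then have "(x \<in> P \<longleftrightarrow> x \<in> P') \<and> (inv x \<in> P \<longleftrightarrow> inv x \<in> P')"
          using P'(2) R.total[OF x] R.asym[of x] R'.asym[of x] R'.asym[of "inv x"] R'.disjoint R.disjoint
            R.C.m_inv_closed[of x] x by auto
        then have "sign_map G (order_of C P') x = sign_map G ?R x"
          using sign_map_eq_iff[OF R'(1) R(1) x] R R' by simp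
        then show ?thesis using X(1) x by auto
      next
        case False
        then show ?thesis using sign_map_PiE[of "order_of C P'"] x by (auto simp: E_def)
      qed
    qed (simp add: sign_map_def)
    then have "order_of C P' = ?R" using X(3) U(2) R'(1) by blast
    then show ?thesis using R R' by simp
  qed
  ultimately have "isolated_cone G (carrier G) C P F"
    by (intro isolated_cone.intro isolated_cone_axioms.intro P(1)) (auto simp: F_def)
  then show ?thesis by (rule that)
qed

text \<open>Each other preorder differs from \<open>R\<close> at some coordinate; prescribing the
  signs of \<open>R\<close> at these finitely many coordinates leaves only \<open>R\<close>.\<close>

lemma finite_CO_isolated:
  assumes "finite (CO G)" "R \<in> CO G" shows "isolated_point (CO_topology G) R"
proof -
  let ?T = "\<lambda>_::'a. discrete_topology {1, -1, 0 :: int}"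
  have "\<exists>x\<in>carrier G. sign_map G R' x \<noteq> sign_map G R x" if "R' \<in> CO G - {R}" for R'
  proof (rule ccontr)
    assume "\<not> ?thesis"
    then have "x \<in> positive_cone G R' \<longleftrightarrow> x \<in> positive_cone G R" if "x \<in> carrier G" for x
      using sign_map_eq_iff[of R' R x] that \<open>R' \<in> CO G - {R}\<close> assms by blast
    then have "positive_cone G R' = positive_cone G R" by (auto simp: positive_cone_def)
    then show False using CO_eqI[of R' R] that assms by blast
  qed
  then obtain w where w: "\<And>R'. R' \<in> CO G - {R} \<Longrightarrow> w R' \<in> carrier G \<and> sign_map G R' (w R') \<noteq> sign_map G R (w R')"
    by metis
  define F where "F = w ` (CO G - {R})"
  define X where "X i = (if i \<in> F then {sign_map G R i} else {1, -1, 0})" for i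
  have F: "finite F" "F \<subseteq> carrier G" using assms w by (auto simp: F_def)
  have "openin (product_topology ?T (carrier G)) (\<Pi>\<^sub>E i\<in>carrier G. X i)"
  proof (rule product_topology_basis)
    show "openin (?T i) (X i)" for i
      using sign_map_PiE[of R] F by (auto simp: X_def)
    show "finite {i. X i \<noteq> topspace (?T i)}"
      by (rule finite_subset[OF _ F(1)]) (auto simp: X_def)
  qed
  moreover have "{R} = sign_map G -` (\<Pi>\<^sub>E i\<in>carrier G. X i) \<inter> CO G"
  proof -
    have "sign_map G R \<in> (\<Pi>\<^sub>E i\<in>carrier G. X i)"
      using sign_map_PiE[of R] by (auto simp: X_def PiE_iff)
    moreover have "R' = R" if "R' \<in> CO G" "sign_map G R' \<in> (\<Pi>\<^sub>E i\<in>carrier G. X i)" for R'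
    proof (rule ccontr)
      assume "R' \<noteq> R"
      then have "w R' \<in> F" "w R' \<in> carrier G" "sign_map G R' (w R') \<noteq> sign_map G R (w R')"
        using w that(1) by (auto simp: F_def)
      moreover have "sign_map G R' (w R') \<in> X (w R')" using that(2) \<open>w R' \<in> carrier G\<close> by (rule PiE_mem)
      ultimately show False by (simp add: X_def)
    qed
    ultimately show ?thesis using assms(2) by blast
  qed
  ultimately have "openin (CO_topology G) {R}"
    unfolding CO_topology_def openin_pullback_topology by blast
  then show ?thesis using openin_subset by (fastforce simp: isolated_point_def)
qed

text \<open>Distinct cones relative to \<open>C\<close> are not nested, by \<open>cone_eqI\<close>,
  so \<open>P\<close> has an element outside each of the finitely many others; these elements form
  \<open>F\<close>.\<close>

lemma finite_CO_rel_isolated: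
  assumes fin: "finite (CO_rel G C)" and P: "conrad_cone G (carrier G) C P" "P \<noteq> {}"
  obtains F where "isolated_cone G (carrier G) C P F"
proof -
  interpret R: conrad_cone G "carrier G" C P by (rule P(1))
  have finc: "finite (cones (carrier G) C)" using fin bij_betw_finite[OF bij_CO_rel] by blast
  have "\<exists>x\<in>P. x \<notin> P'" if "P' \<in> cones (carrier G) C - {P}" for P'
    using that R.cone_eqI[of P'] conrad_cone.axioms(1) unfolding cones_def by blast
  then obtain w where w: "\<And>P'. P' \<in> cones (carrier G) C - {P} \<Longrightarrow> w P' \<in> P \<and> w P' \<notin> P'" by metis
  define F where "F = w ` (cones (carrier G) C - {P})"
  have "P' = P" if P': "conrad_cone G (carrier G) C P'" "F \<subseteq> P'" for P'
  proof (rule ccontr)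
    assume "P' \<noteq> P"
    moreover have "P' \<noteq> {}" using cone_nonempty[OF P'(1)] nonempty_cone_proper[OF P] by blast
    ultimately have "P' \<in> cones (carrier G) C - {P}" using P' by (simp add: cones_def)
    then show False using w P'(2) by (auto simp: F_def)
  qed
  moreover have "finite F" "F \<subseteq> P" using finc w by (auto simp: F_def)
  ultimately have "isolated_cone G (carrier G) C P F"
    by (intro isolated_cone.intro isolated_cone_axioms.intro P(1)) auto
  then show ?thesis by (rule that)
qed

text \<open>The common form of the series in (b) to (e). Absence of cones on the first term stands
  in for maximal length as well as for starting at \<open>C0 G\<close>.\<close>

definition rigid_series where
  "rigid_series Gs \<longleftrightarrow> rational_chain Gs \<and> last Gs = carrier G \<and> no_jump Gs \<and> all_cones (hd Gs) = {}"

lemma isolated_rigid_series: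
  assumes "CO G \<noteq> {}" "isolated_cone G (carrier G) (C0 G) P F"
  shows "\<exists>Gs. rigid_series Gs"
  using isolated_cone.rational_chain_exists[OF assms(2)] all_cones_C0_empty[OF assms(1)]
  by (auto simp: rigid_series_def)

lemma rigid_series_suffix:
  assumes "rigid_series Gs" "rational_series G Ks" shows "\<exists>Xs. Gs = Xs @ Ks"
  using rational_chain_suffix[of Gs Ks] assms by (simp add: rigid_series_def rational_series_iff)

text \<open>The first term is the subgroup of some cone by \<open>rational_chain_cone\<close>, and
  by \<open>hd_subset_C\<close> it is contained in the subgroup of every cone. It differs from the
  last term, which carries a nonempty cone.\<close>

lemma rigid_series_hd:
  assumes ne: "CO G \<noteq> {}" and Gs: "rigid_series Gs" shows "hd Gs = C0 G" "length Gs \<ge> 2"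
proof -
  have chain: "rational_chain Gs" "last Gs = carrier G" "all_cones (hd Gs) = {}" "Gs \<noteq> []"
    using Gs by (auto simp: rigid_series_def rational_chain_def)
  have "all_cones (carrier G) \<noteq> {}" using bij_betw_imp_surj_on[OF bij_CO] ne by blast
  then have hl: "hd Gs \<noteq> last Gs" using chain by auto
  then show "length Gs \<ge> 2" using chain(4) by (cases Gs rule: remdups_adj.cases) auto
  obtain P where P: "conrad_cone G (carrier G) (hd Gs) P" using rational_chain_cone[OF chain(1)] chain(2) by auto
  then have "P \<in> cones (carrier G) (hd Gs)" using cone_nonempty hl chain(2) by (auto simp: cones_def)
  then have "C0 G \<subseteq> hd Gs" unfolding C0_eq by blast
  moreover have "hd Gs \<subseteq> C" if "cones (carrier G) C \<noteq> {}" for C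
  proof -
    obtain Ms where Ms: "Gs = Ms @ [carrier G]" using chain(2,4) by (metis append_butlast_last_id)
    show ?thesis using that hd_subset_C[of Ms "carrier G" C] chain by (auto simp: cones_def Ms)
  qed
  ultimately show "hd Gs = C0 G" unfolding C0_eq by blast
qed

lemma rigid_series_card:
  assumes ne: "CO G \<noteq> {}" and Gs: "rigid_series Gs"
  shows "finite (CO G)" "card (CO G) = 2 ^ (series_length Gs + 1) - 2"
    "card (CO_rel G (C0 G)) = 2 ^ series_length Gs"
proof -
  have len: "length Gs \<ge> 2" and hd: "hd Gs = C0 G" using rigid_series_hd[OF assms] by auto
  have *: "finite (all_cones (carrier G))" "card (all_cones (carrier G)) + 2 = 2 ^ length Gs"
      "card (cones (carrier G) (hd Gs)) = 2 ^ (length Gs - 1)"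
    using card_all_cones[of Gs] Gs len by (auto simp: rigid_series_def)
  show "finite (CO G)" using bij_betw_finite[OF bij_CO] * by blast
  show "card (CO G) = 2 ^ (series_length Gs + 1) - 2"
  proof -
    have "series_length Gs + 1 = length Gs" using len by (simp add: series_length_def)
    then show ?thesis using bij_betw_same_card[OF bij_CO] *(2) by (metis add_diff_cancel_right')
  qed
  show "card (CO_rel G (C0 G)) = 2 ^ series_length Gs"
    using bij_betw_same_card[OF bij_CO_rel[of "C0 G"]] * hd by (simp add: series_length_def)
qed

end

theorem theorem1p5:
  fixes G :: "('a, 'b) monoid_scheme"
  assumes "group G" and "CO G \<noteq> {}"
  shows
    "let
       a = (\<forall>R\<in>CO G. isolated_point (CO_topology G) R);
       series_b = (\<lambda>Gs. rational_series_max G Gs \<and> no_abelian_jumps G Gs \<and> CO (sub G (hd Gs)) = {});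
       series_c = (\<lambda>Gs. rational_series_max G Gs \<and> (\<forall>Ks. rational_series_max G Ks \<longrightarrow> Ks = Gs) \<and>
                        no_abelian_jumps G Gs \<and> CO (sub G (hd Gs)) = {});
       series_d = (\<lambda>Gs. rational_series G Gs \<and> hd Gs = C0 G \<and> no_abelian_jumps G Gs);
       series_e = (\<lambda>Gs. rational_series G Gs \<and> hd Gs = C0 G \<and>
                        (\<forall>Ks. rational_series G Ks \<and> hd Ks = C0 G \<longrightarrow> Ks = Gs) \<and>
                        no_abelian_jumps G Gs);
       b = (\<exists>Gs. series_b Gs);
       c = (\<exists>Gs. series_c Gs);
       d = (\<exists>Gs. series_d Gs);
       e = (\<exists>Gs. series_e Gs);
       f = finite (CO_rel G (C0 G));
       g = finite (CO G)
     in
       (a \<longleftrightarrow> b) \<and> (b \<longleftrightarrow> c) \<and> (c \<longleftrightarrow> d) \<and> (d \<longleftrightarrow> e) \<and> (e \<longleftrightarrow> f) \<and> (f \<longleftrightarrow> g) \<and>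
       (\<forall>Gs. series_b Gs \<or> series_c Gs \<or> series_d Gs \<or> series_e Gs \<longrightarrow>
          card (CO G) = 2 ^ (series_length Gs + 1) - 2 \<and>
          card (CO_rel G (C0 G)) = 2 ^ series_length Gs)"
proof -
  interpret group G by fact
  note ne = assms(2)
  have CO_hd: "CO (sub G (hd Gs)) = {} \<longleftrightarrow> all_cones (hd Gs) = {}" if "rational_series G Gs" for Gs
    using CO_sub_empty_iff[of "hd Gs"] that by (auto simp: rational_series_def)
  have rigid: "rigid_series Gs \<longleftrightarrow>
      rational_series G Gs \<and> no_abelian_jumps G Gs \<and> CO (sub G (hd Gs)) = {}" for Gs
    using CO_hd[of Gs] no_abelian_jumps_iff[of Gs] by (auto simp: rigid_series_def rational_series_iff)
  \<comment> \<open>All three claims rest on every rational series being a final segment of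
    \<open>Gs\<close>: a final segment of the same length is \<open>Gs\<close> itself, and a shorter
    one starts at a strictly larger subgroup.\<close>
  have max: "rational_series_max G Gs" and max_unique: "\<And>Ks. rational_series_max G Ks \<Longrightarrow> Ks = Gs"
    and hd_unique: "\<And>Ks. rational_series G Ks \<Longrightarrow> hd Ks = C0 G \<Longrightarrow> Ks = Gs" if Gs: "rigid_series Gs" for Gs
  proof -
    have rs: "rational_series G Gs" using Gs rigid by blast
    show "rational_series_max G Gs"
      unfolding rational_series_max_def series_length_def
      using rs rigid_series_suffix[OF Gs] by fastforce
    show "Ks = Gs" if Ks: "rational_series_max G Ks" for Ks
    proof -
      obtain Xs where Xs: "Gs = Xs @ Ks" using rigid_series_suffix[OF Gs] Ks by (auto simp: rational_series_max_def)
      have "length Gs - 1 \<le> length Ks - 1" "Ks \<noteq> []"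
        using Ks rs by (auto simp: rational_series_max_def series_length_def rational_series_def)
      then have "Xs = []" unfolding Xs by (cases Ks) auto
      then show ?thesis using Xs by simp
    qed
    show "Ks = Gs" if Ks: "rational_series G Ks" "hd Ks = C0 G" for Ks
    proof -
      obtain Xs where Xs: "Gs = Xs @ Ks" using rigid_series_suffix[OF Gs Ks(1)] by blast
      have "Xs = []"
      proof (rule ccontr)
        assume "Xs \<noteq> []"
        moreover have "rational_chain (Xs @ Ks)" using Gs Xs by (simp add: rigid_series_def)
        moreover have "Ks \<noteq> []" using Ks(1) by (simp add: rational_series_def)
        ultimately have "hd Gs \<subset> C0 G" using rational_chain_append_hd Xs Ks(2) by (metis hd_append2)
        then show False using rigid_series_hd(1)[OF ne Gs] by blast
      qed
      then show ?thesis using Xs by simp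
    qed
  qed
  have b: "rational_series_max G Gs \<and> no_abelian_jumps G Gs \<and> CO (sub G (hd Gs)) = {} \<longleftrightarrow> rigid_series Gs" for Gs
    using rigid max by (auto simp: rational_series_max_def)
  have c: "rational_series_max G Gs \<and> (\<forall>Ks. rational_series_max G Ks \<longrightarrow> Ks = Gs) \<and>
      no_abelian_jumps G Gs \<and> CO (sub G (hd Gs)) = {} \<longleftrightarrow> rigid_series Gs" for Gs
    using b max_unique by blast
  have d: "rational_series G Gs \<and> hd Gs = C0 G \<and> no_abelian_jumps G Gs \<longleftrightarrow> rigid_series Gs" for Gs
    using rigid[of Gs] CO_hd[of Gs] all_cones_C0_empty[OF ne] rigid_series_hd(1)[OF ne] by auto
  have e: "rational_series G Gs \<and> hd Gs = C0 G \<and> (\<forall>Ks. rational_series G Ks \<and> hd Ks = C0 G \<longrightarrow> Ks = Gs) \<and>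
      no_abelian_jumps G Gs \<longleftrightarrow> rigid_series Gs" for Gs
    using d hd_unique by blast
  obtain P where P: "conrad_cone G (carrier G) (C0 G) P" "P \<noteq> {}" using cone_C0[OF ne] by blast
  \<comment> \<open>Isolation is applied to the preorder of one cone relative to
    \<open>C0 G\<close>, so that the series it produces starts at a group without cones.\<close>
  have 1: "\<exists>Gs. rigid_series Gs" if "\<forall>R\<in>CO G. isolated_point (CO_topology G) R"
    using isolated_point_cone[OF _ P] that cone_CO(1)[OF P] isolated_rigid_series[OF ne] by blast
  have 2: "\<exists>Gs. rigid_series Gs" if "finite (CO_rel G (C0 G))"
    using finite_CO_rel_isolated[OF that P] isolated_rigid_series[OF ne] by blast
  have 3: "finite (CO G)" if "\<exists>Gs. rigid_series Gs" using that rigid_series_card(1)[OF ne] by blast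
  have 4: "finite (CO_rel G (C0 G))" if "finite (CO G)"
    by (rule finite_subset[OF _ that]) (auto simp: CO_rel_def)
  have a: "(\<forall>R\<in>CO G. isolated_point (CO_topology G) R) \<longleftrightarrow> (\<exists>Gs. rigid_series Gs)"
    using 1 3 finite_CO_isolated by blast
  have f: "finite (CO_rel G (C0 G)) \<longleftrightarrow> (\<exists>Gs. rigid_series Gs)" using 2 3 4 by blast
  have g: "finite (CO G) \<longleftrightarrow> (\<exists>Gs. rigid_series Gs)" using 2 3 4 by blast
  show ?thesis
    unfolding Let_def b c d e a f g using rigid_series_card(2,3)[OF ne] by simp
qed

end
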